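(* Let $X$ be a non-trivial complex Banach space and let $T\in\mathcal{D}'_{L^1}(X)$. Then the following assertions are equivalent: (i) $T\in B'_{AAA}(X)$. (ii) $T*\varphi\in AAA(\mathbb{R}:X)$ for all $\varphi\in\mathcal{D}_0$. (iii) There exist an integer $k\in\mathbb{N}$ and asymptotically almost automorphic functions $f_j:\mathbb{R}\to X$ ($0\le j\le k$) such that $T=\sum_{j=0}^kf_j^{(j)}$ on $[0,\infty)$. (iv) There exist an integer $k\in\mathbb{N}$ and bounded asymptotically almost automorphic functions $f_j:\mathbb{R}\to X$ ($0\le j\le k$) such that $T=\sum_{j=0}^kf_j^{(j)}$ on $[0,\infty)$. (v) There exist $S\in\mathcal{D}'_{L^1}(X)$, $k\in\mathbb{N}$ and bounded asymptotically almost automorphic functions $f_j:\mathbb{R}\to X$ ($0\le j\le k$) such that $S=\sum_{j=0}^kf_j^{(j)}$ on $\mathbb{R}$, and $\langle S,\varphi\rangle=\langle T,\varphi\rangle$ for all $\varphi\in\mathcal{D}_0$. (vi) There exists $S\in\mathcal{D}'_{L^1}(X)$ such that $\langle S,\varphi\rangle=\langle T,\varphi\rangle$ for all $\varphi\in\mathcal{D}_0$ and $S*\varphi\in AAA(\mathbb{R}:X)$ for all $\varphi\in\mathcal{D}$. (vii) There exists a sequence $(T_n)$ in $\mathcal{E}(X)\cap AAA(\mathbb{R}:X)$ such that $\lim_{n\to\infty}T_n=T$ in $\mathcal{D}'_{L^1}(X)$. (viii) $T*\varphi\in AAA(\mathbb{R}:X)$ for all $\varphi\in\mathcal{D}$.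
   Context: $\mathcal{D}$ is the Schwartz space of complex-valued compactly supported smooth functions on $\mathbb{R}$; $\mathcal{D}_0:=\{\varphi\in\mathcal{D}:\operatorname{supp}\varphi\subseteq[0,\infty)\}$; $\mathcal{E}(X)$ is the space of all infinitely differentiable functions $\mathbb{R}\to X$. $\mathcal{D}_{L^1}$ is the Fréchet space of $f\in C^\infty(\mathbb{R})$ with $f^{(j)}\in L^1(\mathbb{R})$ for all $j\in\mathbb{N}_0$, with seminorms $\|f\|_k=\sum_{j=0}^k\|f^{(j)}\|_{L^1}$. $\mathcal{D}'_{L^1}(X)$ (bounded $X$-valued distributions) is the space of continuous linear maps $\mathcal{D}_{L^1}\to X$, with the strong topology (uniform convergence on bounded sets). Functions are identified with regular distributions; derivatives $f_j^{(j)}$ are distributional. An equality of distributions "on $[0,\infty)$" means equality when tested against all $\varphi\in\mathcal{D}_0$. Convolution: $(T*\varphi)(x)=\langle T,\varphi(x-\cdot)\rangle$; translation: $\langle T_h,\varphi\rangle:=\langle T,\varphi(\cdot-h)\rangle$. A bounded continuous $f:\mathbb{R}\to X$ is almost automorphic ($f\in AA(\mathbb{R}:X)$) if every real sequence $(b_n)$ has a subsequence $(a_n)$ and there is a map $g:\mathbb{R}\to X$ with $\lim_nf(t+a_n)=g(t)$ and $\lim_ng(t-a_n)=f(t)$ pointwise for $t\in\mathbb{R}$. $C_0([0,\infty):X)$ is the space of bounded continuous functions $[0,\infty)\to X$ vanishing at $+\infty$. A continuous $f:\mathbb{R}\to X$ is asymptotically almost automorphic ($f\in AAA(\mathbb{R}:X)$)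 if there are $g\in AA(\mathbb{R}:X)$ and $q\in C_0([0,\infty):X)$ with $f(t)=g(t)+q(t)$ for $t\ge0$ (no boundedness is required for $t<0$). $B'_{+,0}(X):=\{T\in\mathcal{D}'_{L^1}(X):\lim_{h\to+\infty}\langle T_h,\varphi\rangle=0\ \forall\varphi\in\mathcal{D}\}$. $B'_{AA}(X)$ is the space of almost automorphic distributions: $T\in\mathcal{D}'_{L^1}(X)$ with $T*\varphi\in AA(\mathbb{R}:X)$ for all $\varphi\in\mathcal{D}$. $B'_{AAA}(X)$ is the space of asymptotically almost automorphic distributions: $T\in\mathcal{D}'_{L^1}(X)$ for which there exist $T_{aa}\in B'_{AA}(X)$ and $Q\in B'_{+,0}(X)$ with $\langle T,\varphi\rangle=\langle T_{aa},\varphi\rangle+\langle Q,\varphi\rangle$ for all $\varphi\in\mathcal{D}_0$. *)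

theory Defs
  imports "HOL-Analysis.Analysis"
begin

text \<open>The class \<open>banach\<close> is about real scalars. A complex Banach space is a real one
  with a complex scalar multiplication that extends the real one and for which the norm is
  absolutely homogeneous.\<close>

class complex_banach = banach +
  fixes scaleC :: "complex \<Rightarrow> 'a \<Rightarrow> 'a"  (infixr \<open>*\<^sub>C\<close> 75)
  assumes scaleC_add_right: "c *\<^sub>C (x + y) = c *\<^sub>C x + c *\<^sub>C y"
    and scaleC_add_left: "(c + d) *\<^sub>C x = c *\<^sub>C x + d *\<^sub>C x"
    and scaleC_scaleC: "c *\<^sub>C d *\<^sub>C x = (c * d) *\<^sub>C x"
    and scaleC_of_real: "complex_of_real r *\<^sub>C x = r *\<^sub>R x"
    and norm_scaleC: "norm (c *\<^sub>C x) = cmod c * norm x"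

instantiation complex :: complex_banach
begin

definition "scaleC_complex (c :: complex) x = c * x"

instance
  by standard (simp_all add: scaleC_complex_def algebra_simps norm_mult scaleR_conv_of_real)

end

definition nth_vderiv :: "nat \<Rightarrow> (real \<Rightarrow> 'a::real_normed_vector) \<Rightarrow> real \<Rightarrow> 'a" where
  "nth_vderiv j = (\<lambda>g t. vector_derivative g (at t)) ^^ j"

definition smooth_funs :: "(real \<Rightarrow> 'a::real_normed_vector) set" where
  "smooth_funs = {f. \<forall>j t. nth_vderiv j f differentiable (at t)}"

definition supp :: "(real \<Rightarrow> 'a::zero) \<Rightarrow> real set" where
  "supp f = closure {t. f t \<noteq> 0}"

definition test_D :: "(real \<Rightarrow> complex) set" where
  "test_D = {\<phi> \<in> smooth_funs. compact (supp \<phi>)}"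

definition test_D0 :: "(real \<Rightarrow> complex) set" where
  "test_D0 = {\<phi> \<in> test_D. supp \<phi> \<subseteq> {0..}}"

definition DL1 :: "(real \<Rightarrow> complex) set" where
  "DL1 = {\<phi> \<in> smooth_funs. \<forall>j. integrable lborel (nth_vderiv j \<phi>)}"

definition DL1_seminorm :: "nat \<Rightarrow> (real \<Rightarrow> complex) \<Rightarrow> real" where
  "DL1_seminorm k \<phi> = (\<Sum>j\<le>k. \<integral>t. cmod (nth_vderiv j \<phi> t) \<partial>lborel)"

definition DL1_ball :: "nat \<Rightarrow> (real \<Rightarrow> complex) \<Rightarrow> real \<Rightarrow> (real \<Rightarrow> complex) set" where
  "DL1_ball k \<phi> r = {\<psi> \<in> DL1. DL1_seminorm k (\<lambda>t. \<psi> t - \<phi> t) < r}"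

definition DL1_topology :: "(real \<Rightarrow> complex) topology" where
  "DL1_topology = topology_generated_by {DL1_ball k \<phi> r | k \<phi> r. \<phi> \<in> DL1 \<and> 0 < r}"

definition DL1_bounded :: "(real \<Rightarrow> complex) set \<Rightarrow> bool" where
  "DL1_bounded B \<longleftrightarrow> B \<subseteq> DL1 \<and> (\<forall>k. bdd_above (DL1_seminorm k ` B))"

text \<open>A distribution is represented by a total function on \<open>real \<Rightarrow> complex\<close>, of which only the
  restriction to the relevant space of test functions is meaningful.\<close>

type_synonym 'x distr = "(real \<Rightarrow> complex) \<Rightarrow> 'x"

definition DL1' :: "'x::complex_banach distr set" where
  "DL1' = {T. (\<forall>\<phi>\<in>DL1. \<forall>\<psi>\<in>DL1. T (\<lambda>t. \<phi> t + \<psi> t) = T \<phi> + T \<psi>)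
            \<and> (\<forall>c. \<forall>\<phi>\<in>DL1. T (\<lambda>t. c * \<phi> t) = c *\<^sub>C T \<phi>)
            \<and> continuous_map DL1_topology euclidean T}"

definition DL1'_tendsto :: "(nat \<Rightarrow> 'x::complex_banach distr) \<Rightarrow> 'x distr \<Rightarrow> bool" where
  "DL1'_tendsto Tn T \<longleftrightarrow> (\<forall>B. DL1_bounded B \<longrightarrow> uniform_limit B Tn T sequentially)"

text \<open>The Henstock-Kurzweil integral is used because the Bochner integral of the library
  requires a separable codomain. The integrands of interest are continuous with compact
  support.\<close>

definition regular_distr :: "(real \<Rightarrow> 'x::complex_banach) \<Rightarrow> 'x distr" where
  "regular_distr f \<phi> = integral UNIV (\<lambda>t. \<phi> t *\<^sub>C f t)"

definition distr_deriv :: "'x::complex_banach distr \<Rightarrow> 'x distr" where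
  "distr_deriv U \<phi> = - U (\<lambda>t. vector_derivative \<phi> (at t))"

definition translate_distr :: "real \<Rightarrow> 'x distr \<Rightarrow> 'x distr" where
  "translate_distr h T \<phi> = T (\<lambda>t. \<phi> (t - h))"

definition conv_distr :: "'x distr \<Rightarrow> (real \<Rightarrow> complex) \<Rightarrow> real \<Rightarrow> 'x" where
  "conv_distr T \<phi> x = T (\<lambda>t. \<phi> (x - t))"

definition AA :: "(real \<Rightarrow> 'x::real_normed_vector) set" where
  "AA = {f. continuous_on UNIV f \<and> bounded (range f) \<and>
     (\<forall>b :: nat \<Rightarrow> real. \<exists>r :: nat \<Rightarrow> nat. strict_mono r \<and> (\<exists>g :: real \<Rightarrow> 'x. \<forall>t.
        (\<lambda>n. f (t + b (r n))) \<longlonglongrightarrow> g t \<and> (\<lambda>n. g (t - b (r n))) \<longlonglongrightarrow> f t))}"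

definition C0_half_line :: "(real \<Rightarrow> 'x::real_normed_vector) set" where
  "C0_half_line = {q. continuous_on {0..} q \<and> bounded (q ` {0..}) \<and> (q \<longlongrightarrow> 0) at_top}"

definition AAA :: "(real \<Rightarrow> 'x::real_normed_vector) set" where
  "AAA = {f. continuous_on UNIV f \<and> (\<exists>g\<in>AA. \<exists>q\<in>C0_half_line. \<forall>t\<ge>0. f t = g t + q t)}"

definition B'_plus_0 :: "'x::complex_banach distr set" where
  "B'_plus_0 = {T \<in> DL1'. \<forall>\<phi>\<in>test_D. ((\<lambda>h. translate_distr h T \<phi>) \<longlongrightarrow> 0) at_top}"

definition B'_AA :: "'x::complex_banach distr set" where
  "B'_AA = {T \<in> DL1'. \<forall>\<phi>\<in>test_D. conv_distr T \<phi> \<in> AA}"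

definition B'_AAA :: "'x::complex_banach distr set" where
  "B'_AAA = {T \<in> DL1'. \<exists>T\<^sub>a\<^sub>a\<in>B'_AA. \<exists>Q\<in>B'_plus_0. \<forall>\<phi>\<in>test_D0. T \<phi> = T\<^sub>a\<^sub>a \<phi> + Q \<phi>}"

end

theory Submission
  imports Defs "HOL-Computational_Algebra.Polynomial" "HOL-Library.Diagonal_Subsequence"
begin

text \<open>
  A bounded distribution \<open>T\<close> has finite order: \<open>norm (T \<phi>)\<close> is dominated by a single seminorm, of some
  order \<open>k\<close> (\<open>DL1'_bound\<close>). Four arguments give all the equivalences.

  Structure. The map \<open>\<phi> \<mapsto> \<phi> - \<phi>'\<close> is inverted on the test functions by convolution with a one-sided
  exponential, the resolvent, which is a contraction in \<open>L\<^sup>1\<close> and gains one derivative. Hence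
  \<open>F = T \<circ> resolvent\<^bsup>k+1\<^esup>\<close> is dominated by the \<open>L\<^sup>1\<close> norm of \<open>resolvent \<phi>\<close>, which makes \<open>F\<close> a bounded
  continuous function \<open>f\<close>, and \<open>T\<close> is obtained from \<open>f\<close> by applying \<open>U \<mapsto> U + U'\<close> \<open>k + 1\<close> times
  (\<open>bounded_distr_structure\<close>, \<open>distr_id_minus_deriv_funpow\<close>). Because the exponential is one-sided, \<open>f\<close>
  is a uniform limit of functions \<open>T * \<phi>\<close> with \<open>\<phi>\<close> supported in \<open>[0, \<infinity>)\<close>. If these are asymptotically
  almost automorphic, then so is \<open>f\<close> (\<open>AAA_uniform_limit\<close>). So (ii) implies that \<open>T\<close> itself, on the
  whole line, is a sum of derivatives of bounded functions in \<open>AAA\<close>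
  (\<open>conv_distr_AAA_imp_derivatives\<close>), which contains (iii), (iv) and (v).

  Splitting. If \<open>T = \<Sum> f\<^sub>j\<^bsup>(j)\<^esup>\<close> on \<open>[0, \<infinity>)\<close> and \<open>f\<^sub>j = g\<^sub>j + q\<^sub>j\<close> there, then \<open>\<Sum> g\<^sub>j\<^bsup>(j)\<^esup>\<close> is an almost
  automorphic distribution and \<open>\<Sum> q\<^sub>j\<^bsup>(j)\<^esup>\<close> vanishes at \<open>+\<infinity>\<close>; this is (i)
  (\<open>AAA_derivatives_imp_B'_AAA\<close>). It rests on the fact that \<open>g * \<phi>\<close> is almost automorphic when \<open>g\<close> is
  (\<open>conv_distr_regular_AA\<close>).

  Localization at \<open>+\<infinity>\<close>. A continuous function is in \<open>AAA\<close> as soon as it differs from an almost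
  automorphic one by a function that tends to \<open>0\<close> at \<open>+\<infinity>\<close>, and for large \<open>x\<close> the value \<open>(T * \<phi>)(x)\<close>
  depends only on the action of \<open>T\<close> on test functions supported in \<open>[0, \<infinity>)\<close>. So (i) implies (viii)
  (\<open>B'_AAA_conv_distr\<close>), and \<open>S\<close> in (vi) may be replaced by \<open>T\<close> (\<open>conv_distr_AAA_transfer\<close>).

  Approximation. The mollifications of \<open>T\<close> are functions of the form \<open>T * \<phi>\<close> and converge to \<open>T\<close>
  strongly (\<open>DL1'_tendsto_mollify\<close>). Conversely, strong convergence \<open>T\<^sub>n \<rightarrow> T\<close> is uniform on the
  bounded set of translates of a test function, so \<open>T\<^sub>n * \<phi> \<rightarrow> T * \<phi>\<close> uniformly
  (\<open>conv_distr_AAA_limit\<close>). This settles (vii).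
\<close>

section \<open>Smooth functions\<close>

lemma nth_vderiv_0 [simp]: "nth_vderiv 0 f = f"
  by (simp add: nth_vderiv_def)

lemma nth_vderiv_Suc: "nth_vderiv (Suc j) f = (\<lambda>t. vector_derivative (nth_vderiv j f) (at t))"
  by (simp add: nth_vderiv_def)

lemma nth_vderiv_add_index: "nth_vderiv i (nth_vderiv j f) = nth_vderiv (i + j) f"
  by (simp add: nth_vderiv_def funpow_add)

lemma smooth_has_vderiv:
  assumes "f \<in> smooth_funs"
  shows "(nth_vderiv j f has_vector_derivative nth_vderiv (Suc j) f t) (at t)"
  using assms by (simp add: smooth_funs_def nth_vderiv_Suc vector_derivative_works)

lemma smooth_has_vderiv_0:
  assumes "f \<in> smooth_funs"
  shows "(f has_vector_derivative nth_vderiv 1 f t) (at t)"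
  using smooth_has_vderiv[OF assms, of 0 t] by simp

lemma smooth_nth_vderiv: "f \<in> smooth_funs \<Longrightarrow> nth_vderiv j f \<in> smooth_funs"
  by (simp add: smooth_funs_def nth_vderiv_add_index)

lemma smooth_continuous_on: "f \<in> smooth_funs \<Longrightarrow> continuous_on S (nth_vderiv j f)"
  by (intro continuous_at_imp_continuous_on ballI has_vector_derivative_continuous[OF smooth_has_vderiv])

lemma smooth_continuous: "f \<in> smooth_funs \<Longrightarrow> continuous_on S f"
  using smooth_continuous_on[of f S 0] by simp

text \<open>Smoothness has two sources below: a complete list of the derivatives, or a class of
  functions that differentiation does not leave.\<close>

lemma smooth_tower:
  assumes "\<And>j t. (d j has_vector_derivative d (Suc j) t) (at t)"
  shows "nth_vderiv j (d 0) = d j" and "d 0 \<in> smooth_funs"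
proof -
  show *: "nth_vderiv j (d 0) = d j" for j
  proof (induction j)
    case (Suc j)
    then show ?case
      using assms[of j] by (auto simp: nth_vderiv_Suc intro!: ext vector_derivative_at)
  qed simp
  show "d 0 \<in> smooth_funs"
    using assms by (auto simp: smooth_funs_def * intro: differentiableI_vector)
qed

lemma smooth_coinduct:
  assumes "f \<in> C"
    and "\<And>g. g \<in> C \<Longrightarrow> \<exists>g'\<in>C. \<forall>t. (g has_vector_derivative g' t) (at t)"
  shows "f \<in> smooth_funs"
proof -
  have "nth_vderiv j f \<in> C" for j
  proof (induction j)
    case 0
    then show ?case using assms(1) by simp
  next
    case (Suc j)
    then obtain g' where g': "g' \<in> C" "\<And>t. (nth_vderiv j f has_vector_derivative g' t) (at t)"
      using assms(2) by blast
    then have "nth_vderiv (Suc j) f = g'"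
      by (auto simp: nth_vderiv_Suc intro!: ext vector_derivative_at)
    then show ?case using g' by simp
  qed
  then have "\<exists>g'. \<forall>t. (nth_vderiv j f has_vector_derivative g' t) (at t)" for j
    using assms(2) by blast
  then show ?thesis
    unfolding smooth_funs_def using differentiableI_vector by blast
qed

lemma
  assumes f: "f \<in> smooth_funs" and g: "g \<in> smooth_funs"
  shows smooth_add: "(\<lambda>t. f t + g t) \<in> smooth_funs"
    and nth_vderiv_add: "nth_vderiv j (\<lambda>t. f t + g t) = (\<lambda>t. nth_vderiv j f t + nth_vderiv j g t)"
  using smooth_tower[of "\<lambda>j t. nth_vderiv j f t + nth_vderiv j g t",
    OF has_vector_derivative_add[OF smooth_has_vderiv[OF f] smooth_has_vderiv[OF g]]]
  by simp_all

lemma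
  fixes f :: "real \<Rightarrow> complex"
  assumes f: "f \<in> smooth_funs"
  shows smooth_cmult: "(\<lambda>t. c * f t) \<in> smooth_funs"
    and nth_vderiv_cmult: "nth_vderiv j (\<lambda>t. c * f t) = (\<lambda>t. c * nth_vderiv j f t)"
  using smooth_tower[of "\<lambda>j t. c * nth_vderiv j f t",
    OF has_vector_derivative_mult_right[OF smooth_has_vderiv[OF f]]]
  by simp_all

lemma
  assumes f: "f \<in> smooth_funs" and g: "g \<in> smooth_funs"
  shows smooth_diff: "(\<lambda>t. f t - g t) \<in> smooth_funs"
    and nth_vderiv_diff: "nth_vderiv j (\<lambda>t. f t - g t) = (\<lambda>t. nth_vderiv j f t - nth_vderiv j g t)"
  using smooth_tower[of "\<lambda>j t. nth_vderiv j f t - nth_vderiv j g t",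
    OF has_vector_derivative_diff[OF smooth_has_vderiv[OF f] smooth_has_vderiv[OF g]]]
  by simp_all

lemma
  fixes f :: "real \<Rightarrow> 'a::real_normed_vector"
  assumes f: "f \<in> smooth_funs"
  shows smooth_affine: "(\<lambda>t. f (a * t + b)) \<in> smooth_funs"
    and nth_vderiv_affine:
      "nth_vderiv j (\<lambda>t. f (a * t + b)) = (\<lambda>t. a ^ j *\<^sub>R nth_vderiv j f (a * t + b))"
proof -
  have "((\<lambda>t. a ^ j *\<^sub>R nth_vderiv j f (a * t + b)) has_vector_derivative
      a ^ Suc j *\<^sub>R nth_vderiv (Suc j) f (a * t + b)) (at t)" for j t
  proof -
    have "((\<lambda>t. a * t + b) has_vector_derivative a) (at t)"
      by (auto intro!: derivative_eq_intros simp: has_real_derivative_iff_has_vector_derivative[symmetric])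
    from vector_diff_chain_at[OF this smooth_has_vderiv[OF f, of j]]
    have "((\<lambda>t. nth_vderiv j f (a * t + b)) has_vector_derivative
        a *\<^sub>R nth_vderiv (Suc j) f (a * t + b)) (at t)"
      by (simp add: o_def)
    from has_vector_derivative_scaleR[OF DERIV_const[of "a ^ j"] this] show ?thesis
      by (simp add: algebra_simps)
  qed
  note * = smooth_tower[of "\<lambda>j t. a ^ j *\<^sub>R nth_vderiv j f (a * t + b)", OF this]
  from * show "(\<lambda>t. f (a * t + b)) \<in> smooth_funs"
    "nth_vderiv j (\<lambda>t. f (a * t + b)) = (\<lambda>t. a ^ j *\<^sub>R nth_vderiv j f (a * t + b))"
    by simp_all
qed

text \<open>By the product rule, differentiation does not leave the sums of products; this replaces
  Leibniz' formula.\<close>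

inductive_set sums_of_products :: "(real \<Rightarrow> complex) set" where
  prod: "f \<in> smooth_funs \<Longrightarrow> g \<in> smooth_funs \<Longrightarrow> (\<lambda>t. f t * g t) \<in> sums_of_products"
| add: "u \<in> sums_of_products \<Longrightarrow> v \<in> sums_of_products \<Longrightarrow> (\<lambda>t. u t + v t) \<in> sums_of_products"

lemma smooth_mult:
  fixes f g :: "real \<Rightarrow> complex"
  assumes "f \<in> smooth_funs" "g \<in> smooth_funs"
  shows "(\<lambda>t. f t * g t) \<in> smooth_funs"
proof (rule smooth_coinduct)
  show "(\<lambda>t. f t * g t) \<in> sums_of_products"
    using assms by (rule sums_of_products.prod)
next
  fix u assume "u \<in> sums_of_products"
  then show "\<exists>u'\<in>sums_of_products. \<forall>t. (u has_vector_derivative u' t) (at t)"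
  proof induction
    case (prod f g)
    have "(\<lambda>t. f t * nth_vderiv 1 g t + nth_vderiv 1 f t * g t) \<in> sums_of_products"
      using prod by (intro sums_of_products.intros smooth_nth_vderiv)
    moreover have "((\<lambda>t. f t * g t) has_vector_derivative f t * nth_vderiv 1 g t + nth_vderiv 1 f t * g t) (at t)"
      for t using prod by (intro has_vector_derivative_mult smooth_has_vderiv_0)
    ultimately show ?case
      by (intro bexI[where x = "\<lambda>t. f t * nth_vderiv 1 g t + nth_vderiv 1 f t * g t"] allI)
  next
    case (add u v)
    then obtain u' v' where "u' \<in> sums_of_products" "v' \<in> sums_of_products"
      "\<forall>t. (u has_vector_derivative u' t) (at t)" "\<forall>t. (v has_vector_derivative v' t) (at t)"
      by blast
    then show ?case
      by (intro bexI[of _ "\<lambda>t. u' t + v' t"]) (auto intro: has_vector_derivative_add sums_of_products.add)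
  qed
qed

text \<open>All derivatives of \<open>exp (-1/t)\<close> on the right half-line are a polynomial in \<open>1/t\<close> times
  \<open>exp (-1/t)\<close>, hence flat at \<open>0\<close>; so the functions of this form, extended by \<open>0\<close>, make a class
  that is closed under differentiation.\<close>

definition flat_exp :: "real poly \<Rightarrow> real \<Rightarrow> complex" where
  "flat_exp p t = (if t > 0 then of_real (poly p (1 / t) * exp (- 1 / t)) else 0)"

lemma poly_over_exp_tendsto_0: "((\<lambda>x. poly p x / exp x) \<longlongrightarrow> (0::real)) at_top"
proof -
  have "((\<lambda>x. \<Sum>i\<le>degree p. coeff p i * (x ^ i / exp x)) \<longlongrightarrow> (\<Sum>i\<le>degree p. coeff p i * 0)) at_top"
    by (intro tendsto_sum tendsto_mult tendsto_const tendsto_power_div_exp_0)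
  then show ?thesis
    by (simp add: poly_altdef sum_divide_distrib)
qed

lemma flat_exp_has_vderiv:
  "(flat_exp p has_vector_derivative flat_exp ([:0, 0, 1:] * (p - pderiv p)) t) (at t)"
proof -
  consider "t > 0" | "t < 0" | "t = 0" by linarith
  then show ?thesis
  proof cases
    case 1
    have "((\<lambda>t. poly p (1 / t) * exp (- 1 / t)) has_real_derivative
        (poly ([:0, 0, 1:] * (p - pderiv p)) (1 / t) * exp (- 1 / t))) (at t)"
      using 1 by (auto intro!: derivative_eq_intros poly_DERIV simp: field_simps power2_eq_square)
    then have "((\<lambda>t. complex_of_real (poly p (1 / t) * exp (- 1 / t))) has_vector_derivative
        of_real (poly ([:0, 0, 1:] * (p - pderiv p)) (1 / t) * exp (- 1 / t))) (at t)"
      by (intro has_vector_derivative_of_real)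
         (simp add: has_real_derivative_iff_has_vector_derivative)
    then have "((\<lambda>t. complex_of_real (poly p (1 / t) * exp (- 1 / t))) has_vector_derivative
        flat_exp ([:0, 0, 1:] * (p - pderiv p)) t) (at t)"
      using 1 by (simp add: flat_exp_def)
    then show ?thesis
      by (rule has_vector_derivative_transform_within_open[where S = "{0<..}"])
         (use 1 in \<open>auto simp: flat_exp_def\<close>)
  next
    case 2
    have "((\<lambda>t. 0) has_vector_derivative flat_exp ([:0, 0, 1:] * (p - pderiv p)) t) (at t)"
      using 2 by (simp add: flat_exp_def has_vector_derivative_const)
    then show ?thesis
      by (rule has_vector_derivative_transform_within_open[where S = "{..<0}"])
         (use 2 in \<open>auto simp: flat_exp_def\<close>)
  next
    case 3
    \<comment> \<open>The difference quotient at the origin is again a polynomial in \<open>1/h\<close> times \<open>exp (-1/h)\<close>.\<close>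
    have R: "((\<lambda>h. poly ([:0, 1:] * p) (1 / h) * exp (- 1 / h)) \<longlongrightarrow> 0) (at_right 0)"
    proof -
      have "((\<lambda>x. poly ([:0, 1:] * p) x / exp x) \<longlongrightarrow> (0::real)) at_top"
        by (rule poly_over_exp_tendsto_0)
      from filterlim_compose[OF this filterlim_inverse_at_top_right] show ?thesis
        by (simp add: exp_minus divide_inverse)
    qed
    have "((\<lambda>h. norm (flat_exp p h) / \<bar>h\<bar>) \<longlongrightarrow> 0) (at 0)"
    proof (rule filterlim_split_at)
      have "0 = norm (flat_exp p h) / \<bar>h\<bar>" if "h < 0" for h
        using that by (simp add: flat_exp_def)
      then have "\<forall>\<^sub>F h in at_left 0. 0 = norm (flat_exp p h) / \<bar>h\<bar>"
        by (simp add: eventually_at_filter)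
      then show "((\<lambda>h. norm (flat_exp p h) / \<bar>h\<bar>) \<longlongrightarrow> 0) (at_left 0)"
        by (rule Lim_transform_eventually[OF tendsto_const])
      have "\<bar>poly ([:0, 1:] * p) (1 / h) * exp (- 1 / h)\<bar> = norm (flat_exp p h) / \<bar>h\<bar>" if "h > 0" for h
        using that by (simp add: flat_exp_def abs_mult norm_mult)
      then have "\<forall>\<^sub>F h in at_right 0. \<bar>poly ([:0, 1:] * p) (1 / h) * exp (- 1 / h)\<bar> = norm (flat_exp p h) / \<bar>h\<bar>"
        by (simp add: eventually_at_filter)
      from Lim_transform_eventually[OF tendsto_rabs[OF R] this]
      show "((\<lambda>h. norm (flat_exp p h) / \<bar>h\<bar>) \<longlongrightarrow> 0) (at_right 0)"
        by simp
    qed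
    then show ?thesis
      using 3 by (simp add: has_vector_derivative_def has_derivative_at flat_exp_def)
  qed
qed

lemma flat_exp_smooth: "flat_exp p \<in> smooth_funs"
proof (rule smooth_coinduct)
  fix g assume "g \<in> range flat_exp"
  then obtain q where "g = flat_exp q" by blast
  then show "\<exists>g'\<in>range flat_exp. \<forall>t. (g has_vector_derivative g' t) (at t)"
    using flat_exp_has_vderiv[of q] by (intro bexI[OF _ rangeI] allI) auto
qed simp

section \<open>Test functions\<close>

lemma zero_outside_supp: "t \<notin> supp f \<Longrightarrow> f t = 0"
  using closure_subset[of "{t. f t \<noteq> 0}"] by (auto simp: supp_def)

lemma supp_subset: "closed S \<Longrightarrow> (\<And>t. f t \<noteq> 0 \<Longrightarrow> t \<in> S) \<Longrightarrow> supp f \<subseteq> S"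
  unfolding supp_def by (rule closure_minimal) auto

lemma nth_vderiv_eq_0_open:
  assumes "open S" "t \<in> S" "\<And>s. s \<in> S \<Longrightarrow> f s = 0"
  shows "nth_vderiv j f t = 0"
proof -
  have "\<forall>t\<in>S. nth_vderiv j f t = 0"
  proof (induction j)
    case (Suc j)
    show ?case
    proof
      fix t assume t: "t \<in> S"
      have "(nth_vderiv j f has_vector_derivative 0) (at t)"
        by (rule has_vector_derivative_transform_within_open[OF has_vector_derivative_const[of 0] assms(1) t])
           (use Suc in auto)
      then show "nth_vderiv (Suc j) f t = 0"
        by (simp add: nth_vderiv_Suc vector_derivative_at)
    qed
  qed (use assms(3) in simp)
  then show ?thesis using assms(2) by simp
qed

lemma nth_vderiv_outside_supp: "t \<notin> supp f \<Longrightarrow> nth_vderiv j f t = 0"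
  by (rule nth_vderiv_eq_0_open[of "- supp f"])
    (simp_all only: supp_def open_Compl closed_closure Compl_iff zero_outside_supp[unfolded supp_def] not_False_eq_True)

lemma test_DI:
  assumes "f \<in> smooth_funs" "\<And>t. f t \<noteq> 0 \<Longrightarrow> \<bar>t\<bar> \<le> R"
  shows "f \<in> test_D"
proof -
  have "supp f \<subseteq> {-R..R}"
    by (rule supp_subset) (use assms(2) in \<open>force simp: abs_le_iff\<close>)+
  then have "compact (supp f)"
    using compact_Int_closed[OF compact_Icc[of "-R" R], of "supp f"]
    by (simp add: supp_def inf.absorb2)
  then show ?thesis using assms by (simp add: test_D_def)
qed

lemma test_DE:
  assumes "f \<in> test_D"
  obtains R where "R > 0" "\<And>j t. \<bar>t\<bar> \<ge> R \<Longrightarrow> nth_vderiv j f t = 0"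
proof -
  have "bounded (supp f)" using assms by (simp add: test_D_def compact_imp_bounded)
  then obtain R where R: "\<And>t. t \<in> supp f \<Longrightarrow> \<bar>t\<bar> \<le> R"
    unfolding bounded_iff by auto
  show ?thesis
  proof (rule that[of "\<bar>R\<bar> + 1"])
    fix j t assume "\<bar>R\<bar> + 1 \<le> \<bar>t\<bar>"
    then have "t \<notin> supp f" using R[of t] by linarith
    then show "nth_vderiv j f t = 0" by (rule nth_vderiv_outside_supp)
  qed simp
qed

lemma test_D_smooth: "f \<in> test_D \<Longrightarrow> f \<in> smooth_funs"
  by (simp add: test_D_def)

lemma test_D_affine:
  assumes "f \<in> test_D" "a \<noteq> 0"
  shows "(\<lambda>t. f (a * t + b)) \<in> test_D"
proof -
  obtain R where R: "R > 0" "\<And>j t. \<bar>t\<bar> \<ge> R \<Longrightarrow> nth_vderiv j f t = 0"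
    using test_DE[OF assms(1)] by metis
  show ?thesis
  proof (rule test_DI)
    show "(\<lambda>t. f (a * t + b)) \<in> smooth_funs"
      using assms by (intro smooth_affine test_D_smooth)
    fix t assume "f (a * t + b) \<noteq> 0"
    then have "\<bar>a * t + b\<bar> < R" using R(2)[of "a * t + b" 0] by force
    then have "\<bar>a\<bar> * \<bar>t\<bar> \<le> R + \<bar>b\<bar>" by (simp add: abs_mult[symmetric])
    then show "\<bar>t\<bar> \<le> (R + \<bar>b\<bar>) / \<bar>a\<bar>"
      using assms(2) by (simp add: field_simps)
  qed
qed

lemma test_D_nth_vderiv:
  assumes "f \<in> test_D" shows "nth_vderiv j f \<in> test_D"
proof -
  obtain R where R: "R > 0" "\<And>j t. \<bar>t\<bar> \<ge> R \<Longrightarrow> nth_vderiv j f t = 0"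
    using test_DE[OF assms] by metis
  show ?thesis
  proof (rule test_DI)
    show "nth_vderiv j f \<in> smooth_funs"
      using assms by (intro smooth_nth_vderiv test_D_smooth)
    show "\<bar>t\<bar> \<le> R" if "nth_vderiv j f t \<noteq> 0" for t
      using R(2)[of t j] that by linarith
  qed
qed

lemma continuous_vanishing_integrable:
  fixes f :: "real \<Rightarrow> 'b::{banach, second_countable_topology}"
  assumes "continuous_on UNIV f" "\<And>t. \<bar>t\<bar> \<ge> R \<Longrightarrow> f t = 0"
  shows "integrable lborel f"
proof -
  have "integrable lborel (\<lambda>x. indicator {-R..R} x *\<^sub>R f x)"
    using assms(1) by (intro borel_integrable_compact) (auto intro: continuous_on_subset)
  moreover have "(\<lambda>x. indicator {-R..R} x *\<^sub>R f x) = f"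
  proof
    fix x show "indicator {-R..R} x *\<^sub>R f x = f x"
      using assms(2)[of x] by (cases "x \<in> {-R..R}") auto
  qed
  ultimately show ?thesis by simp
qed

lemma test_D_subset_DL1: "test_D \<subseteq> DL1"
proof
  fix f assume f: "f \<in> test_D"
  obtain R where "R > 0" "\<And>j t. \<bar>t\<bar> \<ge> R \<Longrightarrow> nth_vderiv j f t = 0"
    using test_DE[OF f] by metis
  then show "f \<in> DL1"
    using test_D_smooth[OF f]
    by (auto simp: DL1_def intro!: continuous_vanishing_integrable smooth_continuous_on)
qed

lemma test_D0_test_D: "f \<in> test_D0 \<Longrightarrow> f \<in> test_D"
  by (simp add: test_D0_def)

lemma DL1_smooth: "f \<in> DL1 \<Longrightarrow> f \<in> smooth_funs"
  by (simp add: DL1_def)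

lemma DL1_integrable: "f \<in> DL1 \<Longrightarrow> integrable lborel (nth_vderiv j f)"
  by (simp add: DL1_def)

lemma DL1_integrable_0: "f \<in> DL1 \<Longrightarrow> integrable lborel f"
  using DL1_integrable[of f 0] by simp

lemma DL1_nth_vderiv: "f \<in> DL1 \<Longrightarrow> nth_vderiv j f \<in> DL1"
  by (auto simp: DL1_def smooth_nth_vderiv nth_vderiv_add_index)

lemma DL1_diff: "f \<in> DL1 \<Longrightarrow> g \<in> DL1 \<Longrightarrow> (\<lambda>t. f t - g t) \<in> DL1"
  by (simp add: DL1_def smooth_diff nth_vderiv_diff)

lemma DL1_cmult: "f \<in> DL1 \<Longrightarrow> (\<lambda>t. c * f t) \<in> DL1"
  by (simp add: DL1_def smooth_cmult nth_vderiv_cmult)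

lemma DL1_affine: 
  assumes "f \<in> DL1" "a \<noteq> 0" shows "(\<lambda>t. f (a * t + b)) \<in> DL1"
proof -
  have "integrable lborel (\<lambda>t. nth_vderiv j f (b + a * t))" for j
    using assms by (intro lborel_integrable_real_affine DL1_integrable)
  then show ?thesis
    using assms(1) by (simp add: DL1_def smooth_affine nth_vderiv_affine add.commute[of b])
qed

lemma
  assumes "f \<in> smooth_funs"
  shows smooth_translate: "(\<lambda>t. f (t - x)) \<in> smooth_funs"
    and nth_vderiv_translate: "nth_vderiv j (\<lambda>t. f (t - x)) = (\<lambda>t. nth_vderiv j f (t - x))"
  using smooth_affine[OF assms, of 1 "-x"] nth_vderiv_affine[OF assms, of j 1 "-x"] by simp_all

lemma DL1_translate: "f \<in> DL1 \<Longrightarrow> (\<lambda>t. f (t - x)) \<in> DL1"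
  using DL1_affine[of f 1 "-x"] by simp

lemma DL1_reflect: "f \<in> DL1 \<Longrightarrow> (\<lambda>t. f (- t)) \<in> DL1"
  using DL1_affine[of f "-1" 0] by simp

lemma test_D_reflect: "f \<in> test_D \<Longrightarrow> (\<lambda>t. f (- t)) \<in> test_D"
  using test_D_affine[of f "-1" 0] by simp

subsection \<open>The seminorms\<close>

lemma DL1_seminorm_nonneg: "0 \<le> DL1_seminorm k f"
  by (simp add: DL1_seminorm_def sum_nonneg)

lemma DL1_seminorm_0: "DL1_seminorm 0 f = (\<integral>t. cmod (f t) \<partial>lborel)"
  by (simp add: DL1_seminorm_def)

lemma DL1_seminorm_Suc: "DL1_seminorm (Suc k) f = DL1_seminorm 0 f + DL1_seminorm k (nth_vderiv 1 f)"
  unfolding DL1_seminorm_def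
  by (subst sum.atMost_Suc_shift) (simp only: nth_vderiv_add_index add_Suc_right add_0_right One_nat_def
    atMost_0 sum.insert sum.empty finite.emptyI empty_iff not_False_eq_True)

lemma DL1_seminorm_mono: "j \<le> k \<Longrightarrow> DL1_seminorm j f \<le> DL1_seminorm k f"
  unfolding DL1_seminorm_def by (rule sum_mono2) auto

lemma DL1_seminorm_deriv_le: "DL1_seminorm k (nth_vderiv 1 f) \<le> DL1_seminorm (Suc k) f"
  by (simp add: DL1_seminorm_Suc DL1_seminorm_nonneg)

lemma DL1_seminorm_add:
  assumes "f \<in> DL1" "g \<in> DL1"
  shows "DL1_seminorm k (\<lambda>t. f t + g t) \<le> DL1_seminorm k f + DL1_seminorm k g"
  unfolding DL1_seminorm_def sum.distrib[symmetric] nth_vderiv_add[OF DL1_smooth[OF assms(1)] DL1_smooth[OF assms(2)]]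
proof (rule sum_mono)
  fix j
  have "(\<integral>t. cmod (nth_vderiv j f t + nth_vderiv j g t) \<partial>lborel)
      \<le> (\<integral>t. cmod (nth_vderiv j f t) + cmod (nth_vderiv j g t) \<partial>lborel)"
    using assms by (intro integral_mono integrable_norm Bochner_Integration.integrable_add DL1_integrable norm_triangle_ineq)
  also have "\<dots> = (\<integral>t. cmod (nth_vderiv j f t) \<partial>lborel) + (\<integral>t. cmod (nth_vderiv j g t) \<partial>lborel)"
    using assms by (intro Bochner_Integration.integral_add integrable_norm DL1_integrable)
  finally show "(\<integral>t. cmod (nth_vderiv j f t + nth_vderiv j g t) \<partial>lborel) \<le> \<dots>" .
qed

lemma DL1_seminorm_cmult:
  assumes "f \<in> DL1"
  shows "DL1_seminorm k (\<lambda>t. c * f t) = cmod c * DL1_seminorm k f"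
  by (simp add: DL1_seminorm_def nth_vderiv_cmult[OF DL1_smooth[OF assms]] norm_mult sum_distrib_left)

lemma DL1_seminorm_diff:
  assumes "f \<in> DL1" "g \<in> DL1"
  shows "DL1_seminorm k (\<lambda>t. f t - g t) \<le> DL1_seminorm k f + DL1_seminorm k g"
  using DL1_seminorm_add[OF assms(1) DL1_cmult[OF assms(2), of "-1"], of k]
    DL1_seminorm_cmult[OF assms(2), of k "-1"] by simp

lemma DL1_seminorm_translate:
  assumes "f \<in> DL1"
  shows "DL1_seminorm k (\<lambda>t. f (t - x)) = DL1_seminorm k f"
proof -
  have "(\<integral>t. cmod (nth_vderiv j f t) \<partial>lborel) = (\<integral>t. cmod (nth_vderiv j f (t - x)) \<partial>lborel)" for j
    using lborel_integral_real_affine[of 1 "\<lambda>t. cmod (nth_vderiv j f t)" "-x"] by simp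
  then show ?thesis
    by (simp add: DL1_seminorm_def nth_vderiv_translate[OF DL1_smooth[OF assms]])
qed

lemma DL1_seminorm_reflect:
  assumes "f \<in> DL1"
  shows "DL1_seminorm k (\<lambda>t. f (- t)) = DL1_seminorm k f"
proof -
  have "(\<integral>t. cmod (nth_vderiv j f t) \<partial>lborel) = (\<integral>t. cmod (nth_vderiv j f (- t)) \<partial>lborel)" for j
    using lborel_integral_real_affine[of "-1" "\<lambda>t. cmod (nth_vderiv j f t)" 0] by simp
  then show ?thesis
    using nth_vderiv_affine[OF DL1_smooth[OF assms], of _ "-1" 0] by (simp add: DL1_seminorm_def)
qed

section \<open>Convolution of integrable weights with test functions\<close>

abbreviation L1_norm :: "(real \<Rightarrow> complex) \<Rightarrow> real" where
  "L1_norm f \<equiv> (\<integral>t. cmod (f t) \<partial>lborel)"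

text \<open>The weight is only integrable and the second argument carries the smoothness. Indicator
  functions of intervals, the one-sided exponential and mollifiers all occur as weights.\<close>

definition conv_fun :: "(real \<Rightarrow> complex) \<Rightarrow> (real \<Rightarrow> complex) \<Rightarrow> real \<Rightarrow> complex" where
  "conv_fun w \<phi> t = (\<integral>s. w s * \<phi> (t - s) \<partial>lborel)"

text \<open>Derivatives are found from a quadratic remainder estimate, which integrates well.\<close>

lemma has_vector_derivative_quadratic:
  fixes f :: "real \<Rightarrow> 'a::real_normed_vector"
  assumes "\<And>y. norm (f y - f x - (y - x) *\<^sub>R D) \<le> K * (y - x)\<^sup>2"
  shows "(f has_vector_derivative D) (at x)"
proof -
  have "((\<lambda>y. norm (f y - f x - (y - x) *\<^sub>R D) / norm (y - x)) \<longlongrightarrow> 0) (at x)"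
  proof (rule Lim_null_comparison)
    have "norm (norm (f y - f x - (y - x) *\<^sub>R D) / norm (y - x)) \<le> K * \<bar>y - x\<bar>" if "y \<noteq> x" for y
    proof -
      have "norm (f y - f x - (y - x) *\<^sub>R D) \<le> K * \<bar>y - x\<bar> * \<bar>y - x\<bar>"
        using assms[of y] by (simp add: power2_eq_square mult.assoc abs_mult_self_eq)
      then show ?thesis using that by (simp add: divide_simps)
    qed
    then show "\<forall>\<^sub>F y in at x. norm (norm (f y - f x - (y - x) *\<^sub>R D) / norm (y - x)) \<le> K * \<bar>y - x\<bar>"
      by (simp add: eventually_at_filter)
    have "((\<lambda>y. K * \<bar>y - x\<bar>) \<longlongrightarrow> K * \<bar>x - x\<bar>) (at x)"
      by (intro tendsto_intros)
    then show "((\<lambda>y. K * \<bar>y - x\<bar>) \<longlongrightarrow> 0) (at x)" by simp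
  qed
  then show ?thesis
    unfolding has_vector_derivative_def has_derivative_iff_norm
    by (simp add: bounded_linear_scaleR_left)
qed

lemma vector_derivative_Lipschitz:
  fixes f :: "real \<Rightarrow> 'a::real_normed_vector"
  assumes "\<And>x. (f has_vector_derivative f' x) (at x)" "\<And>x. norm (f' x) \<le> M"
  shows "norm (f b - f a) \<le> M * \<bar>b - a\<bar>"
proof -
  have "norm (f b - f a) \<le> M * norm (b - a)"
  proof (rule differentiable_bound[where S = UNIV and f' = "\<lambda>x h. h *\<^sub>R f' x"])
    show "(f has_derivative (\<lambda>h. h *\<^sub>R f' x)) (at x within UNIV)" for x
      using assms(1)[of x] by (simp add: has_vector_derivative_def)
    show "onorm (\<lambda>h. h *\<^sub>R f' x) \<le> M" for x
      using assms(2)[of x] by (intro onorm_le) (simp add: mult.commute[of M] mult_left_mono)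
  qed auto
  then show ?thesis by simp
qed

text \<open>Minkowski's integral inequality in \<open>L\<^sup>1\<close>; it is behind every estimate of a convolution.\<close>

lemma minkowski_L1:
  fixes G :: "real \<Rightarrow> real \<Rightarrow> complex"
  assumes meas [measurable]: "(\<lambda>(x, t). G x t) \<in> borel_measurable (lborel \<Otimes>\<^sub>M lborel)"
    and int: "\<And>x. integrable lborel (G x)"
    and bound: "\<And>x. L1_norm (G x) \<le> b x"
    and b: "integrable lborel b"
  shows "integrable lborel (\<lambda>t. \<integral>x. G x t \<partial>lborel)"
    and "L1_norm (\<lambda>t. \<integral>x. G x t \<partial>lborel) \<le> (\<integral>x. b x \<partial>lborel)"
proof -
  have [measurable]: "(\<lambda>(t, x). G x t) \<in> borel_measurable (lborel \<Otimes>\<^sub>M lborel)"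
    by measurable
  have b0: "0 \<le> b x" for x
    by (rule order_trans[OF _ bound]) simp
  have "(\<integral>\<^sup>+t. cmod (\<integral>x. G x t \<partial>lborel) \<partial>lborel) \<le> (\<integral>\<^sup>+t. \<integral>\<^sup>+x. cmod (G x t) \<partial>lborel \<partial>lborel)"
  proof (rule nn_integral_mono)
    fix t
    show "ennreal (cmod (\<integral>x. G x t \<partial>lborel)) \<le> (\<integral>\<^sup>+x. cmod (G x t) \<partial>lborel)"
      using integral_norm_bound_ennreal[of lborel "\<lambda>x. G x t"]
      by (cases "integrable lborel (\<lambda>x. G x t)") (auto simp: not_integrable_integral_eq)
  qed
  also have "\<dots> = (\<integral>\<^sup>+x. \<integral>\<^sup>+t. cmod (G x t) \<partial>lborel \<partial>lborel)"
    by (rule lborel_pair.Fubini') measurable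
  also have "\<dots> \<le> (\<integral>\<^sup>+x. ennreal (b x) \<partial>lborel)"
    using bound int by (intro nn_integral_mono) (simp add: nn_integral_eq_integral ennreal_leI)
  also have "\<dots> = ennreal (\<integral>x. b x \<partial>lborel)"
    using b b0 by (intro nn_integral_eq_integral) auto
  finally have *: "(\<integral>\<^sup>+t. cmod (\<integral>x. G x t \<partial>lborel) \<partial>lborel) \<le> ennreal (\<integral>x. b x \<partial>lborel)" .
  show **: "integrable lborel (\<lambda>t. \<integral>x. G x t \<partial>lborel)"
  proof (rule integrableI_bounded)
    show "(\<lambda>t. \<integral>x. G x t \<partial>lborel) \<in> borel_measurable lborel"
      by measurable
    show "(\<integral>\<^sup>+t. cmod (\<integral>x. G x t \<partial>lborel) \<partial>lborel) < \<infinity>"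
      using * by (rule order_le_less_trans) simp
  qed
  have "ennreal (L1_norm (\<lambda>t. \<integral>x. G x t \<partial>lborel)) \<le> ennreal (\<integral>x. b x \<partial>lborel)"
    using * nn_integral_eq_integral[OF integrable_norm[OF **]] by simp
  then show "L1_norm (\<lambda>t. \<integral>x. G x t \<partial>lborel) \<le> (\<integral>x. b x \<partial>lborel)"
    using b0 by (simp add: ennreal_le_iff integral_nonneg_AE)
qed

lemma DL1_measurable [measurable_dest]: "\<phi> \<in> DL1 \<Longrightarrow> \<phi> \<in> borel_measurable borel"
  using DL1_integrable_0[of \<phi>] by (simp add: borel_measurable_integrable)

text \<open>The fundamental theorem of calculus, with the increment read as a convolution: this makes
  translation and differentiation accessible to the bounds for convolutions.\<close>

lemma translate_diff_eq_conv_fun: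
  assumes "\<phi> \<in> DL1" "p \<le> q"
  shows "\<phi> (t - q) - \<phi> (t - p) = - conv_fun (\<lambda>s. of_real (indicator {p..q} s)) (nth_vderiv 1 \<phi>) t"
proof -
  have "(\<integral>s. indicator {p..q} s *\<^sub>R (- nth_vderiv 1 \<phi> (t - s)) \<partial>lborel) = \<phi> (t - q) - \<phi> (t - p)"
  proof (rule integral_FTC_Icc[OF assms(2)])
    show "((\<lambda>s. \<phi> (t - s)) has_vector_derivative - nth_vderiv 1 \<phi> (t - s)) (at s within {p..q})" for s
    proof -
      have "((\<lambda>s. t - s) has_vector_derivative - 1) (at s)"
        by (auto intro!: derivative_eq_intros simp: has_real_derivative_iff_has_vector_derivative[symmetric])
      from vector_diff_chain_at[OF this smooth_has_vderiv_0[OF DL1_smooth[OF assms(1)]]]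
      have "((\<lambda>s. \<phi> (t - s)) has_vector_derivative - nth_vderiv 1 \<phi> (t - s)) (at s)"
        by (simp add: o_def)
      then show ?thesis by (rule has_vector_derivative_at_within)
    qed
    have "continuous_on UNIV (nth_vderiv 1 \<phi>)"
      by (rule smooth_continuous_on[OF DL1_smooth[OF assms(1)]])
    then show "continuous_on {p..q} (\<lambda>s. - nth_vderiv 1 \<phi> (t - s))"
      by (intro continuous_on_minus continuous_on_compose2[of UNIV "nth_vderiv 1 \<phi>" "{p..q}" "\<lambda>s. t - s"]
          continuous_on_diff continuous_on_const continuous_on_id subset_UNIV)
  qed
  then show ?thesis
    by (simp add: conv_fun_def scaleR_conv_of_real)
qed

lemma integrable_indicator_Icc: "integrable lborel (\<lambda>s. complex_of_real (indicator {p..q::real} s))"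
  by (intro integrable_of_real integrable_real_indicator) (auto simp: emeasure_lborel_Icc_eq)

text \<open>By the fundamental theorem of calculus, the oscillation of \<open>\<phi>\<close> is at most the \<open>L\<^sup>1\<close> norm of its derivative.\<close>

lemma DL1_bounded_fun:
  assumes "\<phi> \<in> DL1"
  obtains M where "M \<ge> 0" "\<And>t. cmod (\<phi> t) \<le> M"
proof -
  let ?\<phi>' = "nth_vderiv 1 \<phi>"
  have inc: "cmod (\<phi> (- q) - \<phi> (- p)) \<le> L1_norm ?\<phi>'" if "p \<le> q" for p q
  proof -
    have "cmod (\<phi> (- q) - \<phi> (- p))
        = cmod (\<integral>s. of_real (indicator {p..q} s) * ?\<phi>' (- s) \<partial>lborel)"
      using translate_diff_eq_conv_fun[OF assms that, of 0] by (simp add: conv_fun_def)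
    also have "\<dots> \<le> (\<integral>s. cmod (of_real (indicator {p..q} s) * ?\<phi>' (- s)) \<partial>lborel)"
      by (rule integral_norm_bound)
    also have "\<dots> \<le> (\<integral>s. cmod (?\<phi>' (- s)) \<partial>lborel)"
      using DL1_integrable_0[OF DL1_reflect[OF DL1_nth_vderiv[OF assms]]]
      by (intro Henstock_Kurzweil_Integration.integral_le integral_mono') (auto simp: indicator_def norm_mult)
    also have "\<dots> = L1_norm ?\<phi>'"
      using lborel_integral_real_affine[of "-1" "\<lambda>t. cmod (?\<phi>' t)" 0] by simp
    finally show ?thesis .
  qed
  show ?thesis
  proof (rule that)
    fix t
    have "cmod (\<phi> t - \<phi> 0) \<le> L1_norm ?\<phi>'"
      using inc[of 0 "-t"] inc[of "-t" 0] by (cases "t \<le> 0") (simp_all add: norm_minus_commute)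
    then show "cmod (\<phi> t) \<le> cmod (\<phi> 0) + L1_norm ?\<phi>'"
      by (smt (verit) norm_triangle_sub)
  qed simp
qed

lemma integrable_mult_bounded:
  assumes "integrable lborel w" "f \<in> borel_measurable borel" "\<And>s. cmod (f s) \<le> M"
  shows "integrable lborel (\<lambda>s::real. w s * f s :: complex)"
proof (rule Bochner_Integration.integrable_bound)
  show "integrable lborel (\<lambda>s. M * cmod (w s))"
    using assms(1) by (intro integrable_mult_right integrable_norm)
  show "(\<lambda>s. w s * f s) \<in> borel_measurable lborel"
    using assms by (auto simp: borel_measurable_integrable)
  show "AE s in lborel. cmod (w s * f s) \<le> norm (M * cmod (w s))"
  proof (rule AE_I2)
    fix s
    have "cmod (w s) * cmod (f s) \<le> cmod (w s) * M"
      by (rule mult_left_mono[OF assms(3)]) simp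
    also have "\<dots> \<le> norm (M * cmod (w s))" by (simp add: mult.commute)
    finally show "cmod (w s * f s) \<le> norm (M * cmod (w s))" by (simp add: norm_mult)
  qed
qed

lemma conv_fun_integrable:
  assumes "integrable lborel w" "\<phi> \<in> DL1"
  shows "integrable lborel (\<lambda>s. w s * \<phi> (t - s))"
proof -
  obtain M where "\<And>t. cmod (\<phi> t) \<le> M" using DL1_bounded_fun[OF assms(2)] by metis
  then show ?thesis
    using DL1_measurable[OF assms(2)] by (intro integrable_mult_bounded[OF assms(1), of _ M]) auto
qed

text \<open>The second derivative of \<open>\<phi>\<close> is bounded, so Taylor's formula has a quadratic remainder
  that is uniform in the point of expansion and can be integrated against the weight.\<close>

lemma conv_fun_has_vderiv:
  assumes w: "integrable lborel w" and \<phi>: "\<phi> \<in> DL1"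
  shows "(conv_fun w \<phi> has_vector_derivative conv_fun w (nth_vderiv 1 \<phi>) t) (at t)"
proof -
  obtain M where M: "\<And>t. cmod (nth_vderiv 2 \<phi> t) \<le> M"
    using DL1_bounded_fun[OF DL1_nth_vderiv[OF \<phi>]] by metis
  have D: "(nth_vderiv j \<phi> has_vector_derivative nth_vderiv (Suc j) \<phi> t) (at t)" for j t
    by (rule smooth_has_vderiv[OF DL1_smooth[OF \<phi>]])
  have taylor: "cmod (\<phi> b - \<phi> a - (b - a) *\<^sub>R nth_vderiv 1 \<phi> a) \<le> M * (b - a)\<^sup>2" for a b
  proof -
    have "cmod (\<phi> b - \<phi> a - (b - a) *\<^sub>R nth_vderiv 1 \<phi> a) \<le> norm (b - a) * (M * \<bar>b - a\<bar>)"
    proof (rule vector_differentiable_bound_linearization[of "closed_segment a b"])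
      show "(\<phi> has_vector_derivative nth_vderiv 1 \<phi> x) (at x within closed_segment a b)" for x
        using D[of 0 x] by (simp add: has_vector_derivative_at_within)
      fix x assume "x \<in> closed_segment a b"
      then have "\<bar>x - a\<bar> \<le> \<bar>b - a\<bar>" by (auto simp: closed_segment_eq_real_ivl split: if_splits)
      moreover have "cmod (nth_vderiv 1 \<phi> x - nth_vderiv 1 \<phi> a) \<le> M * \<bar>x - a\<bar>"
        using vector_derivative_Lipschitz[OF D[of 1], of M] M by (simp add: numeral_2_eq_2)
      moreover have "0 \<le> M" using M[of 0] by (rule order_trans[OF norm_ge_zero])
      ultimately show "cmod (nth_vderiv 1 \<phi> x - nth_vderiv 1 \<phi> a) \<le> M * \<bar>b - a\<bar>"
        by (smt (verit) mult_left_mono)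
    qed auto
    then show ?thesis by (simp add: power2_eq_square mult.left_commute)
  qed
  show ?thesis
  proof (rule has_vector_derivative_quadratic)
    fix y
    have i: "integrable lborel (\<lambda>s. w s * \<phi> (y - s))" "integrable lborel (\<lambda>s. w s * \<phi> (t - s))"
      "integrable lborel (\<lambda>s. (y - t) *\<^sub>R (w s * nth_vderiv 1 \<phi> (t - s)))"
      using w \<phi> by (auto intro!: conv_fun_integrable DL1_nth_vderiv integrable_scaleR_right)
    have "cmod (conv_fun w \<phi> y - conv_fun w \<phi> t - (y - t) *\<^sub>R conv_fun w (nth_vderiv 1 \<phi>) t)
      = cmod (\<integral>s. w s * \<phi> (y - s) - w s * \<phi> (t - s) - (y - t) *\<^sub>R (w s * nth_vderiv 1 \<phi> (t - s)) \<partial>lborel)"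
      using i by (simp add: conv_fun_def)
    also have "\<dots> \<le> (\<integral>s. cmod (w s * \<phi> (y - s) - w s * \<phi> (t - s)
        - (y - t) *\<^sub>R (w s * nth_vderiv 1 \<phi> (t - s))) \<partial>lborel)"
      by (rule integral_norm_bound)
    also have "\<dots> \<le> (\<integral>s. M * (y - t)\<^sup>2 * cmod (w s) \<partial>lborel)"
    proof (rule Bochner_Integration.integral_mono)
      fix s
      have "w s * \<phi> (y - s) - w s * \<phi> (t - s) - (y - t) *\<^sub>R (w s * nth_vderiv 1 \<phi> (t - s))
          = w s * (\<phi> (y - s) - \<phi> (t - s) - (y - t) *\<^sub>R nth_vderiv 1 \<phi> (t - s))"
        by (simp only: right_diff_distrib mult_scaleR_right)
      then have "cmod (w s * \<phi> (y - s) - w s * \<phi> (t - s) - (y - t) *\<^sub>R (w s * nth_vderiv 1 \<phi> (t - s)))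
          = cmod (w s) * cmod (\<phi> (y - s) - \<phi> (t - s) - (y - t) *\<^sub>R nth_vderiv 1 \<phi> (t - s))"
        by (simp only: norm_mult)
      also have "\<dots> \<le> cmod (w s) * (M * (y - t)\<^sup>2)"
        using taylor[of "y - s" "t - s"] by (intro mult_left_mono) auto
      finally show "cmod (w s * \<phi> (y - s) - w s * \<phi> (t - s) - (y - t) *\<^sub>R (w s * nth_vderiv 1 \<phi> (t - s)))
          \<le> M * (y - t)\<^sup>2 * cmod (w s)" by (simp add: mult.commute)
    next
      show "integrable lborel (\<lambda>s. cmod (w s * \<phi> (y - s) - w s * \<phi> (t - s)
          - (y - t) *\<^sub>R (w s * nth_vderiv 1 \<phi> (t - s))))"
        by (intro integrable_norm Bochner_Integration.integrable_diff i)
      show "integrable lborel (\<lambda>s. M * (y - t)\<^sup>2 * cmod (w s))"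
        using w by (intro integrable_mult_right integrable_norm)
    qed
    also have "\<dots> = M * L1_norm w * (y - t)\<^sup>2" by simp
    finally show "cmod (conv_fun w \<phi> y - conv_fun w \<phi> t - (y - t) *\<^sub>R conv_fun w (nth_vderiv 1 \<phi>) t)
        \<le> M * L1_norm w * (y - t)\<^sup>2" .
  qed
qed

lemma
  assumes "integrable lborel w" "\<phi> \<in> DL1"
  shows conv_fun_smooth: "conv_fun w \<phi> \<in> smooth_funs"
    and nth_vderiv_conv_fun: "nth_vderiv j (conv_fun w \<phi>) = conv_fun w (nth_vderiv j \<phi>)"
proof -
  have "(conv_fun w (nth_vderiv j \<phi>) has_vector_derivative conv_fun w (nth_vderiv (Suc j) \<phi>) t) (at t)"
    for j t
    using conv_fun_has_vderiv[OF assms(1) DL1_nth_vderiv[OF assms(2), of j], of t]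
    by (simp add: nth_vderiv_add_index)
  from smooth_tower[of "\<lambda>j. conv_fun w (nth_vderiv j \<phi>)", OF this]
  show "conv_fun w \<phi> \<in> smooth_funs" "nth_vderiv j (conv_fun w \<phi>) = conv_fun w (nth_vderiv j \<phi>)"
    by simp_all
qed

lemma
  assumes w: "integrable lborel w" and \<phi>: "\<phi> \<in> DL1"
  shows conv_fun_L1: "integrable lborel (conv_fun w \<phi>)"
    and L1_norm_conv_fun_le: "L1_norm (conv_fun w \<phi>) \<le> L1_norm w * L1_norm \<phi>"
proof -
  have [measurable]: "w \<in> borel_measurable borel" "\<phi> \<in> borel_measurable borel"
    using w \<phi> by (simp_all add: DL1_measurable borel_measurable_integrable[of lborel, simplified])
  have 1: "(\<lambda>(s, t). w s * \<phi> (t - s)) \<in> borel_measurable (lborel \<Otimes>\<^sub>M lborel)"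
    by measurable
  have 2: "integrable lborel (\<lambda>t. w s * \<phi> (t - s))" for s
    using DL1_integrable_0[OF DL1_translate[OF \<phi>]] by (intro integrable_mult_right)
  have 3: "L1_norm (\<lambda>t. w s * \<phi> (t - s)) \<le> cmod (w s) * L1_norm \<phi>" for s
    using DL1_seminorm_translate[OF \<phi>, of 0 s] by (simp add: norm_mult DL1_seminorm_0)
  have 4: "integrable lborel (\<lambda>s. cmod (w s) * L1_norm \<phi>)"
    using w by (intro integrable_mult_left integrable_norm)
  show "integrable lborel (conv_fun w \<phi>)"
    using minkowski_L1(1)[OF 1 2 3 4] by (simp add: conv_fun_def[abs_def])
  show "L1_norm (conv_fun w \<phi>) \<le> L1_norm w * L1_norm \<phi>"
    using minkowski_L1(2)[OF 1 2 3 4] by (simp add: conv_fun_def[abs_def])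
qed

lemma conv_fun_DL1:
  assumes "integrable lborel w" "\<phi> \<in> DL1"
  shows "conv_fun w \<phi> \<in> DL1"
  using conv_fun_smooth[OF assms] nth_vderiv_conv_fun[OF assms] conv_fun_L1[OF assms(1) DL1_nth_vderiv[OF assms(2)]]
  by (simp add: DL1_def)

lemma DL1_seminorm_conv_fun_le:
  assumes "integrable lborel w" "\<phi> \<in> DL1"
  shows "DL1_seminorm k (conv_fun w \<phi>) \<le> L1_norm w * DL1_seminorm k \<phi>"
  unfolding DL1_seminorm_def sum_distrib_left nth_vderiv_conv_fun[OF assms]
  by (intro sum_mono L1_norm_conv_fun_le assms DL1_nth_vderiv)

lemma conv_fun_translate: "conv_fun w (\<lambda>t. \<phi> (t - x)) = (\<lambda>t. conv_fun w \<phi> (t - x))"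
  by (simp add: conv_fun_def[abs_def] algebra_simps)

lemma conv_fun_add_right:
  assumes "integrable lborel w" "\<phi> \<in> DL1" "\<psi> \<in> DL1"
  shows "conv_fun w (\<lambda>t. \<phi> t + \<psi> t) = (\<lambda>t. conv_fun w \<phi> t + conv_fun w \<psi> t)"
  using assms by (simp add: conv_fun_def[abs_def] distrib_left conv_fun_integrable)

lemma conv_fun_cmult_right: "conv_fun w (\<lambda>t. c * \<phi> t) = (\<lambda>t. c * conv_fun w \<phi> t)"
  by (simp add: conv_fun_def[abs_def] mult.left_commute[of _ c])

lemma conv_fun_diff_right:
  assumes "integrable lborel w" "\<phi> \<in> DL1" "\<psi> \<in> DL1"
  shows "conv_fun w (\<lambda>t. \<phi> t - \<psi> t) = (\<lambda>t. conv_fun w \<phi> t - conv_fun w \<psi> t)"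
  using assms by (simp add: conv_fun_def[abs_def] right_diff_distrib conv_fun_integrable)

lemma conv_fun_add_left:
  assumes "integrable lborel w" "integrable lborel w'" "\<phi> \<in> DL1"
  shows "conv_fun (\<lambda>t. w t + w' t) \<phi> = (\<lambda>t. conv_fun w \<phi> t + conv_fun w' \<phi> t)"
  using assms by (simp add: conv_fun_def[abs_def] distrib_right conv_fun_integrable)

lemma conv_fun_commute: "conv_fun \<phi> \<psi> = conv_fun \<psi> \<phi>"
proof
  fix t
  show "conv_fun \<phi> \<psi> t = conv_fun \<psi> \<phi> t"
    using lborel_integral_real_affine[of "-1" "\<lambda>s. \<phi> s * \<psi> (t - s)" t]
    by (simp add: conv_fun_def mult.commute)
qed

lemma DL1_seminorm_translate_diff_le:
  assumes "\<phi> \<in> DL1"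
  shows "DL1_seminorm k (\<lambda>t. \<phi> (t - q) - \<phi> (t - p)) \<le> \<bar>q - p\<bar> * DL1_seminorm k (nth_vderiv 1 \<phi>)"
proof -
  have *: "DL1_seminorm k (\<lambda>t. \<phi> (t - q) - \<phi> (t - p)) \<le> (q - p) * DL1_seminorm k (nth_vderiv 1 \<phi>)"
    if "p \<le> q" for p q
  proof -
    let ?w = "\<lambda>s. complex_of_real (indicator {p..q} s)"
    have "(\<lambda>t. \<phi> (t - q) - \<phi> (t - p)) = (\<lambda>t. - 1 * conv_fun ?w (nth_vderiv 1 \<phi>) t)"
      using translate_diff_eq_conv_fun[OF assms that] by auto
    then have "DL1_seminorm k (\<lambda>t. \<phi> (t - q) - \<phi> (t - p)) = DL1_seminorm k (conv_fun ?w (nth_vderiv 1 \<phi>))"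
      using DL1_seminorm_cmult[OF conv_fun_DL1[OF integrable_indicator_Icc DL1_nth_vderiv[OF assms]], of k "-1"]
      by simp
    also have "\<dots> \<le> L1_norm ?w * DL1_seminorm k (nth_vderiv 1 \<phi>)"
      by (intro DL1_seminorm_conv_fun_le integrable_indicator_Icc DL1_nth_vderiv assms)
    also have "L1_norm ?w = q - p"
      using that by simp
    finally show ?thesis .
  qed
  show ?thesis
  proof (cases "p \<le> q")
    case False
    have "DL1_seminorm k (\<lambda>t. -1 * (\<phi> (t - p) - \<phi> (t - q))) = DL1_seminorm k (\<lambda>t. \<phi> (t - p) - \<phi> (t - q))"
      using DL1_seminorm_cmult[OF DL1_diff[OF DL1_translate[OF assms] DL1_translate[OF assms]], of k "-1"]
      by simp
    then show ?thesis using *[of q p] False by simp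
  qed (use * in simp)
qed

text \<open>A weight that is concentrated near \<open>x\<close> acts almost like a multiple of the translation by
  \<open>x\<close>. This one estimate serves for approximate identities, for the differentiability of
  \<open>x \<mapsto> T (\<phi>(\<cdot> - x))\<close>, and for exchanging \<open>T\<close> with an integral.\<close>

lemma DL1_seminorm_conv_fun_approx:
  assumes w: "integrable lborel w" and supp: "\<And>s. w s \<noteq> 0 \<Longrightarrow> \<bar>s - x\<bar> \<le> \<delta>" and \<phi>: "\<phi> \<in> DL1"
    and I: "(\<integral>s. w s \<partial>lborel) = I"
  shows "DL1_seminorm k (\<lambda>t. conv_fun w \<phi> t - I * \<phi> (t - x))
    \<le> L1_norm w * \<delta> * DL1_seminorm k (nth_vderiv 1 \<phi>)"
proof -
  have L1: "L1_norm (\<lambda>t. conv_fun w \<phi> t - I * \<phi> (t - x)) \<le> L1_norm w * \<delta> * L1_norm (nth_vderiv 1 \<phi>)"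
    if \<phi>: "\<phi> \<in> DL1" for \<phi>
  proof -
    have [measurable]: "w \<in> borel_measurable borel" "\<phi> \<in> borel_measurable borel"
      using w \<phi> by (simp_all add: DL1_measurable borel_measurable_integrable[of lborel, simplified])
    have 1: "(\<lambda>(s, t). w s * (\<phi> (t - s) - \<phi> (t - x))) \<in> borel_measurable (lborel \<Otimes>\<^sub>M lborel)"
      by measurable
    have 2: "integrable lborel (\<lambda>t. w s * (\<phi> (t - s) - \<phi> (t - x)))" for s
      using DL1_integrable_0[OF DL1_diff[OF DL1_translate[OF \<phi>] DL1_translate[OF \<phi>]]]
      by (rule integrable_mult_right)
    have 3: "L1_norm (\<lambda>t. w s * (\<phi> (t - s) - \<phi> (t - x))) \<le> cmod (w s) * (\<delta> * L1_norm (nth_vderiv 1 \<phi>))" for s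
    proof (cases "w s = 0")
      case False
      have "L1_norm (\<lambda>t. w s * (\<phi> (t - s) - \<phi> (t - x))) = cmod (w s) * L1_norm (\<lambda>t. \<phi> (t - s) - \<phi> (t - x))"
        by (simp add: norm_mult)
      also have "\<dots> \<le> cmod (w s) * (\<bar>s - x\<bar> * L1_norm (nth_vderiv 1 \<phi>))"
        using DL1_seminorm_translate_diff_le[OF \<phi>, of 0 s x] by (intro mult_left_mono) (auto simp: DL1_seminorm_0)
      also have "\<dots> \<le> cmod (w s) * (\<delta> * L1_norm (nth_vderiv 1 \<phi>))"
        using supp[OF False] by (intro mult_left_mono mult_right_mono) auto
      finally show ?thesis .
    qed simp
    have 4: "integrable lborel (\<lambda>s. cmod (w s) * (\<delta> * L1_norm (nth_vderiv 1 \<phi>)))"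
      using w by (intro integrable_mult_left integrable_norm)
    have "(\<integral>s. w s * (\<phi> (t - s) - \<phi> (t - x)) \<partial>lborel) = conv_fun w \<phi> t - I * \<phi> (t - x)" for t
    proof -
      have "(\<integral>s. w s * (\<phi> (t - s) - \<phi> (t - x)) \<partial>lborel)
          = (\<integral>s. w s * \<phi> (t - s) \<partial>lborel) - (\<integral>s. w s * \<phi> (t - x) \<partial>lborel)"
        unfolding right_diff_distrib using w \<phi>
        by (intro Bochner_Integration.integral_diff conv_fun_integrable integrable_mult_left)
      then show ?thesis using I by (simp add: conv_fun_def)
    qed
    then show ?thesis
      using minkowski_L1(2)[OF 1 2 3 4] by (simp add: mult.assoc)
  qed
  have "nth_vderiv j (\<lambda>t. conv_fun w \<phi> t - I * \<phi> (t - x))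
      = (\<lambda>t. conv_fun w (nth_vderiv j \<phi>) t - I * nth_vderiv j \<phi> (t - x))" for j
    using \<phi> w by (simp add: nth_vderiv_diff nth_vderiv_cmult nth_vderiv_translate nth_vderiv_conv_fun
        conv_fun_smooth smooth_cmult smooth_translate DL1_smooth)
  moreover have "nth_vderiv 1 (nth_vderiv j \<phi>) = nth_vderiv j (nth_vderiv 1 \<phi>)" for j
    by (simp add: nth_vderiv_add_index)
  ultimately show ?thesis
    unfolding DL1_seminorm_def sum_distrib_left
    using L1[OF DL1_nth_vderiv[OF \<phi>]] by (auto intro!: sum_mono)
qed

section \<open>Integrals of vector-valued functions\<close>

lemma bounded_bilinear_scaleC: "bounded_bilinear ((*\<^sub>C) :: complex \<Rightarrow> 'x::complex_banach \<Rightarrow> 'x)"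
proof
  fix c d :: complex and x y :: 'x and r :: real
  show "(c + d) *\<^sub>C x = c *\<^sub>C x + d *\<^sub>C x" by (rule scaleC_add_left)
  show "c *\<^sub>C (x + y) = c *\<^sub>C x + c *\<^sub>C y" by (rule scaleC_add_right)
  show "(r *\<^sub>R c) *\<^sub>C x = r *\<^sub>R c *\<^sub>C x"
    by (simp only: scaleR_conv_of_real scaleC_scaleC[symmetric] scaleC_of_real)
  show "c *\<^sub>C (r *\<^sub>R x) = r *\<^sub>R c *\<^sub>C x"
    by (simp only: scaleC_of_real[symmetric] scaleC_scaleC mult.commute)
  show "\<exists>K. \<forall>a (b::'x). norm (a *\<^sub>C b) \<le> norm a * norm b * K"
    by (rule exI[of _ 1]) (simp add: norm_scaleC)
qed

interpretation scaleC: bounded_bilinear "(*\<^sub>C) :: complex \<Rightarrow> 'x::complex_banach \<Rightarrow> 'x"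
  by (rule bounded_bilinear_scaleC)

lemma scaleC_minus_one: "(- 1) *\<^sub>C x = - (x::'x::complex_banach)"
  using scaleC_of_real[of "- 1" x] by simp

lemma continuous_majorized_integrable:
  fixes f :: "real \<Rightarrow> 'x::banach"
  assumes f: "continuous_on UNIV f" and g: "integrable lborel g" and le: "\<And>t. norm (f t) \<le> g t"
  shows "f integrable_on UNIV" and "norm (integral UNIV f) \<le> (\<integral>t. g t \<partial>lborel)"
proof -
  have gi: "g integrable_on UNIV" by (rule integrable_on_lborel[OF g])
  have "f integrable_on cbox a b" for a b
    by (rule integrable_continuous[OF continuous_on_subset[OF f subset_UNIV]])
  then show "f integrable_on UNIV" using le gi by (rule integrable_on_all_intervals_UNIV)
  then have "norm (integral UNIV f) \<le> integral UNIV g"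
    by (rule integral_norm_bound_integral[OF _ gi le])
  then show "norm (integral UNIV f) \<le> (\<integral>t. g t \<partial>lborel)"
    by (simp add: integral_lborel[OF g])
qed

lemma
  fixes g :: "real \<Rightarrow> 'x::complex_banach"
  assumes \<phi>: "continuous_on UNIV \<phi>" "integrable lborel \<phi>" and g: "continuous_on UNIV g"
    and bound: "\<And>t. \<phi> t \<noteq> 0 \<Longrightarrow> norm (g t) \<le> M"
  shows scaleC_integrable: "(\<lambda>t. \<phi> t *\<^sub>C g t) integrable_on UNIV"
    and norm_integral_scaleC_le: "norm (integral UNIV (\<lambda>t. \<phi> t *\<^sub>C g t)) \<le> L1_norm \<phi> * M"
proof -
  have 1: "continuous_on UNIV (\<lambda>t. \<phi> t *\<^sub>C g t)"
    by (intro scaleC.continuous_on \<phi> g)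
  have 2: "integrable lborel (\<lambda>t. cmod (\<phi> t) * M)"
    using \<phi>(2) by (intro integrable_mult_left integrable_norm)
  have 3: "norm (\<phi> t *\<^sub>C g t) \<le> cmod (\<phi> t) * M" for t
    using bound[of t] by (cases "\<phi> t = 0") (auto simp: norm_scaleC scaleC.zero_left intro: mult_left_mono)
  show "(\<lambda>t. \<phi> t *\<^sub>C g t) integrable_on UNIV"
    by (rule continuous_majorized_integrable(1)[OF 1 2 3])
  show "norm (integral UNIV (\<lambda>t. \<phi> t *\<^sub>C g t)) \<le> L1_norm \<phi> * M"
    using continuous_majorized_integrable(2)[OF 1 2 3] by simp
qed

section \<open>Bounded distributions\<close>

text \<open>The balls are a subbase by definition. They behave like a neighbourhood base because the
  seminorms increase with \<open>k\<close>.\<close>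

lemma DL1_open_contains_ball:
  assumes "openin DL1_topology U" "\<phi> \<in> U"
  obtains k r where "r > 0" "DL1_ball k \<phi> r \<subseteq> U"
proof -
  have "generate_topology_on {DL1_ball k \<phi> r | k \<phi> r. \<phi> \<in> DL1 \<and> 0 < r} U"
    using assms(1) unfolding DL1_topology_def by (rule openin_topology_generated_by)
  then have "\<forall>\<phi>\<in>U. \<exists>k r. r > 0 \<and> DL1_ball k \<phi> r \<subseteq> U"
  proof induction
    case (Int a b)
    show ?case
    proof
      fix \<phi> assume "\<phi> \<in> a \<inter> b"
      then obtain k r k' r' where *: "r > 0" "DL1_ball k \<phi> r \<subseteq> a" "r' > 0" "DL1_ball k' \<phi> r' \<subseteq> b"
        using Int.IH by blast
      have "DL1_ball (max k k') \<phi> (min r r') \<subseteq> DL1_ball k \<phi> r \<inter> DL1_ball k' \<phi> r'"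
        using DL1_seminorm_mono[of k "max k k'"] DL1_seminorm_mono[of k' "max k k'"]
        by (auto simp: DL1_ball_def intro: order_le_less_trans)
      then show "\<exists>k r. r > 0 \<and> DL1_ball k \<phi> r \<subseteq> a \<inter> b"
        using * by (intro exI[of _ "max k k'"] exI[of _ "min r r'"]) auto
    qed
  next
    case (UN K)
    then show ?case by (meson Union_iff Union_upper order_trans)
  next
    case (Basis s)
    then obtain k \<psi> r where s: "s = DL1_ball k \<psi> r" "\<psi> \<in> DL1" by blast
    show ?case
    proof
      fix \<phi> assume "\<phi> \<in> s"
      then have \<phi>: "\<phi> \<in> DL1" "DL1_seminorm k (\<lambda>t. \<phi> t - \<psi> t) < r" by (auto simp: s DL1_ball_def)
      have "DL1_ball k \<phi> (r - DL1_seminorm k (\<lambda>t. \<phi> t - \<psi> t)) \<subseteq> s"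
      proof
        fix \<eta> assume "\<eta> \<in> DL1_ball k \<phi> (r - DL1_seminorm k (\<lambda>t. \<phi> t - \<psi> t))"
        then show "\<eta> \<in> s"
          using DL1_seminorm_add[of "\<lambda>t. \<eta> t - \<phi> t" "\<lambda>t. \<phi> t - \<psi> t" k] s(2) \<phi>
          by (auto simp: s DL1_ball_def DL1_diff)
      qed
      then show "\<exists>k r. r > 0 \<and> DL1_ball k \<phi> r \<subseteq> s"
        using \<phi>(2) by (intro exI[of _ k] exI[of _ "r - DL1_seminorm k (\<lambda>t. \<phi> t - \<psi> t)"]) simp
    qed
  qed simp
  then show ?thesis using that assms(2) by blast
qed

lemma DL1_zero: "(\<lambda>_. 0) \<in> DL1"
proof -
  have "(\<lambda>_. 0::complex) \<in> smooth_funs"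
    by (rule smooth_coinduct[of _ "{\<lambda>_. 0}"]) (auto simp: has_vector_derivative_const)
  moreover have "nth_vderiv j (\<lambda>_. 0::complex) = (\<lambda>_. 0)" for j
    by (rule ext, rule nth_vderiv_eq_0_open[of UNIV]) auto
  ultimately show ?thesis by (simp add: DL1_def)
qed

lemma DL1_seminorm_zero: "DL1_seminorm k (\<lambda>_. 0) = 0"
  using DL1_seminorm_cmult[OF DL1_zero, of k 0] by simp

lemma distr_add: "T \<in> DL1' \<Longrightarrow> \<phi> \<in> DL1 \<Longrightarrow> \<psi> \<in> DL1 \<Longrightarrow> T (\<lambda>t. \<phi> t + \<psi> t) = T \<phi> + T \<psi>"
  by (simp add: DL1'_def)

lemma distr_cmult: "T \<in> DL1' \<Longrightarrow> \<phi> \<in> DL1 \<Longrightarrow> T (\<lambda>t. c * \<phi> t) = c *\<^sub>C T \<phi>"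
  by (simp add: DL1'_def)

lemma distr_uminus: "T \<in> DL1' \<Longrightarrow> \<phi> \<in> DL1 \<Longrightarrow> T (\<lambda>t. - \<phi> t) = - T \<phi>"
  using distr_cmult[of T \<phi> "-1"] by (simp add: scaleC_minus_one)

lemma distr_diff: "T \<in> DL1' \<Longrightarrow> \<phi> \<in> DL1 \<Longrightarrow> \<psi> \<in> DL1 \<Longrightarrow> T (\<lambda>t. \<phi> t - \<psi> t) = T \<phi> - T \<psi>"
  using distr_add[of T \<phi> "\<lambda>t. (-1) * \<psi> t"] DL1_cmult[of \<psi> "-1"] distr_uminus[of T \<psi>] by simp

lemma distr_zero: "T \<in> DL1' \<Longrightarrow> T (\<lambda>_. 0) = 0"
  using distr_cmult[of T "\<lambda>_. 0" 0] by (simp add: DL1_zero scaleC.zero_left)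

text \<open>Continuity means being of finite order. Scaling a test function into a ball on which
  \<open>norm (T \<phi>) < 1\<close> gives the bound; the summand \<open>r * e\<close> below keeps the scaling factor finite when
  the seminorm vanishes.\<close>

lemma DL1'_bound:
  assumes T: "T \<in> DL1'"
  obtains C k where "C \<ge> 0" "\<And>\<phi>. \<phi> \<in> DL1 \<Longrightarrow> norm (T \<phi>) \<le> C * DL1_seminorm k \<phi>"
proof -
  have top: "topspace DL1_topology = DL1"
  proof
    show "topspace DL1_topology \<subseteq> DL1"
      by (auto simp: DL1_topology_def DL1_ball_def)
    show "DL1 \<subseteq> topspace DL1_topology"
    proof
      fix \<phi> assume "\<phi> \<in> DL1"
      then have "\<phi> \<in> DL1_ball 0 \<phi> 1" by (simp add: DL1_ball_def DL1_seminorm_0)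
      then show "\<phi> \<in> topspace DL1_topology"
        unfolding DL1_topology_def topology_generated_by_topspace
        using \<open>\<phi> \<in> DL1\<close> zero_less_one by (intro UnionI[of "DL1_ball 0 \<phi> 1"]) blast+
    qed
  qed
  have "openin DL1_topology {\<phi> \<in> topspace DL1_topology. T \<phi> \<in> ball 0 1}"
    using T by (intro openin_continuous_map_preimage[of _ euclidean]) (auto simp: DL1'_def)
  moreover have "(\<lambda>_. 0) \<in> {\<phi> \<in> topspace DL1_topology. T \<phi> \<in> ball 0 1}"
    by (simp add: top DL1_zero distr_zero[OF T])
  ultimately obtain k r where r: "r > 0" and sub: "DL1_ball k (\<lambda>_. 0) r \<subseteq> {\<phi> \<in> topspace DL1_topology. T \<phi> \<in> ball 0 1}"
    by (rule DL1_open_contains_ball)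
  have "norm (T \<phi>) \<le> 1 / r * DL1_seminorm k \<phi>" if \<phi>: "\<phi> \<in> DL1" for \<phi>
  proof (rule field_le_epsilon)
    fix e :: real assume e: "e > 0"
    define s where "s = DL1_seminorm k \<phi> + r * e"
    have s: "s > 0" "DL1_seminorm k \<phi> < s"
      using r e DL1_seminorm_nonneg[of k \<phi>] by (auto simp: s_def add_nonneg_pos)
    have "r / s * DL1_seminorm k \<phi> < r" using r s by (simp add: field_simps)
    then have "(\<lambda>t. of_real (r / s) * \<phi> t) \<in> DL1_ball k (\<lambda>_. 0) r"
      using r s by (simp add: DL1_ball_def DL1_cmult \<phi> DL1_seminorm_cmult[OF \<phi>] norm_divide
          del: of_real_divide times_divide_eq_left)
    then have "norm (T (\<lambda>t. of_real (r / s) * \<phi> t)) < 1" using sub by auto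
    then have "r / s * norm (T \<phi>) < 1"
      using r s unfolding distr_cmult[OF T \<phi>] norm_scaleC by (simp add: norm_divide)
    then have "norm (T \<phi>) < s / r" using r s by (simp add: field_simps)
    also have "s / r = 1 / r * DL1_seminorm k \<phi> + e" using r by (simp add: s_def field_simps)
    finally show "norm (T \<phi>) \<le> 1 / r * DL1_seminorm k \<phi> + e" by simp
  qed
  then show ?thesis using r by (intro that[of "1 / r" k]) auto
qed

lemma DL1'I:
  fixes T :: "'x::complex_banach distr"
  assumes add: "\<And>\<phi> \<psi>. \<phi> \<in> DL1 \<Longrightarrow> \<psi> \<in> DL1 \<Longrightarrow> T (\<lambda>t. \<phi> t + \<psi> t) = T \<phi> + T \<psi>"
    and cmult: "\<And>c \<phi>. \<phi> \<in> DL1 \<Longrightarrow> T (\<lambda>t. c * \<phi> t) = c *\<^sub>C T \<phi>"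
    and bound: "\<And>\<phi>. \<phi> \<in> DL1 \<Longrightarrow> norm (T \<phi>) \<le> C * DL1_seminorm k \<phi>"
  shows "T \<in> DL1'"
proof -
  have diff: "T \<psi> - T \<phi> = T (\<lambda>t. \<psi> t - \<phi> t)" if "\<phi> \<in> DL1" "\<psi> \<in> DL1" for \<phi> \<psi>
    using add[OF that(2) DL1_cmult[OF that(1), of "-1"]] cmult[OF that(1), of "-1"]
    by (simp add: scaleC_minus_one)
  have "continuous_map DL1_topology euclidean T"
    unfolding continuous_map_def
  proof (intro conjI allI impI)
    fix V :: "'x set" assume "openin euclidean V"
    then have V: "open V" by simp
    show "openin DL1_topology {\<phi> \<in> topspace DL1_topology. T \<phi> \<in> V}"
    proof (subst openin_subopen, intro ballI)
      fix \<phi> assume "\<phi> \<in> {\<phi> \<in> topspace DL1_topology. T \<phi> \<in> V}"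
      then have \<phi>: "\<phi> \<in> DL1" "T \<phi> \<in> V" by (auto simp: DL1_topology_def DL1_ball_def)
      then obtain e where e: "e > 0" "ball (T \<phi>) e \<subseteq> V" using V open_contains_ball by blast
      define r where "r = e / (\<bar>C\<bar> + 1)"
      have r: "r > 0" using e by (simp add: r_def add_nonneg_pos)
      let ?B = "DL1_ball k \<phi> r"
      have "openin DL1_topology ?B"
        unfolding DL1_topology_def using \<phi> r by (intro topology_generated_by_Basis) blast
      moreover have "\<phi> \<in> ?B" using \<phi> r by (simp add: DL1_ball_def DL1_seminorm_zero)
      moreover have "T \<psi> \<in> V" if "\<psi> \<in> ?B" for \<psi>
      proof -
        have \<psi>: "\<psi> \<in> DL1" "DL1_seminorm k (\<lambda>t. \<psi> t - \<phi> t) < r" using that by (auto simp: DL1_ball_def)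
        have "norm (T \<psi> - T \<phi>) \<le> C * DL1_seminorm k (\<lambda>t. \<psi> t - \<phi> t)"
          unfolding diff[OF \<phi>(1) \<psi>(1)] by (rule bound[OF DL1_diff[OF \<psi>(1) \<phi>(1)]])
        also have "\<dots> \<le> (\<bar>C\<bar> + 1) * DL1_seminorm k (\<lambda>t. \<psi> t - \<phi> t)"
          by (rule mult_right_mono) (auto simp: DL1_seminorm_nonneg)
        also have "\<dots> < (\<bar>C\<bar> + 1) * r" using \<psi> by (intro mult_strict_left_mono) auto
        also have "\<dots> = e" by (simp add: r_def add_nonneg_pos order_less_imp_not_eq2)
        finally show ?thesis using e(2) by (auto simp: dist_norm norm_minus_commute subset_iff)
      qed
      ultimately show "\<exists>W. openin DL1_topology W \<and> \<phi> \<in> W \<and> W \<subseteq> {\<phi> \<in> topspace DL1_topology. T \<phi> \<in> V}"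
        using openin_subset by (intro exI[of _ ?B]) fastforce
    qed
  qed simp
  then show ?thesis using add cmult by (simp add: DL1'_def)
qed

lemma DL1'_sum:
  assumes "\<And>i. i \<in> A \<Longrightarrow> T i \<in> DL1'" "finite A"
  shows "(\<lambda>\<phi>. \<Sum>i\<in>A. T i \<phi>) \<in> DL1'"
  using assms(2,1)
proof (induction A)
  case empty
  show ?case by (rule DL1'I[of _ 0 0]) (auto simp: scaleC.zero_right)
next
  case (insert i A)
  then have T: "T i \<in> DL1'" "(\<lambda>\<phi>. \<Sum>i\<in>A. T i \<phi>) \<in> DL1'" by auto
  obtain C k where 1: "C \<ge> 0" "\<And>\<phi>. \<phi> \<in> DL1 \<Longrightarrow> norm (T i \<phi>) \<le> C * DL1_seminorm k \<phi>"
    using DL1'_bound[OF T(1)] by metis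
  obtain C' k' where 2: "C' \<ge> 0" "\<And>\<phi>. \<phi> \<in> DL1 \<Longrightarrow> norm (\<Sum>i\<in>A. T i \<phi>) \<le> C' * DL1_seminorm k' \<phi>"
    using DL1'_bound[OF T(2)] by metis
  have "(\<lambda>\<phi>. T i \<phi> + (\<Sum>i\<in>A. T i \<phi>)) \<in> DL1'"
  proof (rule DL1'I)
    fix \<phi> :: "real \<Rightarrow> complex" assume \<phi>: "\<phi> \<in> DL1"
    have "norm (T i \<phi> + (\<Sum>i\<in>A. T i \<phi>)) \<le> C * DL1_seminorm k \<phi> + C' * DL1_seminorm k' \<phi>"
      by (intro norm_triangle_le add_mono 1 2 \<phi>)
    also have "\<dots> \<le> C * DL1_seminorm (max k k') \<phi> + C' * DL1_seminorm (max k k') \<phi>"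
      using 1 2 by (intro add_mono mult_left_mono DL1_seminorm_mono) auto
    finally show "norm (T i \<phi> + (\<Sum>i\<in>A. T i \<phi>)) \<le> (C + C') * DL1_seminorm (max k k') \<phi>"
      by (simp add: distrib_right)
  qed (auto simp: distr_add[OF T(1)] distr_add[OF T(2)] distr_cmult[OF T(1)] distr_cmult[OF T(2)] scaleC.add_right)
  then show ?case using insert by simp
qed

lemma DL1'_distr_deriv:
  assumes "U \<in> DL1'"
  shows "distr_deriv U \<in> DL1'"
proof -
  obtain C k where b: "C \<ge> 0" "\<And>\<phi>. \<phi> \<in> DL1 \<Longrightarrow> norm (U \<phi>) \<le> C * DL1_seminorm k \<phi>"
    using DL1'_bound[OF assms] by metis
  have eq: "distr_deriv U \<phi> = - U (nth_vderiv 1 \<phi>)" for \<phi>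
    by (simp add: distr_deriv_def nth_vderiv_def)
  show ?thesis
  proof (rule DL1'I)
    fix \<phi> :: "real \<Rightarrow> complex" assume \<phi>: "\<phi> \<in> DL1"
    then show "distr_deriv U (\<lambda>t. c * \<phi> t) = c *\<^sub>C distr_deriv U \<phi>" for c
      by (simp add: eq nth_vderiv_cmult DL1_smooth distr_cmult[OF assms] DL1_nth_vderiv scaleC.minus_right)
    show "norm (distr_deriv U \<phi>) \<le> C * DL1_seminorm (Suc k) \<phi>"
      unfolding eq norm_minus_cancel
      by (rule order_trans[OF b(2)[OF DL1_nth_vderiv[OF \<phi>]] mult_left_mono[OF DL1_seminorm_deriv_le b(1)]])
    fix \<psi> :: "real \<Rightarrow> complex" assume "\<psi> \<in> DL1"
    then show "distr_deriv U (\<lambda>t. \<phi> t + \<psi> t) = distr_deriv U \<phi> + distr_deriv U \<psi>"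
      using \<phi> by (simp add: eq nth_vderiv_add DL1_smooth distr_add[OF assms] DL1_nth_vderiv)
  qed
qed

lemma distr_deriv_funpow_DL1': "U \<in> DL1' \<Longrightarrow> (distr_deriv ^^ j) U \<in> DL1'"
  by (induction j) (auto simp: DL1'_distr_deriv)

lemma distr_deriv_funpow:
  "(distr_deriv ^^ j) U \<phi> = (- 1) ^ j *\<^sub>R U (nth_vderiv j \<phi>)"
proof (induction j arbitrary: \<phi>)
  case (Suc j)
  have "(distr_deriv ^^ Suc j) U \<phi> = - (distr_deriv ^^ j) U (nth_vderiv 1 \<phi>)"
    by (simp add: distr_deriv_def nth_vderiv_def)
  then show ?case
    by (simp add: Suc nth_vderiv_add_index)
qed simp

lemma regular_distr_DL1':
  fixes g :: "real \<Rightarrow> 'x::complex_banach"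
  assumes g: "continuous_on UNIV g" "\<And>t. norm (g t) \<le> M"
  shows "regular_distr g \<in> DL1'"
proof (rule DL1'I)
  have int: "(\<lambda>t. \<phi> t *\<^sub>C g t) integrable_on UNIV" if "\<phi> \<in> DL1" for \<phi>
    by (rule scaleC_integrable[OF smooth_continuous[OF DL1_smooth[OF that]] DL1_integrable_0[OF that] g])
  fix \<phi> :: "real \<Rightarrow> complex" assume \<phi>: "\<phi> \<in> DL1"
  show "regular_distr g (\<lambda>t. c * \<phi> t) = c *\<^sub>C regular_distr g \<phi>" for c
    using integral_linear[OF int[OF \<phi>] scaleC.bounded_linear_right[of c]]
    by (simp add: regular_distr_def o_def scaleC_scaleC)
  show "norm (regular_distr g \<phi>) \<le> M * DL1_seminorm 0 \<phi>"
    unfolding regular_distr_def DL1_seminorm_0 mult.commute[of M]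
    by (rule norm_integral_scaleC_le[OF smooth_continuous[OF DL1_smooth[OF \<phi>]] DL1_integrable_0[OF \<phi>] g])
  fix \<psi> :: "real \<Rightarrow> complex" assume "\<psi> \<in> DL1"
  then show "regular_distr g (\<lambda>t. \<phi> t + \<psi> t) = regular_distr g \<phi> + regular_distr g \<psi>"
    using int \<phi> by (simp add: regular_distr_def scaleC.add_left integral_add)
qed

subsection \<open>Orbits under translation\<close>

text \<open>With \<open>v t = \<phi> (- t)\<close>, the function \<open>T * \<phi>\<close> is the orbit \<open>x \<mapsto> T (v (\<cdot> - x))\<close> of \<open>v\<close> under translation.
  The estimates are made in this form.\<close>

lemma distr_translate_Lipschitz:
  assumes T: "T \<in> DL1'" and v: "v \<in> DL1"
  obtains K where "K \<ge> 0" "\<And>p q. norm (T (\<lambda>t. v (t - q)) - T (\<lambda>t. v (t - p))) \<le> K * \<bar>q - p\<bar>"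
proof -
  obtain C k where b: "C \<ge> 0" "\<And>\<phi>. \<phi> \<in> DL1 \<Longrightarrow> norm (T \<phi>) \<le> C * DL1_seminorm k \<phi>"
    using DL1'_bound[OF T] by metis
  show ?thesis
  proof (rule that)
    show "0 \<le> C * DL1_seminorm k (nth_vderiv 1 v)" using b by (simp add: DL1_seminorm_nonneg)
    fix p q
    have "norm (T (\<lambda>t. v (t - q)) - T (\<lambda>t. v (t - p))) = norm (T (\<lambda>t. v (t - q) - v (t - p)))"
      by (simp add: distr_diff[OF T] DL1_translate v)
    also have "\<dots> \<le> C * (\<bar>q - p\<bar> * DL1_seminorm k (nth_vderiv 1 v))"
      by (rule order_trans[OF b(2) mult_left_mono[OF DL1_seminorm_translate_diff_le b(1)]])
        (intro DL1_diff DL1_translate v)+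
    finally show "norm (T (\<lambda>t. v (t - q)) - T (\<lambda>t. v (t - p))) \<le> C * DL1_seminorm k (nth_vderiv 1 v) * \<bar>q - p\<bar>"
      by (simp add: mult_ac)
  qed
qed

lemma distr_translate_bounded:
  assumes T: "T \<in> DL1'" and v: "v \<in> DL1"
  obtains M where "M \<ge> 0" "\<And>x. norm (T (\<lambda>t. v (t - x))) \<le> M"
proof -
  obtain C k where b: "C \<ge> 0" "\<And>\<phi>. \<phi> \<in> DL1 \<Longrightarrow> norm (T \<phi>) \<le> C * DL1_seminorm k \<phi>"
    using DL1'_bound[OF T] by metis
  show ?thesis
    using b(2)[OF DL1_translate[OF v]] b(1)
    by (intro that[of "C * DL1_seminorm k v"]) (auto simp: DL1_seminorm_translate[OF v] DL1_seminorm_nonneg)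
qed

text \<open>An increment of the orbit is \<open>T\<close> applied to the convolution of \<open>- v'\<close> with the indicator
  function of a short interval, and such a weight is almost a multiple of a translation.\<close>

lemma distr_translate_has_vderiv:
  assumes T: "T \<in> DL1'" and v: "v \<in> DL1"
  shows "((\<lambda>x. T (\<lambda>t. v (t - x))) has_vector_derivative T (\<lambda>t. - nth_vderiv 1 v (t - x))) (at x)"
proof -
  define v' where "v' = nth_vderiv 1 v"
  have v': "v' \<in> DL1" unfolding v'_def by (rule DL1_nth_vderiv[OF v])
  obtain C k where b: "C \<ge> 0" "\<And>\<phi>. \<phi> \<in> DL1 \<Longrightarrow> norm (T \<phi>) \<le> C * DL1_seminorm k \<phi>"
    using DL1'_bound[OF T] by metis
  have main: "norm (T (\<lambda>t. v (t - q)) - T (\<lambda>t. v (t - p)) + (q - p) *\<^sub>R T (\<lambda>t. v' (t - x)))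
      \<le> C * DL1_seminorm k (nth_vderiv 1 v') * (q - p)\<^sup>2" if "p \<le> q" "x \<in> {p..q}" for p q
  proof -
    let ?w = "\<lambda>s. complex_of_real (indicator {p..q} s)"
    have w: "integrable lborel ?w" "(\<integral>s. ?w s \<partial>lborel) = of_real (q - p)" "L1_norm ?w = q - p"
      using that by (auto simp: integrable_indicator_Icc)
    have c: "conv_fun ?w v' \<in> DL1" by (intro conv_fun_DL1 w v')
    have "T (\<lambda>t. v (t - q)) - T (\<lambda>t. v (t - p)) = T (\<lambda>t. - conv_fun ?w v' t)"
      using translate_diff_eq_conv_fun[OF v that(1), folded v'_def] by (simp add: distr_diff[OF T, symmetric] DL1_translate v)
    moreover have "(q - p) *\<^sub>R T (\<lambda>t. v' (t - x)) = T (\<lambda>t. of_real (q - p) * v' (t - x))"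
      by (simp add: distr_cmult[OF T] DL1_translate v' scaleC_of_real del: of_real_diff)
    ultimately have "norm (T (\<lambda>t. v (t - q)) - T (\<lambda>t. v (t - p)) + (q - p) *\<^sub>R T (\<lambda>t. v' (t - x)))
        = norm (T (\<lambda>t. conv_fun ?w v' t - of_real (q - p) * v' (t - x)))"
      using c by (simp add: distr_uminus[OF T] distr_diff[OF T] DL1_translate DL1_cmult v' norm_minus_commute
          del: of_real_diff)
    also have "\<dots> \<le> C * DL1_seminorm k (\<lambda>t. conv_fun ?w v' t - of_real (q - p) * v' (t - x))"
      by (intro b DL1_diff DL1_cmult DL1_translate v' c)
    also have "\<dots> \<le> C * (L1_norm ?w * (q - p) * DL1_seminorm k (nth_vderiv 1 v'))"
      using that by (intro mult_left_mono DL1_seminorm_conv_fun_approx w v' b) (auto simp: indicator_def split: if_splits)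
    finally show ?thesis using that by (simp add: w power2_eq_square mult_ac)
  qed
  show ?thesis
    unfolding v'_def[symmetric]
  proof (rule has_vector_derivative_quadratic)
    fix y
    have D: "T (\<lambda>t. - v' (t - x)) = - T (\<lambda>t. v' (t - x))"
      by (simp add: distr_uminus[OF T] DL1_translate v')
    show "norm (T (\<lambda>t. v (t - y)) - T (\<lambda>t. v (t - x)) - (y - x) *\<^sub>R T (\<lambda>t. - v' (t - x)))
        \<le> C * DL1_seminorm k (nth_vderiv 1 v') * (y - x)\<^sup>2"
    proof (cases "x \<le> y")
      case True
      then show ?thesis using main[of x y] by (simp add: D)
    next
      case False
      have "T (\<lambda>t. v (t - y)) - T (\<lambda>t. v (t - x)) + (y - x) *\<^sub>R T (\<lambda>t. v' (t - x))
          = - (T (\<lambda>t. v (t - x)) - T (\<lambda>t. v (t - y)) + (x - y) *\<^sub>R T (\<lambda>t. v' (t - x)))"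
        by (simp add: scaleR_diff_left)
      then show ?thesis
        using main[of y x] False by (simp only: D scaleR_minus_right diff_minus_eq_add norm_minus_cancel)
          (simp add: power2_commute)
    qed
  qed
qed

lemma conv_distr_has_vderiv:
  assumes "T \<in> DL1'" "\<phi> \<in> DL1"
  shows "(conv_distr T \<phi> has_vector_derivative conv_distr T (nth_vderiv 1 \<phi>) x) (at x)"
proof -
  have "nth_vderiv 1 (\<lambda>t. \<phi> (- t)) = (\<lambda>t. - nth_vderiv 1 \<phi> (- t))"
    using nth_vderiv_affine[OF DL1_smooth[OF assms(2)], of 1 "-1" 0] by simp
  with distr_translate_has_vderiv[OF assms(1) DL1_reflect[OF assms(2)], of x]
  show ?thesis by (simp add: conv_distr_def[abs_def])
qed

lemma conv_distr_smooth: "T \<in> DL1' \<Longrightarrow> \<phi> \<in> DL1 \<Longrightarrow> conv_distr T \<phi> \<in> smooth_funs"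
  by (rule smooth_coinduct[of _ "conv_distr T ` DL1"]) (auto intro: conv_distr_has_vderiv DL1_nth_vderiv)

lemma distr_translate_continuous:
  "T \<in> DL1' \<Longrightarrow> v \<in> DL1 \<Longrightarrow> continuous_on S (\<lambda>x. T (\<lambda>t. v (t - x)))"
  using smooth_continuous[OF conv_distr_smooth, of T "\<lambda>t. v (- t)" S]
  by (simp add: conv_distr_def[abs_def] DL1_reflect)

lemma conv_distr_continuous: "T \<in> DL1' \<Longrightarrow> \<phi> \<in> DL1 \<Longrightarrow> continuous_on S (conv_distr T \<phi>)"
  by (rule smooth_continuous[OF conv_distr_smooth])

subsection \<open>Exchanging a distribution with an integral\<close>

text \<open>Extended to the whole line by constants, the function has derivative \<open>0\<close> everywhere.\<close>

lemma quadratic_increments_imp_eq: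
  fixes f :: "real \<Rightarrow> 'a::real_normed_vector"
  assumes "a \<le> b" and inc: "\<And>p q. a \<le> p \<Longrightarrow> p \<le> q \<Longrightarrow> q \<le> b \<Longrightarrow> norm (f q - f p) \<le> K * (q - p)\<^sup>2"
  shows "f b = f a"
proof -
  let ?g = "\<lambda>s. f (max a (min b s))"
  have le: "norm (?g y - ?g x) \<le> \<bar>K\<bar> * (y - x)\<^sup>2" if "x \<le> y" for x y
  proof -
    let ?p = "max a (min b x)" and ?q = "max a (min b y)"
    have pq: "a \<le> ?p" "?p \<le> ?q" "?q \<le> b" "?q - ?p \<le> y - x" using that assms(1) by (auto simp: max_def min_def)
    have "norm (?g y - ?g x) \<le> K * (?q - ?p)\<^sup>2" by (rule inc[OF pq(1-3)])
    also have "\<dots> \<le> \<bar>K\<bar> * (y - x)\<^sup>2" using pq by (intro mult_mono power_mono) auto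
    finally show ?thesis .
  qed
  have "norm (?g y - ?g x) \<le> \<bar>K\<bar> * (y - x)\<^sup>2" for x y
    using le[of x y] le[of y x] by (cases "x \<le> y") (auto simp: norm_minus_commute power2_commute)
  then have "(?g has_vector_derivative 0) (at x)" for x
    by (intro has_vector_derivative_quadratic[of _ _ _ "\<bar>K\<bar>"]) simp
  from vector_derivative_Lipschitz[OF this, of 0 b a] show ?thesis
    using assms(1) by simp
qed

text \<open>Both sides, as functions of the upper limit of integration, change over \<open>[p, q]\<close> by
  \<open>(\<integral>\<^bsub>p\<^esub>\<^bsup>q\<^esup> \<eta>) T (v (\<cdot> - p))\<close> up to an error of order \<open>(q - p)\<^sup>2\<close>, so their difference is constant.\<close>

lemma integral_translates_eq_conv_fun:
  fixes T :: "'x::complex_banach distr"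
  assumes T: "T \<in> DL1'" and v: "v \<in> DL1" and \<eta>: "continuous_on UNIV \<eta>" and R: "\<And>t. \<bar>t\<bar> \<ge> R \<Longrightarrow> \<eta> t = 0"
  shows "integral UNIV (\<lambda>x. \<eta> x *\<^sub>C T (\<lambda>t. v (t - x))) = T (conv_fun \<eta> v)"
proof -
  let ?R = "\<bar>R\<bar>"
  have R': "\<eta> t = 0" if "t \<notin> {-?R<..<?R}" for t using that R[of t] by auto
  define U where "U x = T (\<lambda>t. v (t - x))" for x
  obtain K where K: "K \<ge> 0" "\<And>p q. norm (U q - U p) \<le> K * \<bar>q - p\<bar>"
    unfolding U_def using distr_translate_Lipschitz[OF T v] by metis
  have U: "continuous_on S U" for S
    unfolding U_def by (rule distr_translate_continuous[OF T v])
  obtain C k where b: "C \<ge> 0" "\<And>\<phi>. \<phi> \<in> DL1 \<Longrightarrow> norm (T \<phi>) \<le> C * DL1_seminorm k \<phi>"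
    using DL1'_bound[OF T] by metis
  have \<eta>': "continuous_on S \<eta>" for S using \<eta> continuous_on_subset by blast
  have \<eta>U: "continuous_on S (\<lambda>x. \<eta> x *\<^sub>C U x)" for S by (intro scaleC.continuous_on \<eta>' U)
  obtain M where M: "M \<ge> 0" "\<And>t. cmod (\<eta> t) \<le> M"
  proof -
    have "bounded (\<eta> ` {-?R..?R})" by (intro compact_imp_bounded compact_continuous_image \<eta>') auto
    then obtain M where M: "\<forall>x\<in>\<eta> ` {-?R..?R}. cmod x \<le> M" unfolding bounded_iff by blast
    show thesis
    proof (rule that[of "\<bar>M\<bar>"])
      show "cmod (\<eta> t) \<le> \<bar>M\<bar>" for t
      proof (cases "t \<in> {-?R..?R}")
        case True
        then have "cmod (\<eta> t) \<le> M" using M by blast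
        then show ?thesis by simp
      next
        case False
        then have "\<eta> t = 0" by (intro R') auto
        then show ?thesis by simp
      qed
    qed simp
  qed
  define w where "w q = (\<lambda>s. indicator {-?R..q} s *\<^sub>R \<eta> s)" for q
  have w: "integrable lborel (w q)" for q
    unfolding w_def by (rule borel_integrable_compact[OF compact_Icc \<eta>'])
  have w_int: "(\<integral>s. w q s \<partial>lborel) = integral {-?R..q} \<eta>" for q
    using set_borel_integral_eq_integral(2)[of "{-?R..q}" \<eta>] w[of q]
    by (simp add: set_integrable_def set_lebesgue_integral_def w_def)
  define \<Phi> where "\<Phi> q = T (conv_fun (w q) v) - integral {-?R..q} (\<lambda>x. \<eta> x *\<^sub>C U x)" for q
  define S where "S = DL1_seminorm k (nth_vderiv 1 v)"
  have inc: "norm (\<Phi> q - \<Phi> p) \<le> (C * M * S + M * K) * (q - p)\<^sup>2"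
    if pq: "-?R \<le> p" "p \<le> q" "q \<le> ?R" for p q
  proof -
    let ?u = "\<lambda>s. w q s - w p s"
    let ?I = "integral {p..q} \<eta>"
    have u: "integrable lborel ?u" using w by simp
    have u_int: "(\<integral>s. ?u s \<partial>lborel) = ?I"
      using w Henstock_Kurzweil_Integration.integral_combine[OF pq(1,2) integrable_continuous_real[OF \<eta>']]
      by (simp add: w_int[symmetric] algebra_simps)
    have u_eq: "?u s = indicator {p<..q} s *\<^sub>R \<eta> s" for s
      using pq by (cases "s \<le> p"; cases "s \<le> q"; cases "- ?R \<le> s") (simp_all add: w_def)
    have u_supp: "s \<in> {p..q}" if "?u s \<noteq> 0" for s
      using that unfolding u_eq by (auto simp: indicator_def of_bool_def split: if_splits)
    have "cmod (?u s) \<le> M * indicator {p..q} s" for s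
      unfolding u_eq using M by (cases "s \<in> {p<..q}") (simp_all add: indicator_def)
    then have "L1_norm ?u \<le> (\<integral>s. M * indicator {p..q} s \<partial>lborel)"
      using u by (intro integral_mono integrable_norm integrable_mult_right integrable_real_indicator)
        (auto simp: emeasure_lborel_Icc_eq)
    then have u_norm: "L1_norm ?u \<le> M * (q - p)" using pq by simp
    have cu: "conv_fun ?u v \<in> DL1" and cw: "conv_fun (w q) v \<in> DL1" for q
      by (intro conv_fun_DL1 u w v)+
    have "conv_fun (w q) v = conv_fun (\<lambda>s. ?u s + w p s) v" by simp
    also have "\<dots> = (\<lambda>t. conv_fun ?u v t + conv_fun (w p) v t)"
      by (rule conv_fun_add_left[OF u w v])
    finally have 1: "T (conv_fun (w q) v) - T (conv_fun (w p) v) = T (conv_fun ?u v)"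
      by (simp add: distr_add[OF T] cu cw)
    have "T (conv_fun ?u v) - ?I *\<^sub>C U p = T (\<lambda>t. conv_fun ?u v t - ?I * v (t - p))"
      by (simp add: U_def distr_cmult[OF T, symmetric] distr_diff[OF T] DL1_cmult DL1_translate v cu)
    then have "norm (T (conv_fun ?u v) - ?I *\<^sub>C U p)
        \<le> C * DL1_seminorm k (\<lambda>t. conv_fun ?u v t - ?I * v (t - p))"
      using b(2) by (simp add: DL1_diff DL1_cmult DL1_translate v cu)
    also have "\<dots> \<le> C * (L1_norm ?u * (q - p) * S)"
      unfolding S_def using u_supp
      by (intro mult_left_mono DL1_seminorm_conv_fun_approx u v u_int b) fastforce
    also have "\<dots> \<le> C * (M * (q - p) * (q - p) * S)"
      using pq b(1) u_norm by (intro mult_left_mono mult_right_mono) (auto simp: S_def DL1_seminorm_nonneg)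
    finally have 2: "norm (T (conv_fun ?u v) - ?I *\<^sub>C U p) \<le> C * (M * (q - p) * (q - p) * S)" .
    have 3: "integral {-?R..q} (\<lambda>x. \<eta> x *\<^sub>C U x) - integral {-?R..p} (\<lambda>x. \<eta> x *\<^sub>C U x)
        = integral {p..q} (\<lambda>x. \<eta> x *\<^sub>C U x)"
      using Henstock_Kurzweil_Integration.integral_combine[OF pq(1,2) integrable_continuous_real[OF \<eta>U]]
      by (simp add: algebra_simps)
    have "?I *\<^sub>C U p = integral {p..q} (\<lambda>x. \<eta> x *\<^sub>C U p)"
      using integral_linear[OF integrable_continuous_real[OF \<eta>'] scaleC.bounded_linear_left, of p q "U p"]
      by (simp add: o_def)
    then have "integral {p..q} (\<lambda>x. \<eta> x *\<^sub>C U x) - ?I *\<^sub>C U p = integral {p..q} (\<lambda>x. \<eta> x *\<^sub>C (U x - U p))"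
      by (simp add: scaleC.diff_right Henstock_Kurzweil_Integration.integral_diff
          integrable_continuous_real \<eta>U scaleC.continuous_on \<eta>')
    also have "norm \<dots> \<le> M * (K * (q - p)) * (q - p)"
    proof (rule integral_bound[OF pq(2)])
      show "continuous_on {p..q} (\<lambda>x. \<eta> x *\<^sub>C (U x - U p))"
        by (intro scaleC.continuous_on \<eta>' continuous_on_diff U continuous_on_const)
      fix x assume x: "x \<in> {p..q}"
      have "norm (U x - U p) \<le> K * (q - p)"
        using K(2)[of x p] x mult_left_mono[of "x - p" "q - p" K] K(1) by auto
      then show "norm (\<eta> x *\<^sub>C (U x - U p)) \<le> M * (K * (q - p))"
        unfolding norm_scaleC using M by (intro mult_mono) auto
    qed
    finally have 4: "norm (integral {p..q} (\<lambda>x. \<eta> x *\<^sub>C U x) - ?I *\<^sub>C U p) \<le> M * (K * (q - p)) * (q - p)" .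
    have "\<Phi> q - \<Phi> p = (T (conv_fun ?u v) - ?I *\<^sub>C U p) - (integral {p..q} (\<lambda>x. \<eta> x *\<^sub>C U x) - ?I *\<^sub>C U p)"
      unfolding \<Phi>_def using 1 3 by (simp add: algebra_simps)
    also have "norm \<dots> \<le> C * (M * (q - p) * (q - p) * S) + M * (K * (q - p)) * (q - p)"
      by (rule order_trans[OF norm_triangle_ineq4 add_mono[OF 2 4]])
    finally show ?thesis by (simp add: power2_eq_square algebra_simps)
  qed
  have "\<Phi> ?R = \<Phi> (- ?R)"
    by (rule quadratic_increments_imp_eq[OF _ inc]) auto
  moreover have "\<Phi> (- ?R) = 0"
  proof -
    have "w (- ?R) = (\<lambda>_. 0)" using R'[of "-?R"] by (auto simp: w_def indicator_def)
    then show ?thesis by (simp add: \<Phi>_def conv_fun_def[abs_def] distr_zero[OF T])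
  qed
  moreover have "w ?R = \<eta>" using R' by (force simp: w_def indicator_def)
  ultimately have "T (conv_fun \<eta> v) = integral {-?R..?R} (\<lambda>x. \<eta> x *\<^sub>C U x)"
    by (simp add: \<Phi>_def)
  also have "\<dots> = integral UNIV (\<lambda>x. \<eta> x *\<^sub>C U x)"
  proof (rule integral_unique[symmetric])
    show "((\<lambda>x. \<eta> x *\<^sub>C U x) has_integral integral {-?R..?R} (\<lambda>x. \<eta> x *\<^sub>C U x)) UNIV"
      by (rule has_integral_on_superset[OF integrable_integral[OF integrable_continuous_real[OF \<eta>U]]])
        (use R' in \<open>auto simp: scaleC.zero_left\<close>)
  qed
  finally show ?thesis by (simp add: U_def)
qed

section \<open>Approximate identities\<close>

lemma test_D_cmult:
  assumes "f \<in> test_D" shows "(\<lambda>t. c * f t) \<in> test_D"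
proof -
  obtain R where R: "R > 0" "\<And>j t. \<bar>t\<bar> \<ge> R \<Longrightarrow> nth_vderiv j f t = 0"
    using test_DE[OF assms] by metis
  show ?thesis
  proof (rule test_DI)
    show "(\<lambda>t. c * f t) \<in> smooth_funs" by (rule smooth_cmult[OF test_D_smooth[OF assms]])
    show "\<bar>t\<bar> \<le> R" if "c * f t \<noteq> 0" for t
      using R(2)[of t 0] that by (cases "R \<le> \<bar>t\<bar>") auto
  qed
qed

text \<open>The factors vanish for \<open>t \<le> -1\<close> and for \<open>t \<ge> 0\<close>, respectively.\<close>

definition bump :: "real \<Rightarrow> complex" where
  "bump t = flat_exp 1 (1 + t) * flat_exp 1 (- t)"

lemma bump_test_D: "bump \<in> test_D"
proof (rule test_DI)
  have "(\<lambda>t. flat_exp 1 (1 * t + 1) * flat_exp 1 ((- 1) * t + 0)) \<in> smooth_funs"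
    by (intro smooth_mult smooth_affine flat_exp_smooth)
  then show "bump \<in> smooth_funs" by (simp add: bump_def[abs_def] add.commute)
  show "\<bar>t\<bar> \<le> 1" if "bump t \<noteq> 0" for t
    using that by (auto simp: bump_def flat_exp_def split: if_splits)
qed

lemma bump_eq: "bump t = of_real (cmod (bump t))"
  by (simp add: bump_def flat_exp_def norm_mult)

lemma bump_nonzero_iff: "bump t \<noteq> 0 \<longleftrightarrow> -1 < t \<and> t < 0"
  by (auto simp: bump_def flat_exp_def)

lemma L1_norm_bump_pos: "L1_norm bump > 0"
proof -
  have "(\<integral>t. exp (- 6) * indicator {-2/3..-1/3::real} t \<partial>lborel) \<le> L1_norm bump"
  proof (rule integral_mono)
    show "integrable lborel (\<lambda>t. exp (- 6) * indicator {-2/3..-1/3::real} t :: real)"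
      by (intro integrable_mult_right integrable_real_indicator) (auto simp: emeasure_lborel_Icc_eq)
    show "integrable lborel (\<lambda>t. cmod (bump t))"
      using bump_test_D test_D_subset_DL1 by (intro integrable_norm DL1_integrable_0) auto
    fix t :: real
    have f: "exp (- 3) \<le> cmod (flat_exp 1 s)" if "s \<ge> 1/3" for s :: real
      using that by (simp add: flat_exp_def field_simps)
    show "exp (- 6) * indicator {-2/3..-1/3} t \<le> cmod (bump t)"
    proof (cases "t \<in> {-2/3..-1/3}")
      case True
      then have "exp (- 3) * exp (- 3) \<le> cmod (flat_exp 1 (1 + t)) * cmod (flat_exp 1 (- t))"
        by (intro mult_mono f) auto
      then show ?thesis using True by (simp add: bump_def norm_mult exp_add[symmetric])
    qed simp
  qed
  then have "exp (- 6) * (1 / 3) \<le> L1_norm bump" by simp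
  then show ?thesis using exp_gt_zero[of "- 6 :: real"] by linarith
qed

text \<open>The weights are supported to the left of the origin: convolving with them does not
  enlarge the support of a function to the right.\<close>

lemma approximate_identity:
  obtains \<kappa> :: "nat \<Rightarrow> real \<Rightarrow> complex"
  where "\<And>n. \<kappa> n \<in> test_D" "\<And>n t. \<kappa> n t \<noteq> 0 \<Longrightarrow> - 1 / real (Suc n) \<le> t \<and> t \<le> 0"
    "\<And>n. (\<integral>t. \<kappa> n t \<partial>lborel) = 1" "\<And>n. L1_norm (\<kappa> n) = 1"
proof -
  define \<kappa> :: "nat \<Rightarrow> real \<Rightarrow> complex" where
    "\<kappa> n t = of_real (real (Suc n) / L1_norm bump) * bump (real (Suc n) * t + 0)" for n t
  have supp: "\<kappa> n t \<noteq> 0 \<Longrightarrow> - 1 / real (Suc n) \<le> t \<and> t \<le> 0" for n t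
  proof -
    assume "\<kappa> n t \<noteq> 0"
    then have "-1 < real (Suc n) * t" "real (Suc n) * t < 0"
      using bump_nonzero_iff by (auto simp: \<kappa>_def)
    then show ?thesis by (simp add: field_simps mult_less_0_iff del: of_nat_Suc)
  qed
  have D: "\<kappa> n \<in> test_D" for n
  proof -
    have "(\<lambda>t. bump (real (Suc n) * t + 0)) \<in> test_D"
      by (intro test_D_affine bump_test_D) simp
    then show ?thesis
      unfolding \<kappa>_def by (rule test_D_cmult)
  qed
  have n1: "L1_norm (\<kappa> n) = 1" for n
  proof -
    have "L1_norm bump = real (Suc n) * L1_norm (\<lambda>t. bump (real (Suc n) * t))"
      using lborel_integral_real_affine[of "real (Suc n)" "\<lambda>t. cmod (bump t)" 0] by (simp del: of_nat_Suc)
    moreover have "L1_norm (\<kappa> n) = real (Suc n) / L1_norm bump * L1_norm (\<lambda>t. bump (real (Suc n) * t))"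
      using L1_norm_bump_pos by (simp add: \<kappa>_def norm_mult norm_divide del: of_nat_Suc)
    ultimately show ?thesis using L1_norm_bump_pos by (auto simp del: of_nat_Suc)
  qed
  have "(\<integral>t. \<kappa> n t \<partial>lborel) = 1" for n
  proof -
    have "\<kappa> n t = of_real (cmod (\<kappa> n t))" for t
      using L1_norm_bump_pos bump_eq[of "real (Suc n) * t"]
      by (simp add: \<kappa>_def norm_mult norm_divide del: of_nat_Suc)
    then have "(\<integral>t. \<kappa> n t \<partial>lborel) = (\<integral>t. complex_of_real (cmod (\<kappa> n t)) \<partial>lborel)" by simp
    also have "\<dots> = 1" by (simp add: n1)
    finally show ?thesis .
  qed
  with D supp n1 show thesis by (intro that[of \<kappa>])
qed

lemma DL1_seminorm_mollify:
  assumes "w \<in> test_D" "\<And>t. w t \<noteq> 0 \<Longrightarrow> - \<delta> \<le> t \<and> t \<le> 0" "(\<integral>t. w t \<partial>lborel) = 1" "L1_norm w = 1"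
    and \<phi>: "\<phi> \<in> DL1"
  shows "DL1_seminorm k (\<lambda>t. conv_fun w \<phi> t - \<phi> t) \<le> \<delta> * DL1_seminorm k (nth_vderiv 1 \<phi>)"
proof -
  have "integrable lborel w" using assms(1) test_D_subset_DL1 DL1_integrable_0 by auto
  from DL1_seminorm_conv_fun_approx[OF this, of 0 \<delta> \<phi> 1 k] show ?thesis
    using assms by force
qed

section \<open>The resolvent of differentiation and the structure of bounded distributions\<close>

definition exp_kernel :: "real \<Rightarrow> complex" where
  "exp_kernel s = (if s \<le> 0 then of_real (exp s) else 0)"

text \<open>The inverse of \<open>\<phi> \<mapsto> \<phi> - \<phi>'\<close> on the test functions is
  \<open>\<phi> \<mapsto> (t \<mapsto> \<integral>\<^bsub>t\<^esub>\<^bsup>\<infinity>\<^esup> exp (t - x) \<phi> x dx)\<close>.\<close>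

definition resolvent :: "(real \<Rightarrow> complex) \<Rightarrow> real \<Rightarrow> complex" where
  "resolvent = conv_fun exp_kernel"

definition id_minus_deriv :: "(real \<Rightarrow> complex) \<Rightarrow> real \<Rightarrow> complex" where
  "id_minus_deriv \<phi> = (\<lambda>t. \<phi> t - nth_vderiv 1 \<phi> t)"

lemma exp_kernel_integrable: "integrable lborel exp_kernel"
  and L1_norm_exp_kernel: "L1_norm exp_kernel = 1"
proof -
  let ?g = "\<lambda>t::real. exp (- t) * indicator {0..} t"
  have "(\<integral>\<^sup>+t. ennreal (exp (- t)) * indicator {0..} t \<partial>lborel) = ennreal (0 - (- exp (- 0)))"
  proof (rule nn_integral_FTC_atLeast)
    have "((\<lambda>t::real. exp (- t)) \<longlongrightarrow> 0) at_top"
      by (rule filterlim_compose[OF exp_at_bot filterlim_uminus_at_bot_at_top])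
    from tendsto_minus[OF this] show "((\<lambda>t::real. - exp (- t)) \<longlongrightarrow> 0) at_top"
      by simp
  qed (auto intro!: derivative_eq_intros)
  also have "(\<lambda>t. ennreal (exp (- t)) * indicator {0..} t) = (\<lambda>t. ennreal (?g t))"
    by (auto simp: indicator_def)
  finally have nn: "(\<integral>\<^sup>+t. ennreal (?g t) \<partial>lborel) = 1" by simp
  have g: "integrable lborel ?g"
    by (rule integrableI_nonneg) (use nn in auto)
  have g1: "(\<integral>t. ?g t \<partial>lborel) = 1"
    using nn by (subst integral_eq_nn_integral) auto
  have eq: "?g (0 + (- 1) * t) = cmod (exp_kernel t)" for t
    by (auto simp: exp_kernel_def indicator_def)
  have eq': "exp_kernel t = of_real (?g (0 + (- 1) * t))" for t
    by (auto simp: exp_kernel_def indicator_def)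
  have "integrable lborel (\<lambda>t. ?g (0 + (- 1) * t))"
    by (rule lborel_integrable_real_affine[OF g]) simp
  then have "integrable lborel (\<lambda>t. complex_of_real (?g (0 + (- 1) * t)))"
    by (rule integrable_of_real)
  then show "integrable lborel exp_kernel"
    unfolding eq'[symmetric] .
  show "L1_norm exp_kernel = 1"
    unfolding eq[symmetric] using lborel_integral_real_affine[of "- 1" ?g 0] g1 by simp
qed

lemma resolvent_DL1: "\<phi> \<in> DL1 \<Longrightarrow> resolvent \<phi> \<in> DL1"
  by (simp add: resolvent_def conv_fun_DL1 exp_kernel_integrable)

lemma resolvent_seminorm_le: "\<phi> \<in> DL1 \<Longrightarrow> DL1_seminorm k (resolvent \<phi>) \<le> DL1_seminorm k \<phi>"
  using DL1_seminorm_conv_fun_le[OF exp_kernel_integrable, of \<phi> k]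
  by (simp add: resolvent_def L1_norm_exp_kernel)

text \<open>The integrand is the derivative of \<open>s \<mapsto> exp s * \<phi> (t - s)\<close> on the left half-line, which tends
  to \<open>0\<close> at \<open>-\<infinity>\<close>.\<close>

lemma resolvent_id_minus_deriv:
  assumes \<phi>: "\<phi> \<in> DL1"
  shows "resolvent (id_minus_deriv \<phi>) = \<phi>"
proof
  fix t
  let ?u = "\<lambda>s. \<phi> (t - s) - nth_vderiv 1 \<phi> (t - s)"
  have d: "id_minus_deriv \<phi> \<in> DL1"
    unfolding id_minus_deriv_def by (intro DL1_diff DL1_nth_vderiv \<phi>)
  have int: "integrable lborel (\<lambda>s. exp_kernel s * ?u s)"
    using conv_fun_integrable[OF exp_kernel_integrable d, of t] by (simp add: id_minus_deriv_def)
  have FTC: "(\<integral>s. indicator {- real n..0} s *\<^sub>R (of_real (exp s) * ?u s) \<partial>lborel)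
      = \<phi> t - of_real (exp (- real n)) * \<phi> (t + real n)" for n
  proof -
    have "(\<integral>s. indicator {- real n..0} s *\<^sub>R (of_real (exp s) * ?u s) \<partial>lborel)
        = of_real (exp 0) * \<phi> (t - 0) - of_real (exp (- real n)) * \<phi> (t - (- real n))"
    proof (rule integral_FTC_Icc)
      show "((\<lambda>s. of_real (exp s) * \<phi> (t - s)) has_vector_derivative of_real (exp s) * ?u s)
          (at s within {- real n..0})" for s
      proof -
        have 1: "((\<lambda>s. t - s) has_vector_derivative - 1) (at s)"
          by (auto intro!: derivative_eq_intros simp: has_real_derivative_iff_has_vector_derivative[symmetric])
        from vector_diff_chain_at[OF 1 smooth_has_vderiv_0[OF DL1_smooth[OF \<phi>]]]
        have 2: "((\<lambda>s. \<phi> (t - s)) has_vector_derivative - nth_vderiv 1 \<phi> (t - s)) (at s)"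
          by (simp add: o_def)
        have 3: "((\<lambda>s. complex_of_real (exp s)) has_vector_derivative of_real (exp s)) (at s)"
          by (intro has_vector_derivative_of_real)
            (auto intro!: derivative_eq_intros simp: has_real_derivative_iff_has_vector_derivative[symmetric])
        have "((\<lambda>s. of_real (exp s) * \<phi> (t - s)) has_vector_derivative of_real (exp s) * ?u s) (at s)"
          using has_vector_derivative_mult[OF 3 2] by (simp add: algebra_simps)
        then show ?thesis by (rule has_vector_derivative_at_within)
      qed
      have "continuous_on UNIV (id_minus_deriv \<phi>)" by (rule smooth_continuous[OF DL1_smooth[OF d]])
      then have "continuous_on {- real n..0} (\<lambda>s. id_minus_deriv \<phi> (t - s))"
        by (intro continuous_on_compose2[of UNIV "id_minus_deriv \<phi>" _ "\<lambda>s. t - s"]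
            continuous_on_diff continuous_on_const continuous_on_id subset_UNIV)
      then show "continuous_on {- real n..0} (\<lambda>s. of_real (exp s) * ?u s)"
        unfolding id_minus_deriv_def
        by (intro continuous_on_mult continuous_on_of_real continuous_on_exp continuous_on_id)
    qed simp
    then show ?thesis by simp
  qed
  have "(\<lambda>n. \<integral>s. indicator {- real n..0} s *\<^sub>R (of_real (exp s) * ?u s) \<partial>lborel)
      \<longlonglongrightarrow> (\<integral>s. exp_kernel s * ?u s \<partial>lborel)"
  proof (rule integral_dominated_convergence[where w = "\<lambda>s. cmod (exp_kernel s * ?u s)"])
    have eq: "indicator {- real n..0} s *\<^sub>R (of_real (exp s) * ?u s)
        = indicator {- real n..} s *\<^sub>R (exp_kernel s * ?u s)" for n s
      by (auto simp: exp_kernel_def indicator_def)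
    have [measurable]: "(\<lambda>s. exp_kernel s * ?u s) \<in> borel_measurable borel"
      using borel_measurable_integrable[OF int] by simp
    show "(\<lambda>s. exp_kernel s * ?u s) \<in> borel_measurable lborel" by measurable
    show "(\<lambda>s. indicator {- real n..0} s *\<^sub>R (of_real (exp s) * ?u s)) \<in> borel_measurable lborel" for n
      unfolding eq by measurable
    show "integrable lborel (\<lambda>s. cmod (exp_kernel s * ?u s))" by (rule integrable_norm[OF int])
    show "AE s in lborel. norm (indicator {- real n..0} s *\<^sub>R (of_real (exp s) * ?u s))
        \<le> cmod (exp_kernel s * ?u s)" for n
      unfolding eq by (intro AE_I2) (simp add: indicator_def)
    show "AE s in lborel. (\<lambda>n. indicator {- real n..0} s *\<^sub>R (of_real (exp s) * ?u s)) \<longlonglongrightarrow> exp_kernel s * ?u s"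
    proof (intro AE_I2 tendsto_eventually)
      fix s :: real
      obtain m where "- s \<le> real m" using real_arch_simple by blast
      then have "indicator {- real n..} s *\<^sub>R (exp_kernel s * ?u s) = exp_kernel s * ?u s" if "n \<ge> m" for n
        using that by (auto simp: indicator_def)
      then show "\<forall>\<^sub>F n in sequentially. indicator {- real n..0} s *\<^sub>R (of_real (exp s) * ?u s) = exp_kernel s * ?u s"
        unfolding eq eventually_sequentially by blast
    qed
  qed
  then have lim: "(\<lambda>n. \<phi> t - of_real (exp (- real n)) * \<phi> (t + real n)) \<longlonglongrightarrow> resolvent (id_minus_deriv \<phi>) t"
    unfolding FTC by (simp add: resolvent_def conv_fun_def id_minus_deriv_def)
  obtain M where M: "\<And>t. cmod (\<phi> t) \<le> M" using DL1_bounded_fun[OF \<phi>] by metis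
  have "(\<lambda>n. of_real (exp (- real n)) * \<phi> (t + real n)) \<longlonglongrightarrow> 0"
  proof (rule Lim_null_comparison)
    show "\<forall>\<^sub>F n in sequentially. norm (of_real (exp (- real n)) * \<phi> (t + real n)) \<le> exp (- real n) * M"
      using M by (auto simp: norm_mult)
    have "(\<lambda>n. exp (- real n)) \<longlonglongrightarrow> 0"
      by (rule filterlim_compose[OF exp_at_bot])
        (simp add: filterlim_uminus_at_bot filterlim_real_sequentially)
    then show "(\<lambda>n. exp (- real n) * M) \<longlonglongrightarrow> 0" by (rule tendsto_mult_left_zero)
  qed
  then have "(\<lambda>n. \<phi> t - of_real (exp (- real n)) * \<phi> (t + real n)) \<longlonglongrightarrow> \<phi> t - 0"
    by (intro tendsto_diff tendsto_const)
  then show "resolvent (id_minus_deriv \<phi>) t = \<phi> t"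
    using LIMSEQ_unique[OF lim] by simp
qed

lemma nth_vderiv_1_resolvent:
  assumes "\<phi> \<in> DL1"
  shows "nth_vderiv 1 (resolvent \<phi>) = (\<lambda>t. resolvent \<phi> t - \<phi> t)"
proof -
  have "resolvent (id_minus_deriv \<phi>) = (\<lambda>t. resolvent \<phi> t - resolvent (nth_vderiv 1 \<phi>) t)"
    unfolding resolvent_def id_minus_deriv_def
    by (rule conv_fun_diff_right[OF exp_kernel_integrable assms DL1_nth_vderiv[OF assms]])
  then have "resolvent (nth_vderiv 1 \<phi>) t = resolvent \<phi> t - \<phi> t" for t
    by (simp add: resolvent_id_minus_deriv[OF assms] fun_eq_iff)
  then show ?thesis
    using nth_vderiv_conv_fun[OF exp_kernel_integrable assms, of 1] by (auto simp: resolvent_def)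
qed

text \<open>Convolutions commute with differentiation, hence with the inverse of the resolvent.\<close>

lemma resolvent_conv_fun:
  assumes w: "integrable lborel w" and \<phi>: "\<phi> \<in> DL1"
  shows "resolvent (conv_fun w \<phi>) = conv_fun w (resolvent \<phi>)"
proof -
  note r = resolvent_DL1[OF \<phi>]
  have "id_minus_deriv (conv_fun w (resolvent \<phi>))
      = conv_fun w (\<lambda>t. resolvent \<phi> t - nth_vderiv 1 (resolvent \<phi>) t)"
    unfolding id_minus_deriv_def nth_vderiv_conv_fun[OF w r] conv_fun_diff_right[OF w r DL1_nth_vderiv[OF r]] ..
  also have "\<dots> = conv_fun w \<phi>" by (simp only: nth_vderiv_1_resolvent[OF \<phi>]) simp
  finally show ?thesis using resolvent_id_minus_deriv[OF conv_fun_DL1[OF w r]] by simp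
qed

text \<open>The derivative of \<open>resolvent \<phi>\<close> is \<open>resolvent \<phi> - \<phi>\<close> and thus costs no derivative of \<open>\<phi>\<close>; the
  constant \<open>3\<close> counts the terms.\<close>

lemma resolvent_gain:
  assumes \<phi>: "\<phi> \<in> DL1"
  shows "DL1_seminorm (Suc k) (resolvent \<phi>) \<le> 3 * DL1_seminorm k \<phi>"
proof -
  have "DL1_seminorm k (nth_vderiv 1 (resolvent \<phi>)) \<le> DL1_seminorm k (resolvent \<phi>) + DL1_seminorm k \<phi>"
    unfolding nth_vderiv_1_resolvent[OF \<phi>] by (rule DL1_seminorm_diff[OF resolvent_DL1[OF \<phi>] \<phi>])
  moreover have "DL1_seminorm 0 (resolvent \<phi>) \<le> DL1_seminorm k (resolvent \<phi>)"
    by (rule DL1_seminorm_mono) simp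
  ultimately show ?thesis
    using resolvent_seminorm_le[OF \<phi>, of k] unfolding DL1_seminorm_Suc by simp
qed

lemma resolvent_funpow_DL1: "\<phi> \<in> DL1 \<Longrightarrow> (resolvent ^^ n) \<phi> \<in> DL1"
  by (induction n) (auto simp: resolvent_DL1)

lemma resolvent_funpow_gain: "\<phi> \<in> DL1 \<Longrightarrow> DL1_seminorm n ((resolvent ^^ n) \<phi>) \<le> 3 ^ n * L1_norm \<phi>"
proof (induction n)
  case (Suc n)
  have "DL1_seminorm (Suc n) (resolvent ((resolvent ^^ n) \<phi>)) \<le> 3 * DL1_seminorm n ((resolvent ^^ n) \<phi>)"
    by (rule resolvent_gain[OF resolvent_funpow_DL1[OF Suc.prems]])
  also have "\<dots> \<le> 3 * (3 ^ n * L1_norm \<phi>)" using Suc by simp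
  finally show ?case by simp
qed (simp add: DL1_seminorm_0)

lemma resolvent_funpow_translate: "(resolvent ^^ n) (\<lambda>t. \<phi> (t - x)) = (\<lambda>t. (resolvent ^^ n) \<phi> (t - x))"
proof (induction n)
  case (Suc n)
  then show ?case using conv_fun_translate[of exp_kernel "(resolvent ^^ n) \<phi>" x] by (simp add: resolvent_def)
qed simp

lemma resolvent_funpow_add:
  "\<phi> \<in> DL1 \<Longrightarrow> \<psi> \<in> DL1 \<Longrightarrow> (resolvent ^^ n) (\<lambda>t. \<phi> t + \<psi> t) = (\<lambda>t. (resolvent ^^ n) \<phi> t + (resolvent ^^ n) \<psi> t)"
proof (induction n)
  case (Suc n)
  then show ?case
    using conv_fun_add_right[OF exp_kernel_integrable resolvent_funpow_DL1[OF Suc.prems(1), of n]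
        resolvent_funpow_DL1[OF Suc.prems(2), of n]] by (simp add: resolvent_def)
qed simp

lemma resolvent_funpow_cmult: "(resolvent ^^ n) (\<lambda>t. c * \<phi> t) = (\<lambda>t. c * (resolvent ^^ n) \<phi> t)"
proof (induction n)
  case (Suc n)
  then show ?case using conv_fun_cmult_right[of exp_kernel c "(resolvent ^^ n) \<phi>"] by (simp add: resolvent_def)
qed simp

text \<open>The convolution of a test function with the exponential kernel cut off at \<open>-m\<close> is again a test
  function, and it vanishes on the right half-line if the test function does. This one-sidedness is
  what allows test functions on the half-line to determine the structure of \<open>T\<close>.\<close>

lemma resolvent_funpow_approx_test_D:
  assumes \<phi>: "\<phi> \<in> test_D" "\<And>t. t > 0 \<Longrightarrow> \<phi> t = 0"
  shows "\<exists>u. (\<forall>m. u m \<in> test_D) \<and> (\<forall>m t. t > 0 \<longrightarrow> u m t = 0) \<and>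
    (\<forall>k. (\<lambda>m. DL1_seminorm k (\<lambda>t. u m t - (resolvent ^^ n) \<phi> t)) \<longlonglongrightarrow> 0)"
proof -
  define E where "E m s = indicator {- real m..} s *\<^sub>R exp_kernel s" for m s
  define \<delta> where "\<delta> m = L1_norm (\<lambda>s. E m s - exp_kernel s)" for m
  note [measurable] = borel_measurable_integrable[OF exp_kernel_integrable, simplified]
  have E_le: "cmod (E m s) \<le> cmod (exp_kernel s)" "cmod (E m s - exp_kernel s) \<le> cmod (exp_kernel s)" for m s
    by (auto simp: E_def indicator_def)
  have E_int: "integrable lborel (E m)" for m
    by (rule Bochner_Integration.integrable_bound[OF exp_kernel_integrable]) (auto simp: E_def[abs_def] indicator_def)
  have E_norm: "L1_norm (E m) \<le> 1" for m
    unfolding L1_norm_exp_kernel[symmetric] by (intro integral_mono integrable_norm E_int exp_kernel_integrable E_le)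
  have "\<delta> \<longlonglongrightarrow> (\<integral>s. 0 \<partial>(lborel :: real measure))"
    unfolding \<delta>_def
  proof (rule integral_dominated_convergence[where w = "\<lambda>s. cmod (exp_kernel s)"])
    show "AE s in lborel. (\<lambda>m. cmod (E m s - exp_kernel s)) \<longlonglongrightarrow> 0"
    proof (intro AE_I2 tendsto_eventually)
      fix s :: real
      obtain m0 where "- s \<le> real m0" using real_arch_simple by blast
      then have "cmod (E m s - exp_kernel s) = 0" if "m \<ge> m0" for m
        using that by (auto simp: E_def indicator_def)
      then show "\<forall>\<^sub>F m in sequentially. cmod (E m s - exp_kernel s) = 0"
        unfolding eventually_sequentially by blast
    qed
  qed (use E_le exp_kernel_integrable E_int in \<open>auto intro!: integrable_norm simp: E_def[abs_def]\<close>)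
  then have \<delta>: "\<delta> \<longlonglongrightarrow> 0" by simp
  show ?thesis
  proof (induction n)
    case 0
    show ?case using \<phi> by (intro exI[of _ "\<lambda>_. \<phi>"]) (simp add: DL1_seminorm_zero)
  next
    case (Suc n)
    then obtain u where u: "\<And>m. u m \<in> test_D" "\<And>m t. t > 0 \<Longrightarrow> u m t = 0"
      "\<And>k. (\<lambda>m. DL1_seminorm k (\<lambda>t. u m t - (resolvent ^^ n) \<phi> t)) \<longlonglongrightarrow> 0" by blast
    let ?v = "(resolvent ^^ n) \<phi>"
    have v: "?v \<in> DL1" using \<phi>(1) test_D_subset_DL1 by (intro resolvent_funpow_DL1) blast
    have u': "u m \<in> DL1" for m using u(1) test_D_subset_DL1 by blast
    define w where "w m = conv_fun (E m) (u m)" for m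
    have zero: "w m t = 0" if "\<And>s. - real m \<le> s \<Longrightarrow> s \<le> 0 \<Longrightarrow> u m (t - s) = 0" for m t
    proof -
      have "E m s * u m (t - s) = 0" for s
        using that[of s] by (auto simp: E_def exp_kernel_def indicator_def)
      then show ?thesis unfolding w_def conv_fun_def by (simp only: Bochner_Integration.integral_zero)
    qed
    have "w m \<in> test_D" for m
    proof -
      obtain R where R: "R > 0" "\<And>j t. \<bar>t\<bar> \<ge> R \<Longrightarrow> nth_vderiv j (u m) t = 0"
        using test_DE[OF u(1)] by metis
      show ?thesis
      proof (rule test_DI)
        show "w m \<in> smooth_funs" unfolding w_def by (rule conv_fun_smooth[OF E_int u'])
        show "\<bar>t\<bar> \<le> R + real m" if "w m t \<noteq> 0" for t
        proof (rule ccontr)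
          assume "\<not> \<bar>t\<bar> \<le> R + real m"
          then have "u m (t - s) = 0" if "- real m \<le> s" "s \<le> 0" for s
            using R(2)[of "t - s" 0] that by force
          then show False using zero \<open>w m t \<noteq> 0\<close> by blast
        qed
      qed
    qed
    moreover have "w m t = 0" if "t > 0" for m t
      using u(2) that by (intro zero) force
    moreover have "(\<lambda>m. DL1_seminorm k (\<lambda>t. w m t - resolvent ?v t)) \<longlonglongrightarrow> 0" for k
    proof (rule tendsto_sandwich[OF _ _ tendsto_const])
      show "\<forall>\<^sub>F m in sequentially. 0 \<le> DL1_seminorm k (\<lambda>t. w m t - resolvent ?v t)"
        by (simp add: DL1_seminorm_nonneg)
      show "\<forall>\<^sub>F m in sequentially. DL1_seminorm k (\<lambda>t. w m t - resolvent ?v t)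
          \<le> DL1_seminorm k (\<lambda>t. u m t - ?v t) + \<delta> m * DL1_seminorm k ?v"
      proof (intro always_eventually allI)
        fix m
        let ?K = "\<lambda>s. E m s - exp_kernel s"
        have K: "integrable lborel ?K" using E_int exp_kernel_integrable by simp
        have "conv_fun (\<lambda>s. ?K s + exp_kernel s) ?v = (\<lambda>t. conv_fun ?K ?v t + resolvent ?v t)"
          using conv_fun_add_left[OF K exp_kernel_integrable v] by (simp add: resolvent_def)
        then have "(\<lambda>t. w m t - resolvent ?v t) = (\<lambda>t. conv_fun (E m) (\<lambda>t. u m t - ?v t) t + conv_fun ?K ?v t)"
          unfolding w_def conv_fun_diff_right[OF E_int u' v] by (simp add: fun_eq_iff)
        then have "DL1_seminorm k (\<lambda>t. w m t - resolvent ?v t)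
            \<le> DL1_seminorm k (conv_fun (E m) (\<lambda>t. u m t - ?v t)) + DL1_seminorm k (conv_fun ?K ?v)"
          by (simp only: DL1_seminorm_add[OF conv_fun_DL1[OF E_int DL1_diff[OF u' v]] conv_fun_DL1[OF K v]])
        also have "\<dots> \<le> L1_norm (E m) * DL1_seminorm k (\<lambda>t. u m t - ?v t) + \<delta> m * DL1_seminorm k ?v"
          unfolding \<delta>_def by (intro add_mono DL1_seminorm_conv_fun_le E_int K v DL1_diff u')
        also have "\<dots> \<le> 1 * DL1_seminorm k (\<lambda>t. u m t - ?v t) + \<delta> m * DL1_seminorm k ?v"
          by (intro add_right_mono mult_right_mono E_norm DL1_seminorm_nonneg)
        finally show "DL1_seminorm k (\<lambda>t. w m t - resolvent ?v t)
            \<le> DL1_seminorm k (\<lambda>t. u m t - ?v t) + \<delta> m * DL1_seminorm k ?v" by simp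
      qed
      show "(\<lambda>m. DL1_seminorm k (\<lambda>t. u m t - ?v t) + \<delta> m * DL1_seminorm k ?v) \<longlonglongrightarrow> 0"
        using tendsto_add[OF u(3) tendsto_mult_left_zero[OF \<delta>]] by simp
    qed
    ultimately show ?case by (intro exI[of _ w]) auto
  qed
qed

lemma id_minus_deriv_test_D:
  assumes "\<phi> \<in> test_D" shows "id_minus_deriv \<phi> \<in> test_D"
proof -
  obtain R where R: "R > 0" "\<And>j t. \<bar>t\<bar> \<ge> R \<Longrightarrow> nth_vderiv j \<phi> t = 0"
    using test_DE[OF assms] by metis
  show ?thesis
  proof (rule test_DI)
    show "id_minus_deriv \<phi> \<in> smooth_funs"
      unfolding id_minus_deriv_def using assms by (intro smooth_diff smooth_nth_vderiv test_D_smooth)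
    show "\<bar>t\<bar> \<le> R" if "id_minus_deriv \<phi> t \<noteq> 0" for t
      using R(2)[of t 0] R(2)[of t 1] that by (cases "R \<le> \<bar>t\<bar>") (auto simp: id_minus_deriv_def)
  qed
qed

lemma id_minus_deriv_funpow_test_D: "\<phi> \<in> test_D \<Longrightarrow> (id_minus_deriv ^^ n) \<phi> \<in> test_D"
  by (induction n) (auto simp: id_minus_deriv_test_D)

lemma resolvent_id_minus_deriv_funpow:
  "\<phi> \<in> test_D \<Longrightarrow> (resolvent ^^ n) ((id_minus_deriv ^^ n) \<phi>) = \<phi>"
proof (induction n)
  case (Suc n)
  have "(id_minus_deriv ^^ n) \<phi> \<in> DL1"
    using id_minus_deriv_funpow_test_D[OF Suc.prems] test_D_subset_DL1 by blast
  moreover have "(resolvent ^^ Suc n) \<psi> = (resolvent ^^ n) (resolvent \<psi>)" for \<psi>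
    by (simp add: funpow_swap1)
  ultimately show ?case
    using Suc by (simp add: resolvent_id_minus_deriv)
qed simp

lemma regular_distr_uniform_limit:
  fixes f :: "nat \<Rightarrow> real \<Rightarrow> 'x::complex_banach"
  assumes lim: "uniform_limit UNIV f g sequentially"
    and f: "\<And>n. continuous_on UNIV (f n)" "\<And>n x. norm (f n x) \<le> M"
    and g: "continuous_on UNIV g" "\<And>x. norm (g x) \<le> M" and \<phi>: "\<phi> \<in> DL1"
  shows "(\<lambda>n. regular_distr (f n) \<phi>) \<longlonglongrightarrow> regular_distr g \<phi>"
proof -
  have \<phi>': "continuous_on UNIV \<phi>" "integrable lborel \<phi>"
    by (rule smooth_continuous[OF DL1_smooth[OF \<phi>]], rule DL1_integrable_0[OF \<phi>])
  have diff: "regular_distr (f n) \<phi> - regular_distr g \<phi> = integral UNIV (\<lambda>t. \<phi> t *\<^sub>C (f n t - g t))" for n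
    using scaleC_integrable[OF \<phi>' f(1) f(2)] scaleC_integrable[OF \<phi>' g]
    by (simp add: regular_distr_def scaleC.diff_right Henstock_Kurzweil_Integration.integral_diff)
  show ?thesis
  proof (rule LIMSEQ_I)
    fix r :: real assume r: "r > 0"
    define e where "e = r / (L1_norm \<phi> + 1)"
    have e: "e > 0" using r by (simp add: e_def add_nonneg_pos)
    obtain N where N: "\<And>n x. n \<ge> N \<Longrightarrow> dist (f n x) (g x) < e"
      using uniform_limitD[OF lim e] by (auto simp: eventually_sequentially)
    have "norm (regular_distr (f n) \<phi> - regular_distr g \<phi>) < r" if "n \<ge> N" for n
    proof -
      have "norm (regular_distr (f n) \<phi> - regular_distr g \<phi>) \<le> L1_norm \<phi> * e"
        unfolding diff using N[OF that]
        by (intro norm_integral_scaleC_le \<phi>' continuous_on_diff f g) (auto simp: dist_norm intro: less_imp_le)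
      also have "\<dots> < (L1_norm \<phi> + 1) * e" using e by simp
      also have "\<dots> = r" by (simp add: e_def add_nonneg_pos order_less_imp_not_eq2)
      finally show ?thesis .
    qed
    then show "\<exists>N. \<forall>n\<ge>N. norm (regular_distr (f n) \<phi> - regular_distr g \<phi>) < r" by blast
  qed
qed

text \<open>If \<open>T\<close> has order \<open>k\<close>, then \<open>F = T \<circ> resolvent\<^bsup>k+1\<^esup>\<close> is a bounded continuous function \<open>f\<close>. It is
  the limit of the regularizations \<open>f n x = F (\<kappa> n (\<cdot> - x))\<close> by an approximate identity: since
  \<open>norm (F \<phi>)\<close> is dominated by the \<open>L\<^sup>1\<close> norm of \<open>resolvent \<phi>\<close>, both \<open>f n\<close> and \<open>f m\<close> are uniformly close
  to the regularization by \<open>\<kappa> n * \<kappa> m\<close>.\<close>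

lemma bounded_distr_structure:
  fixes T :: "'x::complex_banach distr"
  assumes T: "T \<in> DL1'"
  obtains N \<kappa> f M where "1 \<le> N" "\<And>n. \<kappa> n \<in> test_D" "\<And>n t. t > 0 \<Longrightarrow> \<kappa> n t = 0"
    "uniform_limit UNIV (\<lambda>n x. T (\<lambda>t. (resolvent ^^ N) (\<kappa> n) (t - x))) f sequentially"
    "continuous_on UNIV f" "\<And>x. norm (f x) \<le> M"
    "\<And>\<phi>. \<phi> \<in> test_D \<Longrightarrow> T \<phi> = regular_distr f ((id_minus_deriv ^^ N) \<phi>)"
proof -
  obtain C k where b: "C \<ge> 0" "\<And>\<phi>. \<phi> \<in> DL1 \<Longrightarrow> norm (T \<phi>) \<le> C * DL1_seminorm k \<phi>"
    using DL1'_bound[OF T] by metis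
  obtain \<kappa> :: "nat \<Rightarrow> real \<Rightarrow> complex" where \<kappa>: "\<And>n. \<kappa> n \<in> test_D"
    "\<And>n t. \<kappa> n t \<noteq> 0 \<Longrightarrow> - 1 / real (Suc n) \<le> t \<and> t \<le> 0"
    "\<And>n. (\<integral>t. \<kappa> n t \<partial>lborel) = 1" "\<And>n. L1_norm (\<kappa> n) = 1"
    using approximate_identity by metis
  have \<kappa>_DL1: "\<kappa> n \<in> DL1" for n using \<kappa>(1) test_D_subset_DL1 by blast
  have \<kappa>_int: "integrable lborel (\<kappa> n)" for n by (rule DL1_integrable_0[OF \<kappa>_DL1])
  have mollify: "DL1_seminorm j (\<lambda>t. conv_fun (\<kappa> n) \<phi> t - \<phi> t) \<le> 1 / real (Suc n) * DL1_seminorm j (nth_vderiv 1 \<phi>)"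
    if "\<phi> \<in> DL1" for j n \<phi>
    using \<kappa>(2) by (intro DL1_seminorm_mollify \<kappa> that) auto
  define N where "N = Suc k"
  define F where "F \<phi> = T ((resolvent ^^ N) \<phi>)" for \<phi>
  define C' where "C' = C * 3 ^ k"
  have C': "C' \<ge> 0" using b by (simp add: C'_def)
  have F_bound: "norm (F \<phi>) \<le> C' * L1_norm (resolvent \<phi>)" if \<phi>: "\<phi> \<in> DL1" for \<phi>
  proof -
    have "norm (F \<phi>) \<le> C * DL1_seminorm k ((resolvent ^^ k) (resolvent \<phi>))"
      unfolding F_def N_def funpow_Suc_right o_apply by (intro b resolvent_funpow_DL1 resolvent_DL1 \<phi>)
    also have "\<dots> \<le> C * (3 ^ k * L1_norm (resolvent \<phi>))"
      by (intro mult_left_mono resolvent_funpow_gain resolvent_DL1 \<phi> b)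
    finally show ?thesis by (simp add: C'_def)
  qed
  have F: "F \<in> DL1'"
  proof (rule DL1'I)
    fix \<phi> :: "real \<Rightarrow> complex" assume \<phi>: "\<phi> \<in> DL1"
    show "F (\<lambda>t. \<phi> t + \<psi> t) = F \<phi> + F \<psi>" if "\<psi> \<in> DL1" for \<psi>
      unfolding F_def resolvent_funpow_add[OF \<phi> that] by (intro distr_add[OF T] resolvent_funpow_DL1 \<phi> that)
    show "F (\<lambda>t. c * \<phi> t) = c *\<^sub>C F \<phi>" for c
      unfolding F_def resolvent_funpow_cmult by (intro distr_cmult[OF T] resolvent_funpow_DL1 \<phi>)
    have "C' * L1_norm (resolvent \<phi>) \<le> C' * DL1_seminorm 0 \<phi>"
      using resolvent_seminorm_le[OF \<phi>, of 0] by (intro mult_left_mono C') (simp add: DL1_seminorm_0)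
    then show "norm (F \<phi>) \<le> C' * DL1_seminorm 0 \<phi>" by (rule order_trans[OF F_bound[OF \<phi>]])
  qed
  define f where "f n x = F (\<lambda>t. \<kappa> n (t - x))" for n x
  have F_translate: "norm (F (\<lambda>t. \<phi> (t - x))) \<le> C' * L1_norm (resolvent \<phi>)" if \<phi>: "\<phi> \<in> DL1" for \<phi> x
    using F_bound[OF DL1_translate[OF \<phi>], of x] DL1_seminorm_translate[OF resolvent_DL1[OF \<phi>], of 0 x]
      resolvent_funpow_translate[of 1 \<phi> x] by (simp add: DL1_seminorm_0)
  have half: "norm (f n x - F (\<lambda>t. conv_fun (\<kappa> m) (\<kappa> n) (t - x))) \<le> 2 * C' * (1 / real (Suc m))" for n m x
  proof -
    let ?c = "conv_fun (\<kappa> m) (\<kappa> n)" and ?r = "resolvent (\<kappa> n)"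
    have c: "?c \<in> DL1" by (intro conv_fun_DL1 \<kappa>_int \<kappa>_DL1)
    have r: "?r \<in> DL1" by (rule resolvent_DL1[OF \<kappa>_DL1])
    have r1: "L1_norm ?r \<le> 1"
      using resolvent_seminorm_le[OF \<kappa>_DL1, of 0 n] by (simp add: DL1_seminorm_0 \<kappa>)
    have "DL1_seminorm 0 (nth_vderiv 1 ?r) \<le> DL1_seminorm 0 ?r + DL1_seminorm 0 (\<kappa> n)"
      unfolding nth_vderiv_1_resolvent[OF \<kappa>_DL1] by (rule DL1_seminorm_diff[OF r \<kappa>_DL1])
    then have r': "DL1_seminorm 0 (nth_vderiv 1 ?r) \<le> 2"
      using r1 by (simp add: DL1_seminorm_0 \<kappa>)
    have res: "resolvent (\<lambda>t. ?c t - \<kappa> n t) = (\<lambda>t. conv_fun (\<kappa> m) ?r t - ?r t)"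
      using conv_fun_diff_right[OF exp_kernel_integrable c \<kappa>_DL1] resolvent_conv_fun[OF \<kappa>_int \<kappa>_DL1]
      by (simp add: resolvent_def)
    have "f n x - F (\<lambda>t. ?c (t - x)) = - F (\<lambda>t. ?c (t - x) - \<kappa> n (t - x))"
      by (simp add: f_def distr_diff[OF F] DL1_translate c \<kappa>_DL1)
    then have "norm (f n x - F (\<lambda>t. ?c (t - x))) \<le> C' * L1_norm (\<lambda>t. conv_fun (\<kappa> m) ?r t - ?r t)"
      using F_translate[OF DL1_diff[OF c \<kappa>_DL1[of n]], where x = x] by (simp add: res)
    also have "\<dots> \<le> C' * (1 / real (Suc m) * 2)"
      using mollify[OF r, of 0 m] mult_left_mono[OF r', of "1 / real (Suc m)"]
      by (intro mult_left_mono C') (simp add: DL1_seminorm_0 del: of_nat_Suc)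
    finally show ?thesis by (simp add: mult_ac)
  qed
  have dist: "norm (f n x - f m x) \<le> 2 * C' * (1 / real (Suc m)) + 2 * C' * (1 / real (Suc n))" for n m x
  proof -
    have "norm (f n x - f m x) \<le> norm (f n x - F (\<lambda>t. conv_fun (\<kappa> m) (\<kappa> n) (t - x)))
        + norm (f m x - F (\<lambda>t. conv_fun (\<kappa> n) (\<kappa> m) (t - x)))"
      unfolding conv_fun_commute[of "\<kappa> n" "\<kappa> m"] by (rule order_trans[OF _ norm_triangle_ineq4]) simp
    then show ?thesis using half[where n = n and m = m and x = x] half[where n = m and m = n and x = x] by simp
  qed
  have "uniformly_Cauchy_on UNIV f"
    unfolding uniformly_Cauchy_on_def
  proof (intro allI impI)
    fix e :: real assume e: "e > 0"
    have "(\<lambda>n. 2 * C' * (1 / real (Suc n))) \<longlonglongrightarrow> 2 * C' * 0"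
      using LIMSEQ_Suc[OF lim_const_over_n[of 1]] by (intro tendsto_mult_left) simp
    then have "(\<lambda>n. 2 * C' * (1 / real (Suc n))) \<longlonglongrightarrow> 0" by simp
    then have "\<forall>\<^sub>F n in sequentially. 2 * C' * (1 / real (Suc n)) < e / 2"
      by (rule order_tendstoD(2)) (use e in simp)
    then obtain n0 where n0: "\<And>n. n \<ge> n0 \<Longrightarrow> 2 * C' * (1 / real (Suc n)) < e / 2"
      by (auto simp: eventually_sequentially)
    have "dist (f m x) (f n x) < e" if "m \<ge> n0" "n \<ge> n0" for m n x
      using dist[where n = m and m = n and x = x] n0[OF that(1)] n0[OF that(2)] by (simp add: dist_norm)
    then show "\<exists>M. \<forall>x\<in>UNIV. \<forall>m\<ge>M. \<forall>n\<ge>M. dist (f m x) (f n x) < e" by blast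
  qed
  then have "uniformly_convergent_on UNIV f" by (rule Cauchy_uniformly_convergent)
  then obtain g where g: "uniform_limit UNIV f g sequentially"
    unfolding uniformly_convergent_on_def by blast
  have f_cont: "continuous_on UNIV (f n)" for n
    unfolding f_def by (rule distr_translate_continuous[OF F \<kappa>_DL1])
  have g_cont: "continuous_on UNIV g"
    by (rule uniform_limit_theorem[OF _ g]) (simp_all add: f_cont)
  have f_bound: "norm (f n x) \<le> C'" for n x
  proof -
    have "L1_norm (resolvent (\<kappa> n)) \<le> 1"
      using resolvent_seminorm_le[OF \<kappa>_DL1, of 0 n] by (simp add: DL1_seminorm_0 \<kappa>)
    then have "C' * L1_norm (resolvent (\<kappa> n)) \<le> C'" using C' by (simp add: mult_left_le)
    then show ?thesis unfolding f_def by (rule order_trans[OF F_translate[OF \<kappa>_DL1]])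
  qed
  have g_bound: "norm (g x) \<le> C'" for x
    by (rule LIMSEQ_le_const2[OF tendsto_norm[OF tendsto_uniform_limitI[OF g UNIV_I]]]) (use f_bound in auto)
  have F_eq: "F \<phi> = regular_distr g \<phi>" if \<phi>: "\<phi> \<in> test_D" for \<phi>
  proof -
    have \<phi>': "\<phi> \<in> DL1" using \<phi> test_D_subset_DL1 by blast
    obtain R where R: "R > 0" "\<And>j t. \<bar>t\<bar> \<ge> R \<Longrightarrow> nth_vderiv j \<phi> t = 0"
      using test_DE[OF \<phi>] by metis
    have eq: "regular_distr (f n) \<phi> = F (conv_fun (\<kappa> n) \<phi>)" for n
      using integral_translates_eq_conv_fun[OF F \<kappa>_DL1 smooth_continuous[OF DL1_smooth[OF \<phi>']], of R n] R(2)[of _ 0]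
      by (simp add: regular_distr_def f_def conv_fun_commute[of \<phi>])
    obtain C2 k2 where b2: "C2 \<ge> 0" "\<And>\<phi>. \<phi> \<in> DL1 \<Longrightarrow> norm (F \<phi>) \<le> C2 * DL1_seminorm k2 \<phi>"
      using DL1'_bound[OF F] by metis
    have "(\<lambda>n. F (conv_fun (\<kappa> n) \<phi>) - F \<phi>) \<longlonglongrightarrow> 0"
    proof (rule Lim_null_comparison)
      show "\<forall>\<^sub>F n in sequentially. norm (F (conv_fun (\<kappa> n) \<phi>) - F \<phi>)
          \<le> C2 * (1 / real (Suc n) * DL1_seminorm k2 (nth_vderiv 1 \<phi>))"
      proof (intro always_eventually allI)
        fix n
        have c: "conv_fun (\<kappa> n) \<phi> \<in> DL1" by (intro conv_fun_DL1 \<kappa>_int \<phi>')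
        show "norm (F (conv_fun (\<kappa> n) \<phi>) - F \<phi>) \<le> C2 * (1 / real (Suc n) * DL1_seminorm k2 (nth_vderiv 1 \<phi>))"
          unfolding distr_diff[OF F c \<phi>', symmetric]
          by (rule order_trans[OF b2(2)[OF DL1_diff[OF c \<phi>']] mult_left_mono[OF mollify[OF \<phi>'] b2(1)]])
      qed
      have "(\<lambda>n. C2 * (1 / real (Suc n) * DL1_seminorm k2 (nth_vderiv 1 \<phi>)))
          \<longlonglongrightarrow> C2 * (0 * DL1_seminorm k2 (nth_vderiv 1 \<phi>))"
        using LIMSEQ_Suc[OF lim_const_over_n[of 1]] by (intro tendsto_mult_left tendsto_mult_right) simp
      then show "(\<lambda>n. C2 * (1 / real (Suc n) * DL1_seminorm k2 (nth_vderiv 1 \<phi>))) \<longlonglongrightarrow> 0" by simp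
    qed
    then have "(\<lambda>n. regular_distr (f n) \<phi>) \<longlonglongrightarrow> F \<phi>"
      unfolding eq by (rule LIM_zero_cancel)
    moreover have "(\<lambda>n. regular_distr (f n) \<phi>) \<longlonglongrightarrow> regular_distr g \<phi>"
      by (rule regular_distr_uniform_limit[OF g f_cont f_bound g_cont g_bound \<phi>'])
    ultimately show ?thesis by (rule LIMSEQ_unique)
  qed
  show thesis
  proof (rule that)
    show "1 \<le> N" by (simp add: N_def)
    show "\<kappa> n \<in> test_D" for n by (rule \<kappa>(1))
    show "\<kappa> n t = 0" if "t > 0" for n t using \<kappa>(2)[of n t] that by force
    show "uniform_limit UNIV (\<lambda>n x. T (\<lambda>t. (resolvent ^^ N) (\<kappa> n) (t - x))) g sequentially"
      using g unfolding f_def[abs_def] F_def resolvent_funpow_translate .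
    show "continuous_on UNIV g" "\<And>x. norm (g x) \<le> C'" by (fact g_cont, fact g_bound)
    show "T \<phi> = regular_distr g ((id_minus_deriv ^^ N) \<phi>)" if "\<phi> \<in> test_D" for \<phi>
      using F_eq[OF id_minus_deriv_funpow_test_D[OF that, of N]]
      by (simp add: F_def resolvent_id_minus_deriv_funpow[OF that])
  qed
qed

lemma regular_distr_scaleR:
  "regular_distr (\<lambda>x. r *\<^sub>R f x) \<phi> = r *\<^sub>R regular_distr f \<phi>" for f :: "real \<Rightarrow> 'x::complex_banach"
  by (simp add: regular_distr_def scaleC.scaleR_right)

text \<open>The adjoint of \<open>\<phi> \<mapsto> \<phi> - \<phi>'\<close> is \<open>U \<mapsto> U + U'\<close>.\<close>

lemma distr_id_minus_deriv_funpow: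
  fixes U :: "'x::complex_banach distr"
  assumes U: "U \<in> DL1'"
  shows "\<exists>c. \<forall>\<phi>\<in>test_D. U ((id_minus_deriv ^^ n) \<phi>) = (\<Sum>j\<le>n. c j *\<^sub>R (distr_deriv ^^ j) U \<phi>)"
proof (induction n)
  case 0
  show ?case by (intro exI[of _ "\<lambda>_. 1"]) simp
next
  case (Suc n)
  then obtain c where c: "\<And>\<phi>. \<phi> \<in> test_D \<Longrightarrow> U ((id_minus_deriv ^^ n) \<phi>) = (\<Sum>j\<le>n. c j *\<^sub>R (distr_deriv ^^ j) U \<phi>)"
    by blast
  define d where "d j = (if j \<le> n then c j else 0) + (if j = 0 then 0 else c (j - 1))" for j
  have "U ((id_minus_deriv ^^ Suc n) \<phi>) = (\<Sum>j\<le>Suc n. d j *\<^sub>R (distr_deriv ^^ j) U \<phi>)" if \<phi>: "\<phi> \<in> test_D" for \<phi>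
  proof -
    have \<phi>': "\<phi> \<in> DL1" "nth_vderiv 1 \<phi> \<in> DL1" using \<phi> test_D_subset_DL1 DL1_nth_vderiv by blast+
    let ?D = "\<lambda>j. (distr_deriv ^^ j) U"
    have step: "?D j (id_minus_deriv \<phi>) = ?D j \<phi> + ?D (Suc j) \<phi>" for j
    proof -
      have "?D (Suc j) \<phi> = - ?D j (nth_vderiv 1 \<phi>)" by (simp add: distr_deriv_def nth_vderiv_def)
      then show ?thesis
        unfolding id_minus_deriv_def distr_diff[OF distr_deriv_funpow_DL1'[OF U] \<phi>'] by simp
    qed
    have "U ((id_minus_deriv ^^ Suc n) \<phi>) = (\<Sum>j\<le>n. c j *\<^sub>R (?D j \<phi> + ?D (Suc j) \<phi>))"
      unfolding funpow_Suc_right o_apply c[OF id_minus_deriv_test_D[OF \<phi>]] step ..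
    also have "\<dots> = (\<Sum>j\<le>n. c j *\<^sub>R ?D j \<phi>) + (\<Sum>j\<le>n. c j *\<^sub>R ?D (Suc j) \<phi>)"
      by (simp only: scaleR_add_right sum.distrib)
    also have "(\<Sum>j\<le>n. c j *\<^sub>R ?D j \<phi>) = (\<Sum>j\<le>Suc n. (if j \<le> n then c j else 0) *\<^sub>R ?D j \<phi>)"
      by simp
    also have "(\<Sum>j\<le>n. c j *\<^sub>R ?D (Suc j) \<phi>) = (\<Sum>j\<le>Suc n. (if j = 0 then 0 else c (j - 1)) *\<^sub>R ?D j \<phi>)"
      by (subst sum.atMost_Suc_shift) simp
    finally show ?thesis by (simp only: d_def scaleR_add_left sum.distrib)
  qed
  then show ?case by blast
qed

section \<open>Almost automorphic functions\<close>

lemma AA_continuous: "f \<in> AA \<Longrightarrow> continuous_on S f"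
  by (auto simp: AA_def intro: continuous_on_subset)

lemma AA_bounded:
  assumes "f \<in> AA" obtains M where "M \<ge> 0" "\<And>t. norm (f t) \<le> M"
proof -
  obtain M where M: "\<And>t. norm (f t) \<le> M" using assms by (auto simp: AA_def bounded_iff)
  show ?thesis by (rule that[of M, OF order_trans[OF norm_ge_zero M[of 0]] M])
qed

lemma AA_subseqE:
  assumes "f \<in> AA"
  obtains r :: "nat \<Rightarrow> nat" and g where "strict_mono r"
    "\<And>t. (\<lambda>n. f (t + b (r n))) \<longlonglongrightarrow> g t" "\<And>t. (\<lambda>n. g (t - b (r n))) \<longlonglongrightarrow> f t"
proof -
  have "\<exists>r :: nat \<Rightarrow> nat. strict_mono r \<and> (\<exists>g. \<forall>t. (\<lambda>n. f (t + b (r n))) \<longlonglongrightarrow> g t \<and> (\<lambda>n. g (t - b (r n))) \<longlonglongrightarrow> f t)"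
    using assms unfolding AA_def by blast
  then show ?thesis using that by blast
qed

lemma AA_lincomb:
  assumes f: "f \<in> AA" and g: "g \<in> AA"
  shows "(\<lambda>t. c *\<^sub>R f t + d *\<^sub>R g t) \<in> AA"
  unfolding AA_def
proof (intro CollectI conjI allI)
  show "continuous_on UNIV (\<lambda>t. c *\<^sub>R f t + d *\<^sub>R g t)"
    by (intro continuous_on_add continuous_on_scaleR continuous_on_const AA_continuous f g)
  obtain M where M: "M \<ge> 0" "\<And>t. norm (f t) \<le> M" using AA_bounded[OF f] by metis
  obtain M' where M': "M' \<ge> 0" "\<And>t. norm (g t) \<le> M'" using AA_bounded[OF g] by metis
  have "norm (c *\<^sub>R f t + d *\<^sub>R g t) \<le> \<bar>c\<bar> * M + \<bar>d\<bar> * M'" for t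
    using M M' by (intro norm_triangle_le add_mono) (auto simp: mult_left_mono)
  then show "bounded (range (\<lambda>t. c *\<^sub>R f t + d *\<^sub>R g t))" by (auto simp: bounded_iff)
  fix b :: "nat \<Rightarrow> real"
  obtain r h where r: "strict_mono (r :: nat \<Rightarrow> nat)" "\<And>t. (\<lambda>n. f (t + b (r n))) \<longlonglongrightarrow> h t"
    "\<And>t. (\<lambda>n. h (t - b (r n))) \<longlonglongrightarrow> f t"
    using AA_subseqE[OF f, of b] by metis
  obtain s k where s: "strict_mono (s :: nat \<Rightarrow> nat)" "\<And>t. (\<lambda>n. g (t + b (r (s n)))) \<longlonglongrightarrow> k t"
    "\<And>t. (\<lambda>n. k (t - b (r (s n)))) \<longlonglongrightarrow> g t"
    using AA_subseqE[OF g, of "b \<circ> r"] by (auto simp: o_def)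
  show "\<exists>r :: nat \<Rightarrow> nat. strict_mono r \<and> (\<exists>ga. \<forall>t.
      (\<lambda>n. c *\<^sub>R f (t + b (r n)) + d *\<^sub>R g (t + b (r n))) \<longlonglongrightarrow> ga t \<and>
      (\<lambda>n. ga (t - b (r n))) \<longlonglongrightarrow> c *\<^sub>R f t + d *\<^sub>R g t)"
  proof (intro exI[of _ "r \<circ> s"] exI[of _ "\<lambda>t. c *\<^sub>R h t + d *\<^sub>R k t"] conjI allI)
    show "strict_mono (r \<circ> s)" by (rule strict_mono_o[OF r(1) s(1)])
    fix t
    have "(\<lambda>n. f (t + b (r (s n)))) \<longlonglongrightarrow> h t" "(\<lambda>n. h (t - b (r (s n)))) \<longlonglongrightarrow> f t"
      using LIMSEQ_subseq_LIMSEQ[OF r(2) s(1)] LIMSEQ_subseq_LIMSEQ[OF r(3) s(1)] by (simp_all add: o_def)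
    with s show "(\<lambda>n. c *\<^sub>R f (t + b ((r \<circ> s) n)) + d *\<^sub>R g (t + b ((r \<circ> s) n))) \<longlonglongrightarrow> c *\<^sub>R h t + d *\<^sub>R k t"
      "(\<lambda>n. c *\<^sub>R h (t - b ((r \<circ> s) n)) + d *\<^sub>R k (t - b ((r \<circ> s) n))) \<longlonglongrightarrow> c *\<^sub>R f t + d *\<^sub>R g t"
      by (auto simp: o_def intro!: tendsto_intros)
  qed
qed

lemma AA_zero: "(\<lambda>_. 0) \<in> AA"
  unfolding AA_def by (auto intro: exI[of _ id] exI[of _ "\<lambda>_. 0"] simp: strict_mono_def)

lemma AA_add: "f \<in> AA \<Longrightarrow> g \<in> AA \<Longrightarrow> (\<lambda>t. f t + g t) \<in> AA"
  using AA_lincomb[of f g 1 1] by simp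

lemma AA_diff: "f \<in> AA \<Longrightarrow> g \<in> AA \<Longrightarrow> (\<lambda>t. f t - g t) \<in> AA"
  using AA_lincomb[of f g 1 "- 1"] by simp

lemma AA_scaleR: "f \<in> AA \<Longrightarrow> (\<lambda>t. c *\<^sub>R f t) \<in> AA"
  using AA_lincomb[of f f c 0] by simp

lemma AA_sum: "finite A \<Longrightarrow> (\<And>i. i \<in> A \<Longrightarrow> f i \<in> AA) \<Longrightarrow> (\<lambda>t. \<Sum>i\<in>A. f i t) \<in> AA"
  by (induction A rule: finite_induct) (auto simp: AA_zero AA_add)

text \<open>Every value of an almost automorphic function is approached by values at arbitrarily
  large arguments, so the function is controlled by its behaviour near \<open>\<infinity>\<close>.\<close>

lemma AA_norm_le_of_eventually:
  assumes g: "g \<in> AA" and ev: "\<forall>\<^sub>F t in at_top. norm (g t) \<le> e"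
  shows "norm (g t) \<le> e"
proof -
  obtain r h where r: "strict_mono (r :: nat \<Rightarrow> nat)" "\<And>t. (\<lambda>n. g (t + real (r n))) \<longlonglongrightarrow> h t"
    "\<And>t. (\<lambda>n. h (t - real (r n))) \<longlonglongrightarrow> g t"
    using AA_subseqE[OF g, of real] by metis
  have h: "norm (h t) \<le> e" for t
  proof (rule tendsto_upperbound[OF tendsto_norm[OF r(2)]])
    have "filterlim (\<lambda>n. t + real (r n)) at_top sequentially"
      by (intro filterlim_tendsto_add_at_top[OF tendsto_const]
          filterlim_compose[OF filterlim_real_sequentially filterlim_subseq[OF r(1)]])
    then show "\<forall>\<^sub>F n in sequentially. norm (g (t + real (r n))) \<le> e"
      using ev by (rule eventually_compose_filterlim[rotated])
  qed simp
  show ?thesis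
    by (rule tendsto_upperbound[OF tendsto_norm[OF r(3)]]) (simp_all add: h)
qed

lemma uniform_limit_reindex:
  "uniform_limit UNIV f g F \<Longrightarrow> uniform_limit UNIV (\<lambda>n i. f n (a i)) (\<lambda>i. g (a i)) F"
  unfolding uniform_limit_iff by (blast intro: eventually_mono)

text \<open>A diagonal subsequence serves all \<open>f n\<close> at once. Their limit functions \<open>h n\<close> inherit the uniform
  Cauchy property, and both limits in the definition may be interchanged with the uniform one.\<close>

lemma AA_uniform_limit:
  fixes f :: "nat \<Rightarrow> real \<Rightarrow> 'x::banach"
  assumes f: "\<And>n. f n \<in> AA" and lim: "uniform_limit UNIV f g sequentially"
  shows "g \<in> AA"
  unfolding AA_def
proof (intro CollectI conjI allI)
  show "continuous_on UNIV g"
    by (rule uniform_limit_theorem[OF _ lim]) (simp_all add: AA_continuous f)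
  obtain n where n: "\<And>x. dist (f n x) (g x) < 1"
    using uniform_limitD[OF lim, of 1] by (auto simp: eventually_sequentially)
  obtain M where M: "\<And>t. norm (f n t) \<le> M" using AA_bounded[OF f] by metis
  have "norm (g t) \<le> M + 1" for t
    using norm_triangle_sub[of "g t" "f n t"] n[of t] M[of t] by (simp add: dist_norm norm_minus_commute)
  then show "bounded (range g)" by (auto simp: bounded_iff)
  fix b :: "nat \<Rightarrow> real"
  define P where "P n s \<longleftrightarrow> (\<exists>h. \<forall>t. (\<lambda>i. f n (t + b (s i))) \<longlonglongrightarrow> h t \<and> (\<lambda>i. h (t - b (s i))) \<longlonglongrightarrow> f n t)"
    for n and s :: "nat \<Rightarrow> nat"
  interpret subseqs P
  proof
    fix n and s :: "nat \<Rightarrow> nat" assume "strict_mono s"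
    obtain r h where "strict_mono (r :: nat \<Rightarrow> nat)" "\<And>t. (\<lambda>i. f n (t + (b \<circ> s) (r i))) \<longlonglongrightarrow> h t"
      "\<And>t. (\<lambda>i. h (t - (b \<circ> s) (r i))) \<longlonglongrightarrow> f n t"
      using AA_subseqE[OF f, of n "b \<circ> s"] by metis
    then show "\<exists>r. strict_mono r \<and> P n (s \<circ> r)" unfolding P_def o_def by blast
  qed
  define \<beta> where "\<beta> i = b (diagseq i)" for i
  have "\<exists>h. \<forall>t. (\<lambda>i. f n (t + \<beta> i)) \<longlonglongrightarrow> h t \<and> (\<lambda>i. h (t - \<beta> i)) \<longlonglongrightarrow> f n t" for n
  proof -
    have "P n (diagseq \<circ> ((+) (Suc n)))"
    proof (rule diagseq_holds)
      fix r s :: "nat \<Rightarrow> nat" and n assume r: "strict_mono r" and "P n s"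
      then obtain h where h: "\<And>t. (\<lambda>i. f n (t + b (s i))) \<longlonglongrightarrow> h t" "\<And>t. (\<lambda>i. h (t - b (s i))) \<longlonglongrightarrow> f n t"
        unfolding P_def by blast
      have "(\<lambda>i. f n (t + b (s (r i)))) \<longlonglongrightarrow> h t" "(\<lambda>i. h (t - b (s (r i)))) \<longlonglongrightarrow> f n t" for t
        using LIMSEQ_subseq_LIMSEQ[OF h(1) r] LIMSEQ_subseq_LIMSEQ[OF h(2) r] by (simp_all add: o_def)
      then show "P n (s \<circ> r)" unfolding P_def o_def by blast
    qed
    then obtain h where h: "\<And>t. (\<lambda>i. f n (t + \<beta> (Suc n + i))) \<longlonglongrightarrow> h t"
      "\<And>t. (\<lambda>i. h (t - \<beta> (Suc n + i))) \<longlonglongrightarrow> f n t"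
      unfolding P_def \<beta>_def o_def by blast
    have "(\<lambda>i. f n (t + \<beta> i)) \<longlonglongrightarrow> h t" "(\<lambda>i. h (t - \<beta> i)) \<longlonglongrightarrow> f n t" for t
      using LIMSEQ_offset[of "\<lambda>i. f n (t + \<beta> i)" "Suc n" "h t"] LIMSEQ_offset[of "\<lambda>i. h (t - \<beta> i)" "Suc n" "f n t"] h[of t]
      by (simp_all add: add.commute)
    then show ?thesis by blast
  qed
  then obtain h where h: "\<And>n t. (\<lambda>i. f n (t + \<beta> i)) \<longlonglongrightarrow> h n t" "\<And>n t. (\<lambda>i. h n (t - \<beta> i)) \<longlonglongrightarrow> f n t"
    by metis
  have "uniformly_Cauchy_on UNIV h"
    unfolding uniformly_Cauchy_on_def
  proof (intro allI impI)
    fix e :: real assume "e > 0"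
    then have "\<forall>\<^sub>F n in sequentially. \<forall>x\<in>UNIV. dist (f n x) (g x) < e / 4"
      by (intro uniform_limitD[OF lim]) simp
    then obtain N where N: "\<And>n x. n \<ge> N \<Longrightarrow> dist (f n x) (g x) < e / 4"
      by (auto simp: eventually_sequentially)
    have "dist (h m t) (h n t) < e" if "m \<ge> N" "n \<ge> N" for m n t
    proof -
      have "dist (f m x) (f n x) \<le> e / 2" for x
        using N[OF that(1), of x] N[OF that(2), of x] dist_triangle2[of "f m x" "f n x" "g x"] by linarith
      then have "dist (h m t) (h n t) \<le> e / 2"
        by (intro tendsto_upperbound[OF tendsto_dist[OF h(1) h(1)]]) simp_all
      then show ?thesis using \<open>e > 0\<close> by linarith
    qed
    then show "\<exists>M. \<forall>x\<in>UNIV. \<forall>m\<ge>M. \<forall>n\<ge>M. dist (h m x) (h n x) < e" by blast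
  qed
  then have "uniformly_convergent_on UNIV h" by (rule Cauchy_uniformly_convergent)
  then obtain k where k: "uniform_limit UNIV h k sequentially"
    unfolding uniformly_convergent_on_def by blast
  have "(\<lambda>i. g (t + \<beta> i)) \<longlonglongrightarrow> k t" for t
    by (rule swap_uniform_limit'[OF _ tendsto_uniform_limitI[OF k] uniform_limit_reindex[OF lim]])
      (simp_all add: h(1))
  moreover have "(\<lambda>i. k (t - \<beta> i)) \<longlonglongrightarrow> g t" for t
    by (rule swap_uniform_limit'[OF _ tendsto_uniform_limitI[OF lim] uniform_limit_reindex[OF k]])
      (simp_all add: h(2))
  ultimately show "\<exists>r :: nat \<Rightarrow> nat. strict_mono r \<and> (\<exists>h. \<forall>t. (\<lambda>n. g (t + b (r n))) \<longlonglongrightarrow> h t \<and> (\<lambda>n. h (t - b (r n))) \<longlonglongrightarrow> g t)"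
    unfolding \<beta>_def using subseq_diagseq by blast
qed

subsection \<open>Asymptotically almost automorphic functions\<close>

text \<open>In the following two lemmas the decomposition is restated without the half-line: only the
  behaviour at \<open>+\<infinity>\<close> and continuity matter, because a continuous function with a limit at \<open>+\<infinity>\<close> is
  bounded on \<open>[0, \<infinity>)\<close>.\<close>

lemma AAA_I:
  fixes f :: "real \<Rightarrow> 'x::real_normed_vector"
  assumes f: "continuous_on UNIV f" and g: "g \<in> AA" and lim: "((\<lambda>t. f t - g t) \<longlongrightarrow> 0) at_top"
  shows "f \<in> AAA"
proof -
  have c: "continuous_on S (\<lambda>t. f t - g t)" for S
    by (intro continuous_on_diff AA_continuous g continuous_on_subset[OF f]) auto
  have "\<forall>\<^sub>F t in at_top. dist (f t - g t) 0 < 1" by (rule tendstoD[OF lim]) simp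
  then obtain B where B: "\<And>t. t \<ge> B \<Longrightarrow> norm (f t - g t) < 1"
    by (auto simp: eventually_at_top_linorder)
  have "compact ((\<lambda>t. f t - g t) ` {0..B})" by (intro compact_continuous_image c) simp
  then have "bounded ((\<lambda>t. f t - g t) ` {0..B})" by (rule compact_imp_bounded)
  then obtain M where M: "\<And>t. t \<in> {0..B} \<Longrightarrow> norm (f t - g t) \<le> M"
    unfolding bounded_iff by blast
  have "norm (f t - g t) \<le> max M 1" if "t \<ge> 0" for t
    using M[of t] B[of t] that by (cases "t \<le> B") auto
  then have "bounded ((\<lambda>t. f t - g t) ` {0..})" by (auto simp: bounded_iff)
  then have "(\<lambda>t. f t - g t) \<in> C0_half_line" using c lim by (simp add: C0_half_line_def)
  then show ?thesis using f g unfolding AAA_def by force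
qed

lemma AAA_E:
  assumes "f \<in> AAA"
  obtains g where "g \<in> AA" "((\<lambda>t. f t - g t) \<longlongrightarrow> 0) at_top"
proof -
  obtain g q where *: "g \<in> AA" "q \<in> C0_half_line" "\<And>t. t \<ge> 0 \<Longrightarrow> f t = g t + q t"
    using assms by (auto simp: AAA_def)
  have eq: "\<forall>\<^sub>F t in at_top. q t = f t - g t"
    using eventually_ge_at_top[of 0] by eventually_elim (simp add: *(3))
  have "(q \<longlongrightarrow> 0) at_top" using *(2) by (simp add: C0_half_line_def)
  then show ?thesis by (rule that[OF *(1) Lim_transform_eventually[OF _ eq]])
qed

lemma AAA_continuous: "f \<in> AAA \<Longrightarrow> continuous_on S f"
  by (auto simp: AAA_def intro: continuous_on_subset)

lemma AAA_eventually_eq: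
  assumes "f \<in> AAA" "continuous_on UNIV h" "\<forall>\<^sub>F t in at_top. f t = h t"
  shows "h \<in> AAA"
proof -
  obtain g where g: "g \<in> AA" "((\<lambda>t. f t - g t) \<longlongrightarrow> 0) at_top" using AAA_E[OF assms(1)] by metis
  have "\<forall>\<^sub>F t in at_top. f t - g t = h t - g t" using assms(3) by eventually_elim simp
  then show ?thesis by (rule AAA_I[OF assms(2) g(1) Lim_transform_eventually[OF g(2)]])
qed

lemma AAA_scaleR:
  assumes "f \<in> AAA" shows "(\<lambda>t. c *\<^sub>R f t) \<in> AAA"
proof -
  obtain g where g: "g \<in> AA" "((\<lambda>t. f t - g t) \<longlongrightarrow> 0) at_top" using AAA_E[OF assms] by metis
  show ?thesis
  proof (rule AAA_I[OF _ AA_scaleR[OF g(1)]])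
    show "continuous_on UNIV (\<lambda>t. c *\<^sub>R f t)"
      by (intro continuous_on_scaleR continuous_on_const AAA_continuous assms)
    show "((\<lambda>t. c *\<^sub>R f t - c *\<^sub>R g t) \<longlongrightarrow> 0) at_top"
      using tendsto_scaleR[OF tendsto_const g(2), of c] by (simp add: scaleR_diff_right)
  qed
qed

text \<open>The almost automorphic parts of a uniformly convergent sequence converge uniformly, because
  the difference of two of them is bounded by its superior limit at \<open>\<infinity>\<close>.\<close>

lemma AAA_uniform_limit:
  fixes f :: "nat \<Rightarrow> real \<Rightarrow> 'x::banach"
  assumes f: "\<And>n. f n \<in> AAA" and lim: "uniform_limit UNIV f l sequentially"
  shows "l \<in> AAA"
proof -
  have "\<forall>n. \<exists>g. g \<in> AA \<and> ((\<lambda>t. f n t - g t) \<longlongrightarrow> 0) at_top"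
  proof
    fix n
    obtain g where "g \<in> AA" "((\<lambda>t. f n t - g t) \<longlongrightarrow> 0) at_top" by (rule AAA_E[OF f])
    then show "\<exists>g. g \<in> AA \<and> ((\<lambda>t. f n t - g t) \<longlongrightarrow> 0) at_top" by blast
  qed
  from choice[OF this] obtain g
    where g: "\<And>n. g n \<in> AA" "\<And>n. ((\<lambda>t. f n t - g n t) \<longlongrightarrow> 0) at_top" by blast
  have "uniformly_Cauchy_on UNIV g"
    unfolding uniformly_Cauchy_on_def
  proof (intro allI impI)
    fix e :: real assume e: "e > 0"
    then have "\<forall>\<^sub>F n in sequentially. \<forall>x\<in>UNIV. dist (f n x) (l x) < e / 4"
      by (intro uniform_limitD[OF lim]) simp
    then obtain N where N: "\<And>n x. n \<ge> N \<Longrightarrow> dist (f n x) (l x) < e / 4"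
      by (auto simp: eventually_sequentially)
    have "dist (g m t) (g n t) < e" if mn: "m \<ge> N" "n \<ge> N" for m n t
    proof -
      have "((\<lambda>t. (f m t - g m t) - (f n t - g n t)) \<longlongrightarrow> 0 - 0) at_top" by (intro tendsto_diff g)
      then have "\<forall>\<^sub>F t in at_top. dist ((f m t - g m t) - (f n t - g n t)) (0 - 0) < e / 4"
        by (rule tendstoD) (use e in simp)
      then have "\<forall>\<^sub>F t in at_top. norm (g m t - g n t) \<le> 3 * (e / 4)"
      proof eventually_elim
        case (elim t)
        have "g m t - g n t = (f m t - l t) - (f n t - l t) - ((f m t - g m t) - (f n t - g n t))" by simp
        also have "norm \<dots> \<le> norm (f m t - l t) + norm (f n t - l t) + norm ((f m t - g m t) - (f n t - g n t))"
          by (intro order_trans[OF norm_triangle_ineq4] add_mono norm_triangle_ineq4 order_refl)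
        finally show ?case
          using N[OF mn(1), of t] N[OF mn(2), of t] elim by (simp add: dist_norm)
      qed
      then have "norm (g m t - g n t) \<le> 3 * (e / 4)"
        by (rule AA_norm_le_of_eventually[OF AA_diff[OF g(1) g(1)]])
      then show ?thesis using e by (simp add: dist_norm)
    qed
    then show "\<exists>M. \<forall>x\<in>UNIV. \<forall>m\<ge>M. \<forall>n\<ge>M. dist (g m x) (g n x) < e" by blast
  qed
  then have "uniformly_convergent_on UNIV g" by (rule Cauchy_uniformly_convergent)
  then obtain k where k: "uniform_limit UNIV g k sequentially"
    unfolding uniformly_convergent_on_def by blast
  show ?thesis
  proof (rule AAA_I)
    show "continuous_on UNIV l"
      by (rule uniform_limit_theorem[OF _ lim]) (simp_all add: AAA_continuous f)
    show "k \<in> AA" by (rule AA_uniform_limit[OF g(1) k])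
    show "((\<lambda>t. l t - k t) \<longlongrightarrow> 0) at_top"
      by (rule swap_uniform_limit'[OF _ tendsto_const uniform_limit_minus[OF lim k]]) (simp_all add: g(2))
  qed
qed

section \<open>Regularizing (asymptotically) almost automorphic functions\<close>

lemma has_integral_UNIV_shift:
  fixes f :: "real \<Rightarrow> 'x::banach"
  assumes "(f has_integral I) UNIV"
  shows "((\<lambda>t. f (t + c)) has_integral I) UNIV"
  unfolding has_integral_alt'[of _ I UNIV]
proof (intro conjI allI impI)
  have f: "f integrable_on cbox a b" for a b
    using assms unfolding has_integral_alt'[of f I UNIV] by simp
  have int: "((\<lambda>t. f (t + c)) has_integral integral (cbox (a + c) (b + c)) f) (cbox a b)" for a b
    using integrable_integral[OF f, of "a + c" "b + c"] has_integral_shift_cbox_iff[of f c _ a b]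
    by (simp add: o_def add.commute del: box_real)
  show "(\<lambda>t. if t \<in> UNIV then f (t + c) else 0) integrable_on cbox a b" for a b
    using has_integral_integrable[OF int] by simp
  fix e :: real assume "e > 0"
  then obtain B where B: "B > 0" "\<And>a b. ball 0 B \<subseteq> cbox a b \<Longrightarrow> norm (integral (cbox a b) f - I) < e"
    using assms unfolding has_integral_alt'[of f I UNIV] by (auto simp del: box_real)
  show "\<exists>B>0. \<forall>a b. ball 0 B \<subseteq> cbox a b \<longrightarrow>
      norm (integral (cbox a b) (\<lambda>t. if t \<in> UNIV then f (t + c) else 0) - I) < e"
  proof (intro exI[of _ "B + \<bar>c\<bar>"] conjI allI impI)
    show "B + \<bar>c\<bar> > 0" using B(1) by simp
    fix a b :: real assume sub: "ball 0 (B + \<bar>c\<bar>) \<subseteq> cbox a b"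
    have "ball 0 B \<subseteq> cbox (a + c) (b + c)"
    proof
      fix t :: real assume "t \<in> ball 0 B"
      then have "t - c \<in> ball 0 (B + \<bar>c\<bar>)" by auto
      then have "t - c \<in> cbox a b" using sub by blast
      then show "t \<in> cbox (a + c) (b + c)" by auto
    qed
    then show "norm (integral (cbox a b) (\<lambda>t. if t \<in> UNIV then f (t + c) else 0) - I) < e"
      using B(2)[of "a + c" "b + c"] integral_unique[OF int, of a b] by (simp del: box_real)
  qed
qed

lemma DL1_convolve: "\<phi> \<in> DL1 \<Longrightarrow> (\<lambda>t. \<phi> (x - t)) \<in> DL1"
  using DL1_affine[of \<phi> "-1" x] by simp

lemma test_D_convolve: "\<phi> \<in> test_D \<Longrightarrow> (\<lambda>t. \<phi> (x - t)) \<in> test_D"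
  using test_D_affine[of \<phi> "-1" x] by simp

lemma L1_norm_convolve: "L1_norm (\<lambda>t. \<phi> (x - t)) = L1_norm \<phi>"
  using lborel_integral_real_affine[of "-1" "\<lambda>t. cmod (\<phi> t)" x] by simp

lemma weighted_dominated_convergence:
  fixes d :: "nat \<Rightarrow> real \<Rightarrow> real"
  assumes \<psi>: "integrable lborel \<psi>" and d: "\<And>n. d n \<in> borel_measurable borel" "\<And>n t. \<bar>d n t\<bar> \<le> M"
    and lim: "\<And>t. (\<lambda>n. d n t) \<longlonglongrightarrow> l t"
  shows "integrable lborel (\<lambda>t. \<psi> t * d n t)"
    and "(\<lambda>n. \<integral>t. \<psi> t * d n t \<partial>lborel) \<longlonglongrightarrow> (\<integral>t. \<psi> t * l t \<partial>lborel)"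
proof -
  have [measurable]: "\<psi> \<in> borel_measurable borel" "\<And>n. d n \<in> borel_measurable borel"
    using borel_measurable_integrable[OF \<psi>] d by simp_all
  have l [measurable]: "l \<in> borel_measurable borel"
    by (rule borel_measurable_LIMSEQ_real[OF lim d(1)])
  have w: "integrable lborel (\<lambda>t. M * \<bar>\<psi> t\<bar>)"
    using \<psi> by (intro integrable_mult_right integrable_abs)
  have b: "AE t in lborel. norm (\<psi> t * d n t) \<le> M * \<bar>\<psi> t\<bar>" for n
    using d(2) by (intro AE_I2) (simp add: abs_mult mult.commute[of M] mult_left_mono)
  have c: "AE t in lborel. (\<lambda>n. \<psi> t * d n t) \<longlonglongrightarrow> \<psi> t * l t"
    by (intro AE_I2 tendsto_mult_left lim)
  have m: "(\<lambda>t. \<psi> t * l t) \<in> borel_measurable lborel" "\<And>n. (\<lambda>t. \<psi> t * d n t) \<in> borel_measurable lborel"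
    by measurable
  show "integrable lborel (\<lambda>t. \<psi> t * d n t)" 
    by (rule integrable_dominated_convergence2[OF m w c b])
  show "(\<lambda>n. \<integral>t. \<psi> t * d n t \<partial>lborel) \<longlonglongrightarrow> (\<integral>t. \<psi> t * l t \<partial>lborel)"
    by (rule integral_dominated_convergence[OF m w c b])
qed

text \<open>The limit function \<open>h\<close> of the translates of \<open>g\<close> need not be continuous, and its convolution with
  \<open>\<phi>\<close> is never formed. Dominated convergence is applied to the scalar functions
  \<open>norm (g (t + \<beta> n) - h t)\<close> and \<open>norm (h (t - \<beta> n) - g t)\<close> only, and the limit of the translates of
  \<open>g * \<phi>\<close> is found by completeness.\<close>

lemma conv_distr_regular_AA:
  fixes g :: "real \<Rightarrow> 'x::complex_banach"
  assumes g: "g \<in> AA" and \<phi>: "\<phi> \<in> test_D"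
  shows "conv_distr (regular_distr g) \<phi> \<in> AA"
proof -
  obtain M where M: "M \<ge> 0" "\<And>t. norm (g t) \<le> M" using AA_bounded[OF g] by metis
  have \<phi>': "\<phi> \<in> DL1" using \<phi> test_D_subset_DL1 by blast
  have gc: "continuous_on UNIV (\<lambda>t. g (t + b))" for b
    by (rule continuous_on_compose2[OF AA_continuous[OF g, of UNIV]]) (auto intro!: continuous_intros)
  have U: "regular_distr g \<in> DL1'" by (rule regular_distr_DL1'[OF AA_continuous[OF g] M(2)])
  define G where "G = conv_distr (regular_distr g) \<phi>"
  define \<psi> where "\<psi> x t = cmod (\<phi> (x - t))" for x t
  have \<phi>x: "continuous_on UNIV (\<lambda>t. \<phi> (x - t))" "integrable lborel (\<lambda>t. \<phi> (x - t))" for x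
    using smooth_continuous[OF DL1_smooth[OF DL1_convolve[OF \<phi>']]] DL1_integrable_0[OF DL1_convolve[OF \<phi>']] by auto
  have \<psi>: "integrable lborel (\<psi> x)" for x
    unfolding \<psi>_def by (intro integrable_norm \<phi>x)
  have int: "(\<lambda>t. \<phi> (x - t) *\<^sub>C g (t + b)) integrable_on UNIV" for x b
    by (rule scaleC_integrable[OF \<phi>x gc M(2)])
  have G_shift: "G (x + b) = integral UNIV (\<lambda>t. \<phi> (x - t) *\<^sub>C g (t + b))" for x b
  proof -
    have "((\<lambda>t. \<phi> (x + b - t) *\<^sub>C g t) has_integral G (x + b)) UNIV"
      using integrable_integral[OF int[of "x + b" 0]] by (simp add: G_def conv_distr_def regular_distr_def)
    from has_integral_UNIV_shift[OF this, of b] show ?thesis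
      by (simp add: integral_unique)
  qed
  have G_diff: "norm (G (x + a) - G (x + b)) \<le> (\<integral>t. \<psi> x t * norm (g (t + a) - g (t + b)) \<partial>lborel)" for x a b
  proof -
    have "G (x + a) - G (x + b) = integral UNIV (\<lambda>t. \<phi> (x - t) *\<^sub>C (g (t + a) - g (t + b)))"
      unfolding G_shift by (simp add: scaleC.diff_right Henstock_Kurzweil_Integration.integral_diff int)
    also have "norm \<dots> \<le> (\<integral>t. \<psi> x t * norm (g (t + a) - g (t + b)) \<partial>lborel)"
    proof (rule continuous_majorized_integrable(2))
      show "continuous_on UNIV (\<lambda>t. \<phi> (x - t) *\<^sub>C (g (t + a) - g (t + b)))"
        by (intro scaleC.continuous_on continuous_on_diff \<phi>x gc)
      have "norm (g (t + a) - g (t + b)) \<le> 2 * M" for t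
        using norm_triangle_ineq4[of "g (t + a)" "g (t + b)"] M(2)[of "t + a"] M(2)[of "t + b"] by linarith
      then show "integrable lborel (\<lambda>t. \<psi> x t * norm (g (t + a) - g (t + b)))"
        by (intro weighted_dominated_convergence(1)[OF \<psi>, where d = "\<lambda>_ t. norm (g (t + a) - g (t + b))"
              and l = "\<lambda>t. norm (g (t + a) - g (t + b))"]
            borel_measurable_continuous_onI continuous_on_norm continuous_on_diff gc tendsto_const) simp
    qed (simp add: norm_scaleC \<psi>_def)
    finally show ?thesis .
  qed
  show ?thesis
    unfolding AA_def G_def[symmetric]
  proof (intro CollectI conjI allI)
    show "continuous_on UNIV G" unfolding G_def by (rule conv_distr_continuous[OF U \<phi>'])
    obtain K where "\<And>x. norm (regular_distr g (\<lambda>t. \<phi> (- (t - x)))) \<le> K"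
      using distr_translate_bounded[OF U DL1_reflect[OF \<phi>']] by metis
    then show "bounded (range G)" by (auto simp: bounded_iff G_def conv_distr_def)
    fix b :: "nat \<Rightarrow> real"
    obtain r h where r: "strict_mono (r :: nat \<Rightarrow> nat)" "\<And>t. (\<lambda>n. g (t + b (r n))) \<longlonglongrightarrow> h t"
      "\<And>t. (\<lambda>n. h (t - b (r n))) \<longlonglongrightarrow> g t"
      using AA_subseqE[OF g, of b] by metis
    define \<beta> where "\<beta> n = b (r n)" for n
    note lim = r(2,3)[folded \<beta>_def]
    have h: "norm (h t) \<le> M" for t
      by (rule tendsto_upperbound[OF tendsto_norm[OF lim(1)]]) (simp_all add: M)
    have meas: "(\<lambda>t. norm (g (t + a) - g (t + c))) \<in> borel_measurable borel" for a c
      by (intro borel_measurable_continuous_onI continuous_on_norm continuous_on_diff gc)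
    have le: "\<bar>norm (u - v)\<bar> \<le> 2 * M" if "norm u \<le> M" "norm v \<le> M" for u v :: 'x
      using norm_triangle_ineq4[of u v] that by simp
    define d where "d n t = norm (g (t + \<beta> n) - h t)" for n t
    have d_lim: "(\<lambda>m. norm (g (t + \<beta> n) - g (t + \<beta> m))) \<longlonglongrightarrow> d n t" for n t
      unfolding d_def by (intro tendsto_intros lim)
    have d_meas: "d n \<in> borel_measurable borel" for n
      by (rule borel_measurable_LIMSEQ_real[OF d_lim meas])
    have d_le: "\<bar>d n t\<bar> \<le> 2 * M" for n t unfolding d_def by (intro le M h)
    have d_0: "(\<lambda>n. d n t) \<longlonglongrightarrow> 0" for t
      using tendsto_norm[OF tendsto_diff[OF lim(1)[of t] tendsto_const[of "h t"]]] by (simp add: d_def)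
    have e_0: "(\<lambda>n. \<integral>t. \<psi> x t * d n t \<partial>lborel) \<longlonglongrightarrow> 0" for x
      using weighted_dominated_convergence(2)[OF \<psi> d_meas d_le d_0] by simp
    have e_int: "integrable lborel (\<lambda>t. \<psi> x t * d n t)" for x n
      by (rule weighted_dominated_convergence(1)[OF \<psi> d_meas d_le d_0])
    have G_le: "norm (G (x + \<beta> n) - G (x + \<beta> m)) \<le> (\<integral>t. \<psi> x t * d n t \<partial>lborel) + (\<integral>t. \<psi> x t * d m t \<partial>lborel)"
      for x n m
    proof -
      have "(\<integral>t. \<psi> x t * norm (g (t + \<beta> n) - g (t + \<beta> m)) \<partial>lborel) \<le> (\<integral>t. \<psi> x t * d n t + \<psi> x t * d m t \<partial>lborel)"
      proof (rule integral_mono)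
        show "integrable lborel (\<lambda>t. \<psi> x t * norm (g (t + \<beta> n) - g (t + \<beta> m)))"
          by (rule weighted_dominated_convergence(1)[OF \<psi>, where d = "\<lambda>_ t. norm (g (t + \<beta> n) - g (t + \<beta> m))",
              OF meas le[OF M(2) M(2)] tendsto_const])
        show "integrable lborel (\<lambda>t. \<psi> x t * d n t + \<psi> x t * d m t)"
          by (intro Bochner_Integration.integrable_add e_int)
        fix t
        have "norm (g (t + \<beta> n) - g (t + \<beta> m)) \<le> d n t + d m t"
          unfolding d_def using norm_triangle_ineq4[of "g (t + \<beta> n) - h t" "g (t + \<beta> m) - h t"] by simp
        then show "\<psi> x t * norm (g (t + \<beta> n) - g (t + \<beta> m)) \<le> \<psi> x t * d n t + \<psi> x t * d m t"
          unfolding distrib_left[symmetric] by (intro mult_left_mono) (simp_all add: \<psi>_def)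
      qed
      also have "\<dots> = (\<integral>t. \<psi> x t * d n t \<partial>lborel) + (\<integral>t. \<psi> x t * d m t \<partial>lborel)"
        by (rule Bochner_Integration.integral_add[OF e_int e_int])
      finally show ?thesis using G_diff[of x "\<beta> n" "\<beta> m"] by linarith
    qed
    have "\<exists>y. (\<lambda>n. G (x + \<beta> n)) \<longlonglongrightarrow> y" for x
    proof -
      have "Cauchy (\<lambda>n. G (x + \<beta> n))"
      proof (rule CauchyI)
        fix e :: real assume "e > 0"
        then have "\<forall>\<^sub>F n in sequentially. (\<integral>t. \<psi> x t * d n t \<partial>lborel) < e / 2"
          by (intro order_tendstoD(2)[OF e_0]) simp
        then obtain N where N: "\<And>n. n \<ge> N \<Longrightarrow> (\<integral>t. \<psi> x t * d n t \<partial>lborel) < e / 2"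
          by (auto simp: eventually_sequentially)
        have "norm (G (x + \<beta> m) - G (x + \<beta> n)) < e" if "m \<ge> N" "n \<ge> N" for m n
          using G_le[of x m n] N[OF that(1)] N[OF that(2)] by linarith
        then show "\<exists>N. \<forall>m\<ge>N. \<forall>n\<ge>N. norm (G (x + \<beta> m) - G (x + \<beta> n)) < e" by blast
      qed
      then show ?thesis using Cauchy_convergent convergent_def by blast
    qed
    then obtain H where H: "\<And>x. (\<lambda>n. G (x + \<beta> n)) \<longlonglongrightarrow> H x" by metis
    define d' where "d' n t = norm (h (t - \<beta> n) - g t)" for n t
    have d'_lim: "(\<lambda>m. norm (g (t + (\<beta> m - \<beta> n)) - g (t + 0))) \<longlonglongrightarrow> d' n t" for n t
    proof -
      have "(\<lambda>m. norm (g (t - \<beta> n + \<beta> m) - g t)) \<longlonglongrightarrow> d' n t"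
        unfolding d'_def by (intro tendsto_intros lim)
      then show ?thesis by (simp add: algebra_simps)
    qed
    have d'_meas: "d' n \<in> borel_measurable borel" for n
      by (rule borel_measurable_LIMSEQ_real[OF d'_lim meas])
    have d'_le: "\<bar>d' n t\<bar> \<le> 2 * M" for n t unfolding d'_def by (intro le M h)
    have d'_0: "(\<lambda>n. d' n t) \<longlonglongrightarrow> 0" for t
      using tendsto_norm[OF tendsto_diff[OF lim(2)[of t] tendsto_const[of "g t"]]] by (simp add: d'_def)
    have H_le: "norm (H (x - \<beta> n) - G x) \<le> (\<integral>t. \<psi> x t * d' n t \<partial>lborel)" for x n
    proof (rule LIMSEQ_le)
      show "(\<lambda>m. norm (G (x - \<beta> n + \<beta> m) - G x)) \<longlonglongrightarrow> norm (H (x - \<beta> n) - G x)"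
        by (intro tendsto_intros H)
      show "(\<lambda>m. \<integral>t. \<psi> x t * norm (g (t + (\<beta> m - \<beta> n)) - g (t + 0)) \<partial>lborel) \<longlonglongrightarrow> (\<integral>t. \<psi> x t * d' n t \<partial>lborel)"
        by (rule weighted_dominated_convergence(2)[OF \<psi> meas le[OF M(2) M(2)] d'_lim])
      show "\<exists>N. \<forall>m\<ge>N. norm (G (x - \<beta> n + \<beta> m) - G x)
          \<le> (\<integral>t. \<psi> x t * norm (g (t + (\<beta> m - \<beta> n)) - g (t + 0)) \<partial>lborel)"
      proof (intro exI allI impI)
        fix m
        show "norm (G (x - \<beta> n + \<beta> m) - G x)
          \<le> (\<integral>t. \<psi> x t * norm (g (t + (\<beta> m - \<beta> n)) - g (t + 0)) \<partial>lborel)"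
          using G_diff[of x "\<beta> m - \<beta> n" 0] by (simp only: add_0_right add_diff_eq diff_add_eq)
      qed
    qed
    have "(\<lambda>n. H (x - \<beta> n)) \<longlonglongrightarrow> G x" for x
    proof (rule LIM_zero_cancel, rule Lim_null_comparison)
      show "\<forall>\<^sub>F n in sequentially. norm (H (x - \<beta> n) - G x) \<le> (\<integral>t. \<psi> x t * d' n t \<partial>lborel)"
        by (simp add: H_le)
      show "(\<lambda>n. \<integral>t. \<psi> x t * d' n t \<partial>lborel) \<longlonglongrightarrow> 0"
        using weighted_dominated_convergence(2)[OF \<psi> d'_meas d'_le d'_0] by simp
    qed
    then show "\<exists>r :: nat \<Rightarrow> nat. strict_mono r \<and>
        (\<exists>H. \<forall>t. (\<lambda>n. G (t + b (r n))) \<longlonglongrightarrow> H t \<and> (\<lambda>n. H (t - b (r n))) \<longlonglongrightarrow> G t)"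
      using r(1) H unfolding \<beta>_def by blast
  qed
qed

lemma test_D_scaleC_integrable:
  fixes f :: "real \<Rightarrow> 'x::complex_banach"
  assumes \<phi>: "\<phi> \<in> test_D" and f: "continuous_on UNIV f"
  shows "(\<lambda>t. \<phi> t *\<^sub>C f t) integrable_on UNIV"
proof -
  obtain R where R: "R > 0" "\<And>j t. \<bar>t\<bar> \<ge> R \<Longrightarrow> nth_vderiv j \<phi> t = 0"
    using test_DE[OF \<phi>] by metis
  have "bounded (f ` {-R..R})"
    by (intro compact_imp_bounded compact_continuous_image continuous_on_subset[OF f]) auto
  then obtain M where M: "\<And>t. t \<in> {-R..R} \<Longrightarrow> norm (f t) \<le> M"
    unfolding bounded_iff by blast
  have \<phi>': "\<phi> \<in> DL1" using \<phi> test_D_subset_DL1 by blast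
  show ?thesis
  proof (rule scaleC_integrable[OF smooth_continuous[OF DL1_smooth[OF \<phi>']] DL1_integrable_0[OF \<phi>'] f])
    fix t assume "\<phi> t \<noteq> 0"
    then have "\<bar>t\<bar> < R" using R(2)[of t 0] by force
    then show "norm (f t) \<le> M" by (intro M) auto
  qed
qed

text \<open>For large \<open>x\<close>, the support of \<open>\<phi> (x - \<cdot>)\<close> lies where \<open>q\<close> is small.\<close>

lemma convolution_tendsto_0:
  fixes q :: "real \<Rightarrow> 'x::complex_banach"
  assumes \<phi>: "\<phi> \<in> test_D" and q: "continuous_on UNIV q" "(q \<longlongrightarrow> 0) at_top"
  shows "((\<lambda>x. integral UNIV (\<lambda>t. \<phi> (x - t) *\<^sub>C q t)) \<longlongrightarrow> 0) at_top"
proof (rule tendstoI)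
  fix r :: real assume r: "r > 0"
  define e where "e = r / (L1_norm \<phi> + 1)"
  have e: "e > 0" using r by (simp add: e_def add_nonneg_pos)
  obtain R where R: "R > 0" "\<And>j t. \<bar>t\<bar> \<ge> R \<Longrightarrow> nth_vderiv j \<phi> t = 0"
    using test_DE[OF \<phi>] by metis
  obtain B where B: "\<And>t. t \<ge> B \<Longrightarrow> norm (q t) < e"
    using tendstoD[OF q(2) e] by (auto simp: eventually_at_top_linorder)
  have \<phi>': "\<phi> \<in> DL1" using \<phi> test_D_subset_DL1 by blast
  have "norm (integral UNIV (\<lambda>t. \<phi> (x - t) *\<^sub>C q t)) < r" if "x \<ge> B + R" for x
  proof -
    have "norm (integral UNIV (\<lambda>t. \<phi> (x - t) *\<^sub>C q t)) \<le> L1_norm (\<lambda>t. \<phi> (x - t)) * e"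
    proof (rule norm_integral_scaleC_le[OF smooth_continuous[OF DL1_smooth[OF DL1_convolve[OF \<phi>']]]
          DL1_integrable_0[OF DL1_convolve[OF \<phi>']] q(1)])
      fix t assume "\<phi> (x - t) \<noteq> 0"
      then have "\<bar>x - t\<bar> < R" using R(2)[of "x - t" 0] by force
      then have "B \<le> t" using that by linarith
      then show "norm (q t) \<le> e" using B[of t] by simp
    qed
    also have "\<dots> < (L1_norm \<phi> + 1) * e" using e by (simp only: L1_norm_convolve) simp
    also have "\<dots> = r" by (simp add: e_def add_nonneg_pos order_less_imp_not_eq2)
    finally show ?thesis .
  qed
  then show "\<forall>\<^sub>F x in at_top. dist (integral UNIV (\<lambda>t. \<phi> (x - t) *\<^sub>C q t)) 0 < r"
    by (auto simp: eventually_at_top_linorder)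
qed

text \<open>The distribution \<open>U\<close> is the extension of the regular distribution of \<open>f\<close>, which may be unbounded
  on the left half-line.\<close>

lemma conv_distr_regular_AAA:
  fixes f :: "real \<Rightarrow> 'x::complex_banach"
  assumes f: "f \<in> AAA" and U: "U \<in> DL1'" "\<And>\<phi>. \<phi> \<in> test_D \<Longrightarrow> U \<phi> = regular_distr f \<phi>" and \<phi>: "\<phi> \<in> test_D"
  shows "conv_distr U \<phi> \<in> AAA"
proof -
  obtain g where g: "g \<in> AA" "((\<lambda>t. f t - g t) \<longlongrightarrow> 0) at_top" using AAA_E[OF f] by metis
  have c: "continuous_on UNIV (\<lambda>t. f t - g t)"
    by (intro continuous_on_diff AA_continuous AAA_continuous f g)
  have "conv_distr U \<phi> x - conv_distr (regular_distr g) \<phi> x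
      = integral UNIV (\<lambda>t. \<phi> (x - t) *\<^sub>C (f t - g t))" for x
    unfolding conv_distr_def U(2)[OF test_D_convolve[OF \<phi>]]
    by (simp add: regular_distr_def scaleC.diff_right Henstock_Kurzweil_Integration.integral_diff
        test_D_scaleC_integrable test_D_convolve \<phi> AA_continuous AAA_continuous f g)
  then have "((\<lambda>x. conv_distr U \<phi> x - conv_distr (regular_distr g) \<phi> x) \<longlongrightarrow> 0) at_top"
    using convolution_tendsto_0[OF \<phi> c g(2)] by simp
  moreover have "continuous_on UNIV (conv_distr U \<phi>)"
    using \<phi> test_D_subset_DL1 by (intro conv_distr_continuous U) blast
  ultimately show ?thesis
    using AAA_I conv_distr_regular_AA[OF g(1) \<phi>] by blast
qed

section \<open>Almost automorphic and vanishing distributions\<close>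

lemma conv_distr_distr_deriv:
  assumes "\<phi> \<in> smooth_funs"
  shows "conv_distr (distr_deriv U) \<phi> = conv_distr (\<lambda>\<psi>. - U (\<lambda>t. - \<psi> t)) (nth_vderiv 1 \<phi>)"
proof
  fix x
  have "nth_vderiv 1 (\<lambda>t. \<phi> (x - t)) = (\<lambda>t. - nth_vderiv 1 \<phi> (x - t))"
    using nth_vderiv_affine[OF assms, of 1 "-1" x] by simp
  then show "conv_distr (distr_deriv U) \<phi> x = conv_distr (\<lambda>\<psi>. - U (\<lambda>t. - \<psi> t)) (nth_vderiv 1 \<phi>) x"
    by (simp add: conv_distr_def distr_deriv_def nth_vderiv_def)
qed

lemma B'_AA_regular:
  assumes g: "g \<in> AA" shows "regular_distr g \<in> B'_AA"
proof -
  obtain M where "\<And>t. norm (g t) \<le> M" using AA_bounded[OF g] by metis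
  then show ?thesis
    using regular_distr_DL1'[OF AA_continuous[OF g]] conv_distr_regular_AA[OF g] by (auto simp: B'_AA_def)
qed

lemma B'_AA_distr_deriv:
  assumes U: "U \<in> B'_AA" shows "distr_deriv U \<in> B'_AA"
  unfolding B'_AA_def
proof (intro CollectI conjI ballI)
  have U': "U \<in> DL1'" using U by (simp add: B'_AA_def)
  then show "distr_deriv U \<in> DL1'" by (rule DL1'_distr_deriv)
  fix \<phi> :: "real \<Rightarrow> complex" assume \<phi>: "\<phi> \<in> test_D"
  have "nth_vderiv 1 \<phi> \<in> DL1" using \<phi> test_D_nth_vderiv test_D_subset_DL1 by blast
  then have "conv_distr (distr_deriv U) \<phi> = conv_distr U (nth_vderiv 1 \<phi>)"
    unfolding conv_distr_distr_deriv[OF test_D_smooth[OF \<phi>]]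
    by (auto simp: conv_distr_def distr_uminus[OF U'] DL1_convolve)
  then show "conv_distr (distr_deriv U) \<phi> \<in> AA"
    using U test_D_nth_vderiv[OF \<phi>, of 1] by (simp add: B'_AA_def)
qed

lemma B'_AA_sum:
  assumes "\<And>i. i \<in> A \<Longrightarrow> U i \<in> B'_AA" "finite A"
  shows "(\<lambda>\<phi>. \<Sum>i\<in>A. U i \<phi>) \<in> B'_AA"
  unfolding B'_AA_def
proof (intro CollectI conjI ballI)
  show "(\<lambda>\<phi>. \<Sum>i\<in>A. U i \<phi>) \<in> DL1'"
    using assms by (intro DL1'_sum) (auto simp: B'_AA_def)
  fix \<phi> :: "real \<Rightarrow> complex" assume "\<phi> \<in> test_D"
  then have "(\<lambda>x. \<Sum>i\<in>A. conv_distr (U i) \<phi> x) \<in> AA"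
    using assms by (intro AA_sum) (auto simp: B'_AA_def)
  then show "conv_distr (\<lambda>\<phi>. \<Sum>i\<in>A. U i \<phi>) \<phi> \<in> AA" by (simp add: conv_distr_def[abs_def])
qed

lemma B'_plus_0_regular:
  fixes q :: "real \<Rightarrow> 'x::complex_banach"
  assumes q: "continuous_on UNIV q" "\<And>t. norm (q t) \<le> M" "(q \<longlongrightarrow> 0) at_top"
  shows "regular_distr q \<in> B'_plus_0"
  unfolding B'_plus_0_def
proof (intro CollectI conjI ballI)
  show "regular_distr q \<in> DL1'" by (rule regular_distr_DL1'[OF q(1,2)])
  fix \<phi> :: "real \<Rightarrow> complex" assume "\<phi> \<in> test_D"
  from convolution_tendsto_0[OF test_D_reflect[OF this] q(1,3)]
  show "((\<lambda>h. translate_distr h (regular_distr q) \<phi>) \<longlongrightarrow> 0) at_top"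
    by (simp add: translate_distr_def regular_distr_def)
qed

lemma B'_plus_0_distr_deriv:
  assumes U: "U \<in> B'_plus_0" shows "distr_deriv U \<in> B'_plus_0"
  unfolding B'_plus_0_def
proof (intro CollectI conjI ballI)
  show "distr_deriv U \<in> DL1'" using U by (simp add: B'_plus_0_def DL1'_distr_deriv)
  fix \<phi> :: "real \<Rightarrow> complex" assume \<phi>: "\<phi> \<in> test_D"
  have "translate_distr h (distr_deriv U) \<phi> = - translate_distr h U (nth_vderiv 1 \<phi>)" for h
    using nth_vderiv_translate[OF test_D_smooth[OF \<phi>], of 1 h]
    by (simp add: translate_distr_def distr_deriv_def nth_vderiv_def)
  moreover have "((\<lambda>h. translate_distr h U (nth_vderiv 1 \<phi>)) \<longlongrightarrow> 0) at_top"
    using U test_D_nth_vderiv[OF \<phi>, of 1] by (simp add: B'_plus_0_def)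
  ultimately show "((\<lambda>h. translate_distr h (distr_deriv U) \<phi>) \<longlongrightarrow> 0) at_top"
    using tendsto_minus[of "\<lambda>h. translate_distr h U (nth_vderiv 1 \<phi>)" 0] by simp
qed

lemma B'_plus_0_sum:
  assumes "\<And>i. i \<in> A \<Longrightarrow> U i \<in> B'_plus_0" "finite A"
  shows "(\<lambda>\<phi>. \<Sum>i\<in>A. U i \<phi>) \<in> B'_plus_0"
  unfolding B'_plus_0_def
proof (intro CollectI conjI ballI)
  show "(\<lambda>\<phi>. \<Sum>i\<in>A. U i \<phi>) \<in> DL1'"
    using assms by (intro DL1'_sum) (auto simp: B'_plus_0_def)
  fix \<phi> :: "real \<Rightarrow> complex" assume "\<phi> \<in> test_D"
  then have "((\<lambda>h. \<Sum>i\<in>A. translate_distr h (U i) \<phi>) \<longlongrightarrow> 0) at_top"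
    using assms by (intro tendsto_null_sum) (auto simp: B'_plus_0_def)
  then show "((\<lambda>h. translate_distr h (\<lambda>\<phi>. \<Sum>i\<in>A. U i \<phi>) \<phi>) \<longlongrightarrow> 0) at_top"
    by (simp add: translate_distr_def)
qed

section \<open>The implications\<close>

lemma test_D0I:
  assumes "\<phi> \<in> test_D" "\<And>t. \<phi> t \<noteq> 0 \<Longrightarrow> t \<ge> 0"
  shows "\<phi> \<in> test_D0"
  using assms supp_subset[of "{0..}" \<phi>] by (auto simp: test_D0_def)

lemma test_D0_zero: "\<phi> \<in> test_D0 \<Longrightarrow> t < 0 \<Longrightarrow> nth_vderiv j \<phi> t = 0"
  by (rule nth_vderiv_outside_supp) (auto simp: test_D0_def)

lemma eventually_convolve_test_D0:
  assumes "\<phi> \<in> test_D"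
  shows "\<forall>\<^sub>F x in at_top. (\<lambda>t. \<phi> (x - t)) \<in> test_D0"
proof -
  obtain R where R: "R > 0" "\<And>j t. \<bar>t\<bar> \<ge> R \<Longrightarrow> nth_vderiv j \<phi> t = 0"
    using test_DE[OF assms] by metis
  show ?thesis
    using eventually_ge_at_top[of R]
  proof eventually_elim
    case (elim x)
    show ?case
    proof (rule test_D0I[OF test_D_convolve[OF assms]])
      fix t assume "\<phi> (x - t) \<noteq> 0"
      then have "\<bar>x - t\<bar> < R" using R(2)[of "x - t" 0] by force
      then show "t \<ge> 0" using elim by linarith
    qed
  qed
qed

text \<open>Far to the right, \<open>T * \<phi>\<close> only sees \<open>T\<close> on the half-line.\<close>

lemma conv_distr_AAA_transfer:
  assumes T: "T \<in> DL1'" and ST: "\<And>\<phi>. \<phi> \<in> test_D0 \<Longrightarrow> S \<phi> = T \<phi>"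
    and \<phi>: "\<phi> \<in> test_D" and S: "conv_distr S \<phi> \<in> AAA"
  shows "conv_distr T \<phi> \<in> AAA"
proof (rule AAA_eventually_eq[OF S])
  show "continuous_on UNIV (conv_distr T \<phi>)"
    using \<phi> test_D_subset_DL1 by (intro conv_distr_continuous T) blast
  show "\<forall>\<^sub>F x in at_top. conv_distr S \<phi> x = conv_distr T \<phi> x"
    using eventually_convolve_test_D0[OF \<phi>] by eventually_elim (simp add: conv_distr_def ST)
qed

text \<open>The decomposition \<open>T = A + Q\<close> on the half-line shows that \<open>T * \<phi> - A * \<phi>\<close> eventually equals
  \<open>Q * \<phi>\<close>, which tends to \<open>0\<close>.\<close>

lemma B'_AAA_conv_distr:
  assumes T: "T \<in> B'_AAA" and \<phi>: "\<phi> \<in> test_D"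
  shows "conv_distr T \<phi> \<in> AAA"
proof -
  obtain A Q where AQ: "A \<in> B'_AA" "Q \<in> B'_plus_0" "\<And>\<phi>. \<phi> \<in> test_D0 \<Longrightarrow> T \<phi> = A \<phi> + Q \<phi>"
    using T by (auto simp: B'_AAA_def)
  have "((\<lambda>h. translate_distr h Q (\<lambda>t. \<phi> (- t))) \<longlongrightarrow> 0) at_top"
    using AQ(2) test_D_reflect[OF \<phi>] by (simp add: B'_plus_0_def)
  moreover have "\<forall>\<^sub>F h in at_top. translate_distr h Q (\<lambda>t. \<phi> (- t)) = conv_distr T \<phi> h - conv_distr A \<phi> h"
    using eventually_convolve_test_D0[OF \<phi>]
    by eventually_elim (simp add: conv_distr_def translate_distr_def AQ(3))
  ultimately have lim: "((\<lambda>h. conv_distr T \<phi> h - conv_distr A \<phi> h) \<longlongrightarrow> 0) at_top"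
    by (rule Lim_transform_eventually)
  show ?thesis
  proof (rule AAA_I[OF _ _ lim])
    show "continuous_on UNIV (conv_distr T \<phi>)"
      using T \<phi> test_D_subset_DL1 by (intro conv_distr_continuous) (auto simp: B'_AAA_def)
    show "conv_distr A \<phi> \<in> AA" using AQ(1) \<phi> by (simp add: B'_AA_def)
  qed
qed

text \<open>Splitting \<open>f j = g j + q j\<close> on the half-line splits \<open>T\<close>. To become a distribution on the whole
  line, \<open>q j\<close> is extended to the left by the constant \<open>q j 0\<close>.\<close>

lemma AAA_derivatives_imp_B'_AAA:
  fixes T :: "'x::complex_banach distr" and f :: "nat \<Rightarrow> real \<Rightarrow> 'x"
  assumes T: "T \<in> DL1'" and f: "\<And>j. j \<le> k \<Longrightarrow> f j \<in> AAA"
    and rep: "\<And>\<phi>. \<phi> \<in> test_D0 \<Longrightarrow> T \<phi> = (\<Sum>j\<le>k. (distr_deriv ^^ j) (regular_distr (f j)) \<phi>)"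
  shows "T \<in> B'_AAA"
proof -
  have "\<forall>j. \<exists>g q. j \<le> k \<longrightarrow> g \<in> AA \<and> q \<in> C0_half_line \<and> (\<forall>t\<ge>0. f j t = g t + q t)"
    using f by (fastforce simp: AAA_def)
  then obtain g q where gq: "\<And>j. j \<le> k \<Longrightarrow> g j \<in> AA" "\<And>j. j \<le> k \<Longrightarrow> q j \<in> C0_half_line"
    "\<And>j t. j \<le> k \<Longrightarrow> t \<ge> 0 \<Longrightarrow> f j t = g j t + q j t"
    by metis
  define p where "p j t = q j (max 0 t)" for j t
  have p: "continuous_on UNIV (p j)" "\<exists>M. \<forall>t. norm (p j t) \<le> M" "(p j \<longlongrightarrow> 0) at_top" if "j \<le> k" for j
  proof -
    have q: "continuous_on {0..} (q j)" "bounded (q j ` {0..})" "(q j \<longlongrightarrow> 0) at_top"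
      using gq(2)[OF that] by (auto simp: C0_half_line_def)
    show "continuous_on UNIV (p j)"
      unfolding p_def by (rule continuous_on_compose2[OF q(1)]) (auto intro!: continuous_intros)
    show "\<exists>M. \<forall>t. norm (p j t) \<le> M"
    proof -
      obtain M where "\<forall>t\<ge>0. norm (q j t) \<le> M" using q(2) by (auto simp: bounded_iff)
      then show ?thesis by (intro exI[of _ M]) (simp add: p_def)
    qed
    have "\<forall>\<^sub>F t in at_top. q j t = p j t"
      using eventually_ge_at_top[of 0] by eventually_elim (simp add: p_def)
    then show "(p j \<longlongrightarrow> 0) at_top" by (rule Lim_transform_eventually[OF q(3)])
  qed
  define A where "A \<phi> = (\<Sum>j\<in>{..k}. (distr_deriv ^^ j) (regular_distr (g j)) \<phi>)" for \<phi>
  define Q where "Q \<phi> = (\<Sum>j\<in>{..k}. (distr_deriv ^^ j) (regular_distr (p j)) \<phi>)" for \<phi>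
  have "(distr_deriv ^^ i) U \<in> B'_AA" if "U \<in> B'_AA" for i and U :: "'x distr"
    using that by (induction i) (auto simp: B'_AA_distr_deriv)
  then have A: "A \<in> B'_AA"
    unfolding A_def by (intro B'_AA_sum) (auto simp: B'_AA_regular gq)
  have "(distr_deriv ^^ i) U \<in> B'_plus_0" if "U \<in> B'_plus_0" for i and U :: "'x distr"
    using that by (induction i) (auto simp: B'_plus_0_distr_deriv)
  moreover have "regular_distr (p j) \<in> B'_plus_0" if "j \<le> k" for j
    using p[OF that] B'_plus_0_regular by blast
  ultimately have Q: "Q \<in> B'_plus_0"
    unfolding Q_def by (intro B'_plus_0_sum) auto
  have "T \<phi> = A \<phi> + Q \<phi>" if \<phi>: "\<phi> \<in> test_D0" for \<phi>
  proof -
    have "regular_distr (f j) (nth_vderiv j \<phi>)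
        = regular_distr (g j) (nth_vderiv j \<phi>) + regular_distr (p j) (nth_vderiv j \<phi>)" if j: "j \<le> k" for j
    proof -
      have D: "nth_vderiv j \<phi> \<in> test_D" by (rule test_D_nth_vderiv[OF test_D0_test_D[OF \<phi>]])
      have "nth_vderiv j \<phi> t *\<^sub>C f j t = nth_vderiv j \<phi> t *\<^sub>C g j t + nth_vderiv j \<phi> t *\<^sub>C p j t" for t
      proof (cases "t \<ge> 0")
        case True
        then show ?thesis using gq(3)[OF j] by (simp add: p_def scaleC.add_right)
      next
        case False
        then show ?thesis using test_D0_zero[OF \<phi>, of t j] by (simp add: scaleC.zero_left)
      qed
      then show ?thesis
        unfolding regular_distr_def
        by (simp add: Henstock_Kurzweil_Integration.integral_add test_D_scaleC_integrable[OF D] p(1)[OF j]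
            AA_continuous[OF gq(1)[OF j]])
    qed
    then show ?thesis
      unfolding rep[OF \<phi>] A_def Q_def distr_deriv_funpow
      by (simp add: sum.distrib[symmetric] scaleR_add_right[symmetric])
  qed
  then show ?thesis using T A Q by (auto simp: B'_AAA_def)
qed

text \<open>By density, the hypothesis extends to the images of test functions under the resolvent, which
  are no longer compactly supported.\<close>

lemma conv_distr_AAA_extend:
  fixes T :: "'x::complex_banach distr"
  assumes T: "T \<in> DL1'" and AAA: "\<And>\<phi>. \<phi> \<in> test_D0 \<Longrightarrow> conv_distr T \<phi> \<in> AAA"
    and \<phi>: "\<phi> \<in> test_D" "\<And>t. t > 0 \<Longrightarrow> \<phi> t = 0"
  shows "(\<lambda>x. T (\<lambda>t. (resolvent ^^ N) \<phi> (t - x))) \<in> AAA"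
proof -
  define v where "v = (resolvent ^^ N) \<phi>"
  have v: "v \<in> DL1" unfolding v_def using \<phi>(1) test_D_subset_DL1 by (intro resolvent_funpow_DL1) blast
  obtain C k where b: "C \<ge> 0" "\<And>\<phi>. \<phi> \<in> DL1 \<Longrightarrow> norm (T \<phi>) \<le> C * DL1_seminorm k \<phi>"
    using DL1'_bound[OF T] by metis
  obtain u where u: "\<And>n. u n \<in> test_D" "\<And>n t. t > 0 \<Longrightarrow> u n t = 0"
    "\<And>k. (\<lambda>n. DL1_seminorm k (\<lambda>t. u n t - v t)) \<longlonglongrightarrow> 0"
    unfolding v_def using resolvent_funpow_approx_test_D[where n = N, OF \<phi>] by blast
  have u': "u n \<in> DL1" for n using u(1) test_D_subset_DL1 by blast
  show ?thesis
    unfolding v_def[symmetric]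
  proof (rule AAA_uniform_limit)
    fix n
    have "(\<lambda>t. u n (- t)) \<in> test_D0"
    proof (rule test_D0I[OF test_D_reflect[OF u(1)]])
      fix t assume "u n (- t) \<noteq> 0"
      then show "t \<ge> 0" using u(2)[of "- t" n] by force
    qed
    from AAA[OF this] show "(\<lambda>x. T (\<lambda>t. u n (t - x))) \<in> AAA"
      by (simp add: conv_distr_def[abs_def])
  next
    have est: "norm (T (\<lambda>t. u n (t - x)) - T (\<lambda>t. v (t - x))) \<le> C * DL1_seminorm k (\<lambda>t. u n t - v t)" for n x
    proof -
      have "norm (T (\<lambda>t. u n (t - x) - v (t - x))) \<le> C * DL1_seminorm k (\<lambda>t. u n (t - x) - v (t - x))"
        by (intro b DL1_diff DL1_translate u' v)
      then show ?thesis
        using DL1_seminorm_translate[OF DL1_diff[OF u' v], of k n x]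
        by (simp add: distr_diff[OF T] DL1_translate u' v)
    qed
    show "uniform_limit UNIV (\<lambda>n x. T (\<lambda>t. u n (t - x))) (\<lambda>x. T (\<lambda>t. v (t - x))) sequentially"
    proof (rule uniform_limitI)
      fix e :: real assume e: "e > 0"
      have "(\<lambda>n. C * DL1_seminorm k (\<lambda>t. u n t - v t)) \<longlonglongrightarrow> C * 0"
        by (intro tendsto_mult_left u)
      then have "\<forall>\<^sub>F n in sequentially. C * DL1_seminorm k (\<lambda>t. u n t - v t) < e"
        by (rule order_tendstoD(2)) (use e in simp)
      then show "\<forall>\<^sub>F n in sequentially. \<forall>x\<in>UNIV. dist (T (\<lambda>t. u n (t - x))) (T (\<lambda>t. v (t - x))) < e"
        by eventually_elim (use est in \<open>auto simp: dist_norm intro: order_le_less_trans\<close>)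
    qed
  qed
qed

text \<open>The function \<open>f\<close> of the structure theorem is a uniform limit of functions that belong to \<open>AAA\<close>
  by the previous lemma.\<close>

lemma conv_distr_AAA_imp_derivatives:
  fixes T :: "'x::complex_banach distr"
  assumes T: "T \<in> DL1'" and AAA: "\<And>\<phi>. \<phi> \<in> test_D0 \<Longrightarrow> conv_distr T \<phi> \<in> AAA"
  shows "\<exists>(k::nat) (f :: nat \<Rightarrow> real \<Rightarrow> 'x). 1 \<le> k \<and> (\<forall>j\<le>k. f j \<in> AAA \<and> bounded (range (f j))) \<and>
    (\<forall>\<phi>\<in>test_D. T \<phi> = (\<Sum>j\<le>k. (distr_deriv ^^ j) (regular_distr (f j)) \<phi>))"
proof -
  obtain N \<kappa> f M where s: "1 \<le> N" "\<And>n. \<kappa> n \<in> test_D" "\<And>n t. t > 0 \<Longrightarrow> \<kappa> n t = 0"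
    "uniform_limit UNIV (\<lambda>n x. T (\<lambda>t. (resolvent ^^ N) (\<kappa> n) (t - x))) f sequentially"
    "continuous_on UNIV f" "\<And>x. norm (f x) \<le> M"
    "\<And>\<phi>. \<phi> \<in> test_D \<Longrightarrow> T \<phi> = regular_distr f ((id_minus_deriv ^^ N) \<phi>)"
    by (rule bounded_distr_structure[OF T]) (blast intro: that)
  have f: "f \<in> AAA"
    by (rule AAA_uniform_limit[OF conv_distr_AAA_extend[OF T AAA s(2,3)] s(4)])
  obtain c where c: "\<And>\<phi>. \<phi> \<in> test_D \<Longrightarrow>
      regular_distr f ((id_minus_deriv ^^ N) \<phi>) = (\<Sum>j\<le>N. c j *\<^sub>R (distr_deriv ^^ j) (regular_distr f) \<phi>)"
    using distr_id_minus_deriv_funpow[OF regular_distr_DL1'[OF s(5,6)], of N] by blast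
  show ?thesis
  proof (intro exI[of _ N] exI[of _ "\<lambda>j x. c j *\<^sub>R f x"] conjI allI impI ballI s(1))
    show "(\<lambda>x. c j *\<^sub>R f x) \<in> AAA" for j by (rule AAA_scaleR[OF f])
    have "norm (c j *\<^sub>R f x) \<le> \<bar>c j\<bar> * M" for j x using s(6)[of x] by (simp add: mult_left_mono)
    then show "bounded (range (\<lambda>x. c j *\<^sub>R f x))" for j unfolding bounded_iff by blast
    show "T \<phi> = (\<Sum>j\<le>N. (distr_deriv ^^ j) (regular_distr (\<lambda>x. c j *\<^sub>R f x)) \<phi>)" if "\<phi> \<in> test_D" for \<phi>
      unfolding s(7)[OF that] c[OF that] distr_deriv_funpow regular_distr_scaleR
      by (simp add: mult.commute[of "c _"])
  qed
qed

text \<open>Mollification with a kernel supported in \<open>[-1/(n+1), 0]\<close> moves \<open>\<phi>\<close> in the seminorm of order \<open>k\<close>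
  by at most \<open>1/(n+1)\<close> times the seminorm of order \<open>k + 1\<close>, which is uniform on bounded sets.\<close>

lemma DL1'_tendsto_mollify:
  fixes T :: "'x::complex_banach distr"
  assumes T: "T \<in> DL1'" and AAA: "\<And>\<phi>. \<phi> \<in> test_D \<Longrightarrow> conv_distr T \<phi> \<in> AAA"
  shows "\<exists>(f :: nat \<Rightarrow> real \<Rightarrow> 'x) (Tn :: nat \<Rightarrow> 'x distr).
    (\<forall>n. f n \<in> smooth_funs \<inter> AAA \<and> Tn n \<in> DL1' \<and> (\<forall>\<phi>\<in>test_D. Tn n \<phi> = regular_distr (f n) \<phi>)) \<and>
    DL1'_tendsto Tn T"
proof -
  obtain C k where b: "C \<ge> 0" "\<And>\<phi>. \<phi> \<in> DL1 \<Longrightarrow> norm (T \<phi>) \<le> C * DL1_seminorm k \<phi>"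
    using DL1'_bound[OF T] by metis
  obtain \<kappa> :: "nat \<Rightarrow> real \<Rightarrow> complex" where \<kappa>: "\<And>n. \<kappa> n \<in> test_D"
    "\<And>n t. \<kappa> n t \<noteq> 0 \<Longrightarrow> - 1 / real (Suc n) \<le> t \<and> t \<le> 0"
    "\<And>n. (\<integral>t. \<kappa> n t \<partial>lborel) = 1" "\<And>n. L1_norm (\<kappa> n) = 1"
    using approximate_identity by metis
  have \<kappa>_DL1: "\<kappa> n \<in> DL1" for n using \<kappa>(1) test_D_subset_DL1 by blast
  have \<kappa>_int: "integrable lborel (\<kappa> n)" for n by (rule DL1_integrable_0[OF \<kappa>_DL1])
  define f where "f n = conv_distr T (\<lambda>t. \<kappa> n (- t))" for n
  define Tn where "Tn n \<phi> = T (conv_fun (\<kappa> n) \<phi>)" for n \<phi>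
  have conv: "conv_fun (\<kappa> n) \<phi> \<in> DL1" if "\<phi> \<in> DL1" for n \<phi> by (rule conv_fun_DL1[OF \<kappa>_int that])
  have "f n \<in> smooth_funs" for n
    unfolding f_def by (rule conv_distr_smooth[OF T DL1_reflect[OF \<kappa>_DL1]])
  moreover have "f n \<in> AAA" for n
    unfolding f_def by (rule AAA[OF test_D_reflect[OF \<kappa>(1)]])
  moreover have "Tn n \<in> DL1'" for n
  proof (rule DL1'I)
    fix \<phi> :: "real \<Rightarrow> complex" assume \<phi>: "\<phi> \<in> DL1"
    show "Tn n (\<lambda>t. \<phi> t + \<psi> t) = Tn n \<phi> + Tn n \<psi>" if "\<psi> \<in> DL1" for \<psi>
      unfolding Tn_def conv_fun_add_right[OF \<kappa>_int \<phi> that] by (rule distr_add[OF T conv[OF \<phi>] conv[OF that]])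
    show "Tn n (\<lambda>t. c * \<phi> t) = c *\<^sub>C Tn n \<phi>" for c
      unfolding Tn_def conv_fun_cmult_right by (rule distr_cmult[OF T conv[OF \<phi>]])
    have "C * DL1_seminorm k (conv_fun (\<kappa> n) \<phi>) \<le> C * DL1_seminorm k \<phi>"
      using DL1_seminorm_conv_fun_le[OF \<kappa>_int \<phi>, where k = k] by (intro mult_left_mono b) (simp add: \<kappa>)
    then show "norm (Tn n \<phi>) \<le> C * DL1_seminorm k \<phi>"
      unfolding Tn_def by (rule order_trans[OF b(2)[OF conv[OF \<phi>]]])
  qed
  moreover have "Tn n \<phi> = regular_distr (f n) \<phi>" if \<phi>: "\<phi> \<in> test_D" for n \<phi>
  proof -
    obtain R where R: "R > 0" "\<And>j t. \<bar>t\<bar> \<ge> R \<Longrightarrow> nth_vderiv j \<phi> t = 0"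
      using test_DE[OF \<phi>] by metis
    show ?thesis
      using integral_translates_eq_conv_fun[OF T \<kappa>_DL1 smooth_continuous[OF test_D_smooth[OF \<phi>]], of R n] R(2)[of _ 0]
      by (simp add: regular_distr_def f_def conv_distr_def Tn_def conv_fun_commute[of \<phi>])
  qed
  moreover have "DL1'_tendsto Tn T"
    unfolding DL1'_tendsto_def
  proof (intro allI impI uniform_limitI)
    fix B and e :: real assume B: "DL1_bounded B" and e: "e > 0"
    obtain K where K: "\<And>\<phi>. \<phi> \<in> B \<Longrightarrow> DL1_seminorm (Suc k) \<phi> \<le> K"
      using B unfolding DL1_bounded_def bdd_above_def by blast
    have est: "norm (Tn n \<phi> - T \<phi>) \<le> C * (1 / real (Suc n) * K)" if "\<phi> \<in> B" for n \<phi>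
    proof -
      have \<phi>: "\<phi> \<in> DL1" using B that by (auto simp: DL1_bounded_def)
      have "norm (Tn n \<phi> - T \<phi>) \<le> C * DL1_seminorm k (\<lambda>t. conv_fun (\<kappa> n) \<phi> t - \<phi> t)"
        unfolding Tn_def distr_diff[OF T conv[OF \<phi>] \<phi>, symmetric] by (intro b DL1_diff conv \<phi>)
      also have "\<dots> \<le> C * (1 / real (Suc n) * DL1_seminorm k (nth_vderiv 1 \<phi>))"
        using \<kappa>(2) by (intro mult_left_mono DL1_seminorm_mollify \<kappa> \<phi> b) auto
      also have "\<dots> \<le> C * (1 / real (Suc n) * K)"
        by (intro mult_left_mono b order_trans[OF DL1_seminorm_deriv_le K[OF that]]) simp
      finally show ?thesis .
    qed
    have "(\<lambda>n. C * (1 / real (Suc n) * K)) \<longlonglongrightarrow> C * (0 * K)"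
      using LIMSEQ_Suc[OF lim_const_over_n[of 1]] by (intro tendsto_mult_left tendsto_mult_right) simp
    then have "\<forall>\<^sub>F n in sequentially. C * (1 / real (Suc n) * K) < e"
      by (rule order_tendstoD(2)) (use e in simp)
    then show "\<forall>\<^sub>F n in sequentially. \<forall>\<phi>\<in>B. dist (Tn n \<phi>) (T \<phi>) < e"
      by eventually_elim (use est in \<open>auto simp: dist_norm intro: order_le_less_trans\<close>)
  qed
  ultimately show ?thesis by blast
qed

text \<open>The translates of a reflected test function form a bounded set, so strong convergence of \<open>Tn\<close>
  is uniform convergence of \<open>Tn * \<phi>\<close>.\<close>

lemma conv_distr_AAA_limit:
  fixes T :: "'x::complex_banach distr"
  assumes Tn: "\<And>n. f n \<in> AAA" "\<And>n. Tn n \<in> DL1'" "\<And>n \<phi>. \<phi> \<in> test_D \<Longrightarrow> Tn n \<phi> = regular_distr (f n) \<phi>"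
    and lim: "DL1'_tendsto Tn T" and \<phi>: "\<phi> \<in> test_D"
  shows "conv_distr T \<phi> \<in> AAA"
proof (rule AAA_uniform_limit)
  show "conv_distr (Tn n) \<phi> \<in> AAA" for n
    by (rule conv_distr_regular_AAA[OF Tn \<phi>])
  have \<phi>': "\<phi> \<in> DL1" using \<phi> test_D_subset_DL1 by blast
  define B where "B = range (\<lambda>x t. \<phi> (x - t))"
  have "DL1_seminorm k (\<lambda>t. \<phi> (x - t)) = DL1_seminorm k \<phi>" for k x
    using DL1_seminorm_translate[OF DL1_reflect[OF \<phi>'], of k x] DL1_seminorm_reflect[OF \<phi>', of k] by simp
  then have "DL1_bounded B"
    using DL1_convolve[OF \<phi>'] by (auto simp: DL1_bounded_def B_def image_image)
  then have "uniform_limit B Tn T sequentially" using lim by (simp add: DL1'_tendsto_def)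
  then show "uniform_limit UNIV (\<lambda>n. conv_distr (Tn n) \<phi>) (conv_distr T \<phi>) sequentially"
    by (simp add: uniform_limit_iff B_def conv_distr_def)
qed

theorem theorem2p4:
  fixes T :: "'x::complex_banach distr"
  assumes nontrivial: "\<exists>x::'x. x \<noteq> 0"
    and T: "T \<in> DL1'"
  shows
    \<comment> \<open>(i) iff (ii)\<close>
    "(T \<in> B'_AAA \<longleftrightarrow> (\<forall>\<phi>\<in>test_D0. conv_distr T \<phi> \<in> AAA))
    \<comment> \<open>(i) iff (iii)\<close>
   \<and> (T \<in> B'_AAA \<longleftrightarrow>
        (\<exists>(k::nat) (f :: nat \<Rightarrow> real \<Rightarrow> 'x). 1 \<le> k \<and> (\<forall>j\<le>k. f j \<in> AAA) \<and>
          (\<forall>\<phi>\<in>test_D0. T \<phi> = (\<Sum>j\<le>k. (distr_deriv ^^ j) (regular_distr (f j)) \<phi>))))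
    \<comment> \<open>(i) iff (iv)\<close>
   \<and> (T \<in> B'_AAA \<longleftrightarrow>
        (\<exists>(k::nat) (f :: nat \<Rightarrow> real \<Rightarrow> 'x). 1 \<le> k \<and>
          (\<forall>j\<le>k. f j \<in> AAA \<and> bounded (range (f j))) \<and>
          (\<forall>\<phi>\<in>test_D0. T \<phi> = (\<Sum>j\<le>k. (distr_deriv ^^ j) (regular_distr (f j)) \<phi>))))
    \<comment> \<open>(i) iff (v)\<close>
   \<and> (T \<in> B'_AAA \<longleftrightarrow>
        (\<exists>S\<in>DL1'. \<exists>(k::nat) (f :: nat \<Rightarrow> real \<Rightarrow> 'x). 1 \<le> k \<and>
          (\<forall>j\<le>k. f j \<in> AAA \<and> bounded (range (f j))) \<and>
          (\<forall>\<phi>\<in>test_D. S \<phi> = (\<Sum>j\<le>k. (distr_deriv ^^ j) (regular_distr (f j)) \<phi>)) \<and>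
          (\<forall>\<phi>\<in>test_D0. S \<phi> = T \<phi>)))
    \<comment> \<open>(i) iff (vi)\<close>
   \<and> (T \<in> B'_AAA \<longleftrightarrow>
        (\<exists>S\<in>DL1'. (\<forall>\<phi>\<in>test_D0. S \<phi> = T \<phi>) \<and> (\<forall>\<phi>\<in>test_D. conv_distr S \<phi> \<in> AAA)))
    \<comment> \<open>(i) iff (vii): \<open>Tn n\<close> is the element of \<open>DL1'\<close> identified with the function \<open>f n\<close>\<close>
   \<and> (T \<in> B'_AAA \<longleftrightarrow>
        (\<exists>(f :: nat \<Rightarrow> real \<Rightarrow> 'x) (Tn :: nat \<Rightarrow> 'x distr).
          (\<forall>n. f n \<in> smooth_funs \<inter> AAA \<and> Tn n \<in> DL1' \<and>
               (\<forall>\<phi>\<in>test_D. Tn n \<phi> = regular_distr (f n) \<phi>)) \<and>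
          DL1'_tendsto Tn T))
    \<comment> \<open>(i) iff (viii)\<close>
   \<and> (T \<in> B'_AAA \<longleftrightarrow> (\<forall>\<phi>\<in>test_D. conv_distr T \<phi> \<in> AAA))"
proof -
  note i_viii = B'_AAA_conv_distr[of T]
  note ii_rep = conv_distr_AAA_imp_derivatives[OF T]
  note iii_i = AAA_derivatives_imp_B'_AAA[OF T]
  have i_ii: "conv_distr T \<phi> \<in> AAA" if "T \<in> B'_AAA" "\<phi> \<in> test_D0" for \<phi>
    using i_viii that test_D0_test_D by blast
  have ii_i: "T \<in> B'_AAA" if AAA: "\<And>\<phi>. \<phi> \<in> test_D0 \<Longrightarrow> conv_distr T \<phi> \<in> AAA"
  proof -
    obtain k and f :: "nat \<Rightarrow> real \<Rightarrow> 'x" where "\<forall>j\<le>k. f j \<in> AAA \<and> bounded (range (f j))"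
      "\<forall>\<phi>\<in>test_D. T \<phi> = (\<Sum>j\<le>k. (distr_deriv ^^ j) (regular_distr (f j)) \<phi>)"
      using ii_rep[OF AAA] by blast
    then show ?thesis using iii_i[of k f] test_D0_test_D by blast
  qed
  show ?thesis
  proof (intro conjI iffI, goal_cases)
    case 1
    then show ?case by (blast intro: i_ii)
  next
    case 2
    then show ?case by (blast intro: ii_i)
  next
    case 3
    from ii_rep[OF i_ii[OF this]] show ?case using test_D0_test_D by blast
  next
    case 4
    then show ?case using iii_i by blast
  next
    case 5
    from ii_rep[OF i_ii[OF this]] show ?case using test_D0_test_D by blast
  next
    case 6
    then show ?case using iii_i by blast
  next
    case 7
    \<comment> \<open>(i) implies (v): the representation of \<open>T\<close> holds on the whole line, so \<open>S = T\<close> works.\<close>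
    then show ?case using ii_rep[OF i_ii] T by (intro bexI[of _ T]) blast+
  next
    case 8
    \<comment> \<open>(v) implies (iv), and hence (i): on the half-line, \<open>T\<close> inherits the representation of \<open>S\<close>.\<close>
    then obtain S k and f :: "nat \<Rightarrow> real \<Rightarrow> 'x" where *: "\<forall>j\<le>k. f j \<in> AAA \<and> bounded (range (f j))"
      "\<forall>\<phi>\<in>test_D. S \<phi> = (\<Sum>j\<le>k. (distr_deriv ^^ j) (regular_distr (f j)) \<phi>)"
      "\<forall>\<phi>\<in>test_D0. S \<phi> = T \<phi>" by blast
    have "T \<phi> = (\<Sum>j\<le>k. (distr_deriv ^^ j) (regular_distr (f j)) \<phi>)" if "\<phi> \<in> test_D0" for \<phi>
      using * that test_D0_test_D by metis
    with * show ?case by (intro iii_i) auto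
  next
    case 9
    \<comment> \<open>(i) implies (vi) with \<open>S = T\<close>; conversely, \<open>S * \<phi>\<close> and \<open>T * \<phi>\<close> eventually coincide.\<close>
    then show ?case using i_viii T by blast
  next
    case 10
    then show ?case using conv_distr_AAA_transfer[OF T] test_D0_test_D by (intro ii_i) blast
  next
    case 11
    then show ?case by (intro DL1'_tendsto_mollify[OF T] i_viii)
  next
    case 12
    then obtain f :: "nat \<Rightarrow> real \<Rightarrow> 'x" and Tn where *: "\<And>n. f n \<in> AAA" "\<And>n. Tn n \<in> DL1'"
      "\<And>n \<phi>. \<phi> \<in> test_D \<Longrightarrow> Tn n \<phi> = regular_distr (f n) \<phi>" "DL1'_tendsto Tn T"
      by blast
    show ?case using conv_distr_AAA_limit[OF *] test_D0_test_D by (intro ii_i) blast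
  next
    case 13
    then show ?case using i_viii by blast
  next
    case 14
    then show ?case using test_D0_test_D by (intro ii_i) blast
  qed
qed

end
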